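(* Let $p$ be an odd prime, $a$ an integer with $\gcd(a,p)=1$, and $r$ an odd positive integer. For $k\ge1$ let $F_k$ be the $k\times k$ matrix with $2$ on the diagonal, $1$ on the first super- and subdiagonal and $0$ elsewhere, and $e_1$ the first standard basis column vector of the appropriate size. (1) If $\left(\frac{-1}{p}\right)=1$ and $\left(\frac{a}{p}\right)=1$, let $q$ be a prime with $q\equiv4\pmod7$ and $\left(\frac{q}{p}\right)=\left(\frac{a}{p}\right)$, $v$ an integer with $7p^rv^2\equiv-1\pmod{4q}$, and $x=\frac{7p^rv^2+12q+1}{28q}$. Then the discriminant module of the positive definite even lattice with Gram matrix $\begin{pmatrix}2qp^r & p^rv & 0\\ p^rv & 2x & e_1^{\mathrm T}\\ 0 & e_1 & F_6\end{pmatrix}$ is isometrically isomorphic to $\underline{A}_{p^r}^a$. (2) If $\left(\frac{-1}{p}\right)=1$ and $\left(\frac{a}{p}\right)=-1$, let $q$ be an odd prime with $q\equiv2\pmod3$ and $\left(\frac{q}{p}\right)=-1$, $v$ an integer with $p^rv^2\equiv-\frac{4q+1}{3}\pmod q$ and $v^2\equiv-\frac{4q+1}{3}\pmod4$, and $x=\frac1{4q}\left(p^rv^2+\frac{4q+1}{3}\right)$. Then the discriminant module of the positive definite even lattice with Gram matrix $\begin{pmatrix}2qp^r & p^rv & 0 & 0\\ p^rv & 2x & 1 & 0\\ 0&1&2&1\\0&0&1&2\end{pmatrix}$ is isometrically isomorphic to $\underline{A}_{p^r}^a$. (3) If $\left(\frac{-1}{p}\right)=-1$ and $\left(\frac{a}{p}\right)=1$,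 then the discriminant module of the positive definite even lattice with Gram matrix $\begin{pmatrix}2p^r & p^r\\ p^r & \frac12\left(p^r-\left(\frac{-1}{p}\right)^r\right)\end{pmatrix}$ is isometrically isomorphic to $\underline{A}_{p^r}^a$. (4) If $\left(\frac{-1}{p}\right)=-1$ and $\left(\frac{a}{p}\right)=-1$, let $q$ be a prime with $q\equiv3\pmod5$ and $\left(\frac{q}{p}\right)=-1$, $v$ an integer with $5p^rv^2\equiv-1\pmod{4q}$, and $x=\frac{5p^rv^2+8q+1}{20q}$. Then the discriminant module of the positive definite even lattice with $6\times6$ Gram matrix $\begin{pmatrix}2qp^r & p^rv & 0\\ p^rv & 2x & e_1^{\mathrm T}\\ 0 & e_1 & F_4\end{pmatrix}$ is isometrically isomorphic to $\underline{A}_{p^r}^a$. Moreover, in each case the rank of the given lattice is the least among all positive definite even lattices whose discriminant module is isometrically isomorphic to $\underline{A}_{p^r}^a$.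
   Context: $\left(\frac{\cdot}{p}\right)$ is the Legendre symbol. A lattice $(L,B)$ is a free $\mathbb{Z}$-module of finite rank with symmetric bilinear $B\colon L\times L\to\mathbb{R}$ whose Gram matrix has nonzero determinant; even means $B(x,y)\in\mathbb{Z}$, $B(x,x)\in2\mathbb{Z}$; positive definite means $B(x,x)>0$ for $x\ne0$. The lattice with Gram matrix $G$ is $\mathbb{Z}^n$ with $B(x,y)=x^{\mathrm T}Gy$. Dual lattice $L^\sharp=\{v\in\mathbb{R}\otimes L: B(v,w)\in\mathbb{Z}\ \forall w\in L\}$; discriminant module $D_L=(L^\sharp/L,\ v+L\mapsto\frac12B(v,v)+\mathbb{Z})$. Finite quadratic modules: finite abelian groups with $Q\colon M\to\mathbb{Q}/\mathbb{Z}$, $Q(nx)=n^2Q(x)$, $Q(x+y)-Q(x)-Q(y)$ bilinear nondegenerate; isometric isomorphism = group isomorphism preserving $Q$. $\underline{A}_{p^r}^a=(\mathbb{Z}/p^r\mathbb{Z},\ x+p^r\mathbb{Z}\mapsto\frac{a}{p^r}x^2+\mathbb{Z})$. *)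

theory Defs
  imports
    "HOL-Number_Theory.Residues"
    "HOL-Algebra.Elementary_Groups"
    "Jordan_Normal_Form.Determinant"
    "Jordan_Normal_Form.VS_Connect"
begin

text \<open>
  A lattice \<open>L\<close> is represented inside a real vector space that is a model of
  \<open>\<real> \<otimes> L\<close>, that is, in which every \<open>\<int>\<close>-basis of \<open>L\<close> is an \<open>\<real>\<close>-basis; the bilinear form
  on \<open>L\<close> is given together with its unique \<open>\<real>\<close>-bilinear extension to that space.
\<close>

record 'v zlattice =
  ambient :: "(real, 'v) module"
  points :: "'v set"
  form :: "'v \<Rightarrow> 'v \<Rightarrow> real"

definition lattice_basis :: "'v zlattice \<Rightarrow> 'v list \<Rightarrow> bool" where
  "lattice_basis L bs \<longleftrightarrow>
     distinct bs \<and> vectorspace.basis class_ring (ambient L) (set bs) \<and>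
     points L = {module.lincomb (ambient L) (\<lambda>b. real_of_int (c b)) (set bs) | c. True}"

definition gram_matrix :: "'v zlattice \<Rightarrow> 'v list \<Rightarrow> real mat" where
  "gram_matrix L bs = mat (length bs) (length bs) (\<lambda>(i, j). form L (bs ! i) (bs ! j))"

definition symmetric_bilinear :: "'v zlattice \<Rightarrow> bool" where
  "symmetric_bilinear L \<longleftrightarrow>
     (\<forall>u\<in>carrier (ambient L). \<forall>v\<in>carrier (ambient L). form L u v = form L v u) \<and>
     (\<forall>u\<in>carrier (ambient L). \<forall>v\<in>carrier (ambient L). \<forall>w\<in>carrier (ambient L).
        form L (u \<oplus>\<^bsub>ambient L\<^esub> v) w = form L u w + form L v w) \<and>
     (\<forall>c. \<forall>u\<in>carrier (ambient L). \<forall>v\<in>carrier (ambient L).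
        form L (c \<odot>\<^bsub>ambient L\<^esub> u) v = c * form L u v)"

definition is_lattice :: "'v zlattice \<Rightarrow> bool" where
  "is_lattice L \<longleftrightarrow>
     vectorspace class_ring (ambient L) \<and> symmetric_bilinear L \<and>
     (\<exists>bs. lattice_basis L bs \<and> det (gram_matrix L bs) \<noteq> 0)"

definition lattice_rank :: "'v zlattice \<Rightarrow> nat" where
  "lattice_rank L = (THE n. \<exists>bs. lattice_basis L bs \<and> length bs = n)"

definition even_lattice :: "'v zlattice \<Rightarrow> bool" where
  "even_lattice L \<longleftrightarrow> is_lattice L \<and>
     (\<forall>x\<in>points L. \<forall>y\<in>points L. form L x y \<in> \<int>) \<and>
     (\<forall>x\<in>points L. \<exists>k::int. form L x x = 2 * real_of_int k)"

definition pos_def_lattice :: "'v zlattice \<Rightarrow> bool" where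
  "pos_def_lattice L \<longleftrightarrow> is_lattice L \<and>
     (\<forall>x\<in>points L. x \<noteq> \<zero>\<^bsub>ambient L\<^esub> \<longrightarrow> form L x x > 0)"

definition dual_lattice :: "'v zlattice \<Rightarrow> 'v set" where
  "dual_lattice L = {v \<in> carrier (ambient L). \<forall>w\<in>points L. form L v w \<in> \<int>}"

text \<open>The class \<open>t + \<int>\<close>; the group \<open>\<rat>/\<int>\<close> is viewed as a subgroup of \<open>\<real>/\<int>\<close>.\<close>

definition mod_ints :: "real \<Rightarrow> real set" where
  "mod_ints t = (+) t ` \<int>"

type_synonym 'm quad_module = "'m monoid \<times> ('m \<Rightarrow> real set)"

text \<open>
  The value of the quadratic map at a coset \<open>X = v + L\<close> is written as a union over the
  representatives of \<open>X\<close>; for an even lattice all the sets in this union coincide.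
\<close>

definition discriminant_module :: "'v zlattice \<Rightarrow> 'v set quad_module" where
  "discriminant_module L =
     ((add_monoid (ambient L))\<lparr>carrier := dual_lattice L\<rparr> Mod points L,
      \<lambda>X. \<Union>v\<in>X. mod_ints (form L v v / 2))"

text \<open>\<open>\<int>/m\<int>\<close> has the representatives \<open>0, \<dots>, m - 1\<close> as its carrier; the quadratic map is
  \<open>x + m\<int> \<mapsto> (a/m) x\<^sup>2 + \<int>\<close>.\<close>

definition A_module :: "nat \<Rightarrow> int \<Rightarrow> int quad_module" where
  "A_module m a =
     (integer_mod_group m, \<lambda>x. mod_ints (real_of_int a / real m * (real_of_int x)\<^sup>2))"

definition isometric :: "'m quad_module \<Rightarrow> 'n quad_module \<Rightarrow> bool" where
  "isometric M N \<longleftrightarrow>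
     (\<exists>\<phi>\<in>iso (fst M) (fst N). \<forall>x\<in>carrier (fst M). snd N (\<phi> x) = snd M x)"

definition gram_lattice :: "real mat \<Rightarrow> real vec zlattice" where
  "gram_lattice G =
     \<lparr>ambient = module_vec TYPE(real) (dim_row G),
      points = {x \<in> carrier_vec (dim_row G). \<forall>i<dim_row G. x $ i \<in> \<int>},
      form = (\<lambda>x y. x \<bullet> (G *\<^sub>v y))\<rparr>"

definition F_mat :: "nat \<Rightarrow> real mat" where
  "F_mat k = mat k k (\<lambda>(i, j). if i = j then 2 else if j = Suc i \<or> i = Suc j then 1 else 0)"

text \<open>
  The matrix with diagonal blocks \<open>((\<alpha>, \<beta>), (\<beta>, \<gamma>))\<close> and \<open>F\<^sub>k\<close>, whose upper right block
  has the rows \<open>0\<close> and \<open>e\<^sub>1\<^sup>T\<close>.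
\<close>

definition bordered_F_mat :: "nat \<Rightarrow> real \<Rightarrow> real \<Rightarrow> real \<Rightarrow> real mat" where
  "bordered_F_mat k \<alpha> \<beta> \<gamma> =
     four_block_mat
       (mat_of_rows_list 2 [[\<alpha>, \<beta>], [\<beta>, \<gamma>]])
       (mat_of_rows k [0\<^sub>v k, unit_vec k 0])
       (mat_of_cols k [0\<^sub>v k, unit_vec k 0])
       (F_mat k)"

end

theory Submission
  imports
    "HOL-Complex_Analysis.Cauchy_Integral_Formula"
    "HOL-Number_Theory.Euler_Criterion"
    Defs
begin

text \<open>
  For a positive definite even lattice \<open>L\<close> with \<open>D\<^sub>L \<cong> A\<^sub>P\<^sup>a\<close>, Milgram's formula says that the Gauss sum
  \<open>\<Sum>\<^sub>x e(a x\<^sup>2 / P)\<close> is a positive multiple of \<open>e(rank L / 8)\<close>; hence the ranks of all such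
  lattices agree modulo 8, and since they are positive, a rank between 1 and 8 is minimal.
  Milgram's formula follows from the evaluation \<open>\<Sum>\<^sub>x e(x\<^sup>2 / 4m) = (1 + \<i>) \<surd>m\<close>, over \<open>x\<close> modulo \<open>2m\<close>,
  by passing to a sublattice with an orthogonal basis.

  All four Gram matrices have the shape \<open>bordered_F_mat k (2qP) (Pv) (2x)\<close> with \<open>k = 6, 2, 0, 4\<close> (in the
  third case \<open>q = v = 1\<close>) and satisfy \<open>2q (2x (k + 1) - k) - P v\<^sup>2 (k + 1) = 1\<close>. This identity makes
  the form positive definite and shows that the dual lattice is generated by the lattice and \<open>e\<^sub>0 / P\<close>,
  on which the quadratic form takes the value \<open>q / P\<close>; and \<open>q\<close> is \<open>a\<close> times a square modulo \<open>P\<close>.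
\<close>

section \<open>Quadratic Gauss sums\<close>

text \<open>The absolute value of a quadratic Gauss sum is elementary; the rank modulo 8 sits in its
  phase, and this is what the analysis is for. The sum of \<open>A_module P a\<close> is never
  evaluated: it only serves to compare two lattices. Origin of the identity: \<open>F_mat k\<close>
  has determinant \<open>k + 1\<close>, and its inverse has corner entry \<open>k / (k + 1)\<close>.
  With \<alpha> = 2qP, \<beta> = Pv, \<gamma> = 2x the Gram determinant is therefore \<open>(k + 1)
  * (\<alpha> * (\<gamma> - k / (k + 1)) - \<beta>\<^sup>2)\<close>, and the identity says that it
  equals \<open>P\<close>. Solved for \<open>x\<close> it reads
  \<open>4q (k + 1) x = (k + 1) P v\<^sup>2 + 2qk + 1\<close>, which is the given formula for
  \<open>x\<close>, and \<open>4x = P + 1\<close> when \<open>k = 0\<close>,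
  \<open>q = v = 1\<close>. Integrality of \<open>x\<close> splits into a condition on
  \<open>v\<close> modulo \<open>4q\<close> and one on \<open>q\<close> modulo \<open>k + 1\<close>:
  \<open>12q + 1\<close>, \<open>4q + 1\<close>, \<open>8q + 1\<close> are divisible by 7, 3, 5 when
  \<open>q\<close> is congruent to 4, 2, 3. For \<open>k = 0\<close> it is the congruence of
  \<open>P\<close> to 3 modulo 4.\<close>

definition unit_exp :: "complex \<Rightarrow> complex" where
  "unit_exp z = exp (2 * of_real pi * \<i> * z)"

lemma unit_exp_0 [simp]: "unit_exp 0 = 1"
  by (simp add: unit_exp_def)

lemma unit_exp_add: "unit_exp (z + w) = unit_exp z * unit_exp w"
  by (simp add: unit_exp_def algebra_simps exp_add)

lemma unit_exp_Ints: "z \<in> \<int> \<Longrightarrow> unit_exp z = 1"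
  unfolding unit_exp_def by (elim Ints_cases) (auto simp: exp_eq_1 mult_ac)

lemma unit_exp_eq_1_iff: "unit_exp z = 1 \<longleftrightarrow> z \<in> \<int>"
proof
  assume "unit_exp z = 1"
  then obtain n :: int where n: "Re (2 * of_real pi * \<i> * z) = 0"
      "Im (2 * of_real pi * \<i> * z) = of_int (2 * n) * pi"
    unfolding unit_exp_def exp_eq_1 by auto
  then have "z = of_int n"
    by (auto simp: complex_eq_iff)
  then show "z \<in> \<int>" by simp
qed (rule unit_exp_Ints)

lemma unit_exp_sum: "unit_exp (\<Sum>i\<in>A. f i) = (\<Prod>i\<in>A. unit_exp (f i))"
  by (induction A rule: infinite_finite_induct) (auto simp: unit_exp_add)

lemma norm_unit_exp_real: "z \<in> \<real> \<Longrightarrow> norm (unit_exp z) = 1"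
  by (auto simp: unit_exp_def elim!: Reals_cases)

lemma unit_exp_nonzero [simp]: "unit_exp z \<noteq> 0"
  by (simp add: unit_exp_def)

lemma unit_exp_has_field_derivative [derivative_intros]:
  assumes "(f has_field_derivative f') (at z within S)"
  shows "((\<lambda>z. unit_exp (f z)) has_field_derivative
           2 * of_real pi * \<i> * f' * unit_exp (f z)) (at z within S)"
  unfolding unit_exp_def by (rule derivative_eq_intros refl assms | simp)+

lemma holomorphic_on_unit_exp [holomorphic_intros]:
  assumes "f holomorphic_on S"
  shows "(\<lambda>z. unit_exp (f z)) holomorphic_on S"
  unfolding unit_exp_def by (intro holomorphic_intros assms)

section \<open>Dividing by e(z) - 1 along the segment from 0 to 1\<close>

lemma holomorphic_factor_zero:
  assumes "f holomorphic_on UNIV" "f a = 0"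
  obtains h where "h holomorphic_on UNIV" "\<And>z. f z = (z - a) * h z" "h a = deriv f a"
proof
  show "(\<lambda>z. if z = a then deriv f a else (f z - f a) / (z - a)) holomorphic_on UNIV"
    by (rule pole_lemma_open) (use assms in auto)
qed (use assms in auto)

lemma entire_primitive:
  assumes "f holomorphic_on UNIV"
  obtains F where "\<And>z. (F has_field_derivative f z) (at z)" "F 0 = (0::complex)"
proof -
  obtain g where g: "\<And>z. (g has_field_derivative f z) (at z)"
    using holomorphic_convex_primitive'[of UNIV f] assms by auto
  show ?thesis
  proof
    show "((\<lambda>z. g z - g 0) has_field_derivative f z) (at z)" for z
      by (rule derivative_eq_intros g refl | simp)+
  qed auto
qed

text \<open>The derivative of \<open>unit_exp\<close> vanishes nowhere, so the zeros of
  \<open>unit_exp z - 1\<close> at 0 and 1 are simple: once one linear factor is split off for each,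
  the cofactor vanishes at neither point.\<close>

lemma unit_exp_minus_1_factor:
  obtains h where "h holomorphic_on UNIV" "\<And>z. unit_exp z - 1 = z * (z - 1) * h z"
    "h 0 \<noteq> 0" "h 1 \<noteq> 0"
proof -
  let ?f = "\<lambda>z. unit_exp z - 1"
  have f: "?f holomorphic_on UNIV" by (intro holomorphic_intros)
  have df: "deriv ?f z = 2 * of_real pi * \<i> * unit_exp z" for z
    by (rule DERIV_imp_deriv) (rule derivative_eq_intros refl | simp)+
  obtain g where g: "g holomorphic_on UNIV" "\<And>z. ?f z = (z - 0) * g z" "g 0 = deriv ?f 0"
    using holomorphic_factor_zero[OF f, of 0] by auto
  have g1: "g 1 = 0" using g(2)[of 1] by (simp add: unit_exp_Ints)
  obtain h where h: "h holomorphic_on UNIV" "\<And>z. g z = (z - 1) * h z" "h 1 = deriv g 1"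
    using holomorphic_factor_zero[OF g(1) g1] by metis
  \<comment> \<open>Since \<open>g 1 = 0\<close>, the product rule at 1 leaves only
    \<open>deriv g 1\<close>, which is thus the nonzero derivative of \<open>unit_exp\<close> at
    1.\<close>
  have "((\<lambda>z. z * g z) has_field_derivative deriv g 1 * 1 + 1 * g 1) (at 1)"
    using g(1) by (intro derivative_eq_intros refl) (auto simp: holomorphic_derivI)
  moreover have "(\<lambda>z. z * g z) = ?f" using g(2) by auto
  ultimately have "deriv ?f 1 = deriv g 1" using g1 DERIV_imp_deriv by fastforce
  then have "h 1 \<noteq> 0" using h(3) df[of 1]
    by (metis mult_eq_0_iff unit_exp_nonzero pi_neq_zero of_real_eq_0_iff complex_i_not_zero zero_neq_numeral)
  moreover have "h 0 \<noteq> 0" using h(2)[of 0] g(3) df[of 0] by auto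
  ultimately show ?thesis using that[OF h(1)] g(2) h(2) by simp
qed

text \<open>Supplies the regularity needed in Dirichlet's argument: equal values at 0 and 1 cancel
  both zeros of the denominator, so the quotient \<open>k\<close> is holomorphic and
  \<open>deriv k\<close> is bounded on the segment. All other zeros of \<open>unit_exp z - 1\<close>
  are integers off the segment; hence only a neighbourhood \<open>U\<close> is claimed.\<close>

lemma divide_unit_exp_minus_1:
  assumes "H holomorphic_on UNIV" "H 0 = g" "H 1 = g"
  obtains k U where "open U" "k holomorphic_on U" "closed_segment 0 (1::complex) \<subseteq> U"
    "\<And>z. z \<in> U \<Longrightarrow> H z - g = k z * (unit_exp z - 1)"
proof -
  let ?f = "\<lambda>z. H z - g"
  have f: "?f holomorphic_on UNIV" using assms by (intro holomorphic_intros)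
  obtain f1 where f1: "f1 holomorphic_on UNIV" "\<And>z. ?f z = (z - 0) * f1 z"
    using holomorphic_factor_zero[OF f, of 0] assms by auto
  have "f1 1 = 0" using f1(2)[of 1] assms by simp
  then obtain f2 where f2: "f2 holomorphic_on UNIV" "\<And>z. f1 z = (z - 1) * f2 z"
    using holomorphic_factor_zero[OF f1(1)] by metis
  obtain h where h: "h holomorphic_on UNIV" "\<And>z. unit_exp z - 1 = z * (z - 1) * h z"
    "h 0 \<noteq> 0" "h 1 \<noteq> 0" using unit_exp_minus_1_factor by metis
  define U where "U = {z. h z \<noteq> 0}"
  show ?thesis
  proof
    have "continuous_on UNIV h" using h(1) by (rule holomorphic_on_imp_continuous_on)
    then show "open U" unfolding U_def
      by (intro open_Collect_neq) auto
    show "(\<lambda>z. f2 z / h z) holomorphic_on U"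
      by (intro holomorphic_intros) (use f2(1) h(1) U_def in \<open>auto intro: holomorphic_on_subset\<close>)
    show "closed_segment 0 (1::complex) \<subseteq> U"
    proof
      fix z :: complex assume "z \<in> closed_segment 0 1"
      then obtain u where u: "z = of_real u" "0 \<le> u" "u \<le> 1"
        by (auto simp: in_segment scaleR_conv_of_real)
      show "z \<in> U"
      proof (cases "u = 0 \<or> u = 1")
        case True then show ?thesis using u h by (auto simp: U_def)
      next
        case False
        have "z \<notin> \<int>"
        proof
          assume "z \<in> \<int>"
          then obtain n where "z = of_int n" by (auto elim: Ints_cases)
          then have "u = of_int n" using u(1)
            by (metis of_real_eq_iff of_real_of_int_eq)
          then show False using u False by auto
        qed
        then have "unit_exp z - 1 \<noteq> 0" by (simp add: unit_exp_eq_1_iff)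
        then show ?thesis using h(2)[of z] by (auto simp: U_def)
      qed
    qed
    show "H z - g = f2 z / h z * (unit_exp z - 1)" if "z \<in> U" for z
      using that f1(2)[of z] f2(2)[of z] h(2)[of z] by (simp add: U_def)
  qed
qed

section \<open>Theta sums and their Fourier series\<close>

definition theta_sum :: "nat \<Rightarrow> complex \<Rightarrow> complex" where
  "theta_sum m z = (\<Sum>x<2*m. unit_exp ((of_nat x + z)\<^sup>2 / (4 * of_nat m)))"

text \<open>The shift by 1 telescopes, and the last term is compared with the first by
  \<open>(2m + z)^2 / 4m = z^2 / 4m + z + m\<close>. At \<open>z = 0\<close> the correction
  vanishes, so the Gauss sum is the common value at 0 and 1.\<close>

lemma theta_sum_plus_1:
  assumes "m > 0"
  shows "theta_sum m (z + 1) = theta_sum m z + unit_exp (z\<^sup>2 / (4 * of_nat m)) * (unit_exp z - 1)"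
proof -
  let ?u = "\<lambda>x. unit_exp ((of_nat x + z)\<^sup>2 / (4 * of_nat m))"
  have "theta_sum m (z + 1) - theta_sum m z = (\<Sum>x<2*m. ?u (Suc x) - ?u x)"
    by (simp add: theta_sum_def sum_subtractf add_ac)
  also have "\<dots> = ?u (2*m) - ?u 0" by (rule sum_lessThan_telescope)
  also have "(of_nat (2*m) + z)\<^sup>2 / (4 * of_nat m) = z\<^sup>2 / (4 * of_nat m) + (z + of_nat m)"
    using assms by (simp add: power2_eq_square field_simps)
  finally show ?thesis by (simp add: unit_exp_add unit_exp_Ints algebra_simps)
qed

lemma theta_sum_holomorphic: "theta_sum m holomorphic_on A"
  unfolding theta_sum_def [abs_def] by (intro holomorphic_intros) auto

text \<open>Completing the square: a frequency \<open>n\<close> is absorbed by moving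
  \<open>x\<close> to \<open>x + 2mn\<close>, up to the integer \<open>xn + mn^2\<close>. Fourier
  coefficients thereby become integrals of one fixed function over unit intervals that tile the
  line.\<close>

lemma theta_sum_mult_unit_exp:
  assumes "m > 0"
  shows "theta_sum m z * unit_exp (of_int n * z) =
    (\<Sum>x<2*m. unit_exp ((of_nat x + 2 * of_nat m * of_int n + z)\<^sup>2 / (4 * of_nat m)))"
proof -
  have "unit_exp ((of_nat x + 2 * of_nat m * of_int n + z)\<^sup>2 / (4 * of_nat m)) =
     unit_exp ((of_nat x + z)\<^sup>2 / (4 * of_nat m)) * unit_exp (of_int n * z)" for x
  proof -
    have "(of_nat x + 2 * of_nat m * of_int n + z)\<^sup>2 / (4 * of_nat m) =
      (of_nat x + z)\<^sup>2 / (4 * of_nat m) + (of_int n * z + of_int (int x * n + int m * n * n))"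
      using assms by (simp add: power2_eq_square field_simps)
    then show ?thesis by (simp only: unit_exp_add unit_exp_Ints[OF Ints_of_int] mult_1_right)
  qed
  then show ?thesis by (simp add: theta_sum_def sum_distrib_right)
qed

text \<open>Dirichlet's method: the \<open>N\<close>-th symmetric partial sum of the Fourier series of
  \<open>theta_sum m\<close> on \<open>[0, 1]\<close> at \<open>0\<close> telescopes to a difference of values of the primitive
  \<open>\<Phi>\<close>.  Working with primitives, integration by parts becomes the mean value inequality.\<close>

lemma theta_sum_fourier:
  assumes m: "m > 0" and \<Phi>: "\<And>z. (\<Phi> has_field_derivative unit_exp (z\<^sup>2 / (4 * of_nat m))) (at z)"
  shows "(\<lambda>N. \<Phi> (of_nat (2 * m * Suc N)) - \<Phi> (- of_nat (2 * m * N))) \<longlonglongrightarrow> theta_sum m 0"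
proof -
  define g where "g = theta_sum m 0"
  have g1: "theta_sum m 1 = g" using theta_sum_plus_1[OF m, of 0] by (simp add: g_def)
  obtain k U where U: "open U" and k: "k holomorphic_on U" and sub: "closed_segment 0 1 \<subseteq> U"
    and keq: "\<And>z. z \<in> U \<Longrightarrow> theta_sum m z - g = k z * (unit_exp z - 1)"
    using divide_unit_exp_minus_1[of "theta_sum m" g] theta_sum_holomorphic g1 g_def by metis
  have "compact (closed_segment (0::complex) 1)" by simp
  moreover have "continuous_on (closed_segment 0 1) (deriv k)"
    using holomorphic_on_imp_continuous_on[OF holomorphic_deriv[OF k U]] sub
    by (rule continuous_on_subset)
  ultimately have "bounded (deriv k ` closed_segment 0 1)"
    by (intro compact_imp_bounded compact_continuous_image)
  then obtain C where C: "C > 0" "\<And>z. z \<in> closed_segment 0 1 \<Longrightarrow> norm (deriv k z) \<le> C"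
    by (auto simp: bounded_pos)
  \<comment> \<open>Let \<open>K\<close> be the Dirichlet kernel with frequencies
    \<open>j - N\<close>, from \<open>-N\<close> to \<open>N\<close>. Then \<open>b N\<close>,
    \<open>A N\<close>, \<open>E N\<close> are primitives of \<open>K z * (unit_exp z - 1)\<close>,
    of \<open>theta_sum m z * K z\<close> and of \<open>K z\<close>. Division by \<open>N\<close>
    makes \<open>b\<close> meaningful only for positive \<open>N\<close>.\<close>
  define b where "b N z = unit_exp (of_nat (Suc N) * z) / (2 * of_real pi * \<i> * of_nat (Suc N))
      + unit_exp (- of_nat N * z) / (2 * of_real pi * \<i> * of_nat N)" for N z
  define A where "A N z = (\<Sum>j<2*N+1. \<Sum>x<2*m.
      \<Phi> (of_nat x + 2 * of_nat m * of_int (int j - int N) + z))" for N z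
  define E where "E N z = (\<Sum>j<2*N+1. if j = N then z else
      unit_exp (of_int (int j - int N) * z) / (2 * of_real pi * \<i> * of_int (int j - int N)))" for N z
  \<comment> \<open>Integration by parts without integrals: as
    \<open>theta_sum m z - g = k z * (unit_exp z - 1)\<close>, all terms with the kernel cancel in
    the derivative of \<open>W N\<close>, leaving \<open>- deriv k z * b N z\<close>, of size
    \<open>1 / N\<close>.\<close>
  define W where "W N z = A N z - g * E N z - k z * b N z" for N z
  have bn: "norm (b N z) \<le> 1 / N" if "N > 0" "z \<in> closed_segment 0 1" for N z
  proof -
    have "z \<in> \<real>" using that by (auto simp: in_segment scaleR_conv_of_real)
    then have "norm (unit_exp (of_nat (Suc N) * z)) = 1" "norm (unit_exp (- of_nat N * z)) = 1"
      by (auto intro!: norm_unit_exp_real)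
    then have "norm (b N z) \<le> 1 / (2 * pi * Suc N) + 1 / (2 * pi * N)"
      unfolding b_def by (intro order.trans[OF norm_triangle_ineq])
        (simp add: norm_divide norm_mult del: of_nat_Suc)
    also have "\<dots> \<le> 1 / (2 * 1 * real N) + 1 / (2 * 1 * real N)"
    proof (intro add_mono divide_left_mono)
      show "2 * 1 * real N \<le> 2 * pi * Suc N" "2 * 1 * real N \<le> 2 * pi * N"
        using pi_gt3 by (intro mult_mono; simp)+
    qed (use that in auto)
    finally show ?thesis using that by (simp add: field_simps)
  qed
  have W': "(W N has_field_derivative - deriv k z * b N z) (at z)" if "N > 0" "z \<in> U" for N z
  proof -
    have dA: "(A N has_field_derivative (\<Sum>j<2*N+1. theta_sum m z * unit_exp (of_int (int j - int N) * z))) (at z)"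
      unfolding A_def theta_sum_mult_unit_exp[OF m]
      by (rule derivative_eq_intros DERIV_chain2[OF \<Phi>] refl | simp)+
    have dE: "(E N has_field_derivative (\<Sum>j<2*N+1. unit_exp (of_int (int j - int N) * z))) (at z)"
      unfolding E_def
    proof (rule DERIV_sum)
      fix j
      show "((\<lambda>z. if j = N then z else
        unit_exp (of_int (int j - int N) * z) / (2 * of_real pi * \<i> * of_int (int j - int N)))
         has_field_derivative unit_exp (of_int (int j - int N) * z)) (at z)"
      proof (cases "j = N")
        case False
        then have "(of_int (int j - int N) :: complex) \<noteq> 0"
          by (metis of_int_eq_0_iff eq_iff_diff_eq_0 of_nat_eq_iff)
        with False show ?thesis
          by (simp del: of_int_diff) (rule derivative_eq_intros refl | simp del: of_int_diff)+
      qed auto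
    qed
    have dk: "(k has_field_derivative deriv k z) (at z)"
      using holomorphic_derivI[OF k U that(2)] .
    have db: "(b N has_field_derivative (unit_exp (of_nat (Suc N) * z) - unit_exp (- of_nat N * z))) (at z)"
      unfolding b_def
      by (rule derivative_eq_intros refl | use that in \<open>simp del: of_nat_Suc\<close>)+
    have geom: "(\<Sum>j<2*N+1. unit_exp (of_int (int j - int N) * z)) * (unit_exp z - 1) =
        unit_exp (of_nat (Suc N) * z) - unit_exp (- of_nat N * z)"
    proof -
      have "(\<Sum>j<2*N+1. unit_exp (of_int (int j - int N) * z)) * (unit_exp z - 1) =
        (\<Sum>j<2*N+1. unit_exp (of_int (int (Suc j) - int N) * z) - unit_exp (of_int (int j - int N) * z))"
        unfolding sum_distrib_right
        by (intro sum.cong refl) (simp add: unit_exp_add[symmetric] algebra_simps)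
      also have "\<dots> = unit_exp (of_int (int (2*N+1) - int N) * z) - unit_exp (of_int (int 0 - int N) * z)"
        by (rule sum_lessThan_telescope)
      finally show ?thesis by (simp add: add.commute)
    qed
    have "(W N has_field_derivative (\<Sum>j<2*N+1. theta_sum m z * unit_exp (of_int (int j - int N) * z))
        - g * (\<Sum>j<2*N+1. unit_exp (of_int (int j - int N) * z))
        - (deriv k z * b N z + (unit_exp (of_nat (Suc N) * z) - unit_exp (- of_nat N * z)) * k z)) (at z)"
      unfolding W_def
      by (intro derivative_intros DERIV_cmult dA dE dk db DERIV_mult)
    also have "(\<Sum>j<2*N+1. theta_sum m z * unit_exp (of_int (int j - int N) * z))
        - g * (\<Sum>j<2*N+1. unit_exp (of_int (int j - int N) * z))
        - (deriv k z * b N z + (unit_exp (of_nat (Suc N) * z) - unit_exp (- of_nat N * z)) * k z)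
      = (\<Sum>j<2*N+1. unit_exp (of_int (int j - int N) * z)) * (theta_sum m z - g)
        - (deriv k z * b N z + (\<Sum>j<2*N+1. unit_exp (of_int (int j - int N) * z)) * (unit_exp z - 1) * k z)"
      unfolding geom by (simp only: sum_distrib_left[symmetric]) (simp add: algebra_simps)
    also have "\<dots> = - deriv k z * b N z"
      unfolding keq[OF that(2)] by (simp only: mult_ac) simp
    finally show ?thesis .
  qed
  have bound: "norm (W N 1 - W N 0) \<le> C / N" if N: "N > 0" for N
  proof -
    have "norm (W N 1 - W N 0) \<le> C * (1 / N) * norm (1 - 0 :: complex)"
    proof (rule field_differentiable_bound[where S = "closed_segment 0 1"])
      fix z :: complex assume z: "z \<in> closed_segment 0 1"
      show "(W N has_field_derivative - deriv k z * b N z) (at z within closed_segment 0 1)"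
        using W'[OF N] z sub by (blast intro: has_field_derivative_at_within)
      show "norm (- deriv k z * b N z) \<le> C * (1 / N)"
        unfolding norm_mult norm_minus_cancel using C z bn[OF N z] by (intro mult_mono) auto
    qed auto
    then show ?thesis by simp
  qed
  \<comment> \<open>All summands of nonzero frequency are 1-periodic; only the constant term of the
    kernel contributes.\<close>
  have E1: "E N 1 - E N 0 = 1" for N
  proof -
    have "E N 1 - E N 0 = (\<Sum>j<2*N+1. if j = N then 1 else 0)"
      unfolding E_def sum_subtractf[symmetric]
      by (intro sum.cong refl) (simp add: unit_exp_Ints)
    then show ?thesis by simp
  qed
  \<comment> \<open>The unit intervals starting at \<open>x + 2m (j - N)\<close> tile the range from
    \<open>-2mN\<close> to \<open>2m (N + 1)\<close>, so both sums telescope.\<close>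
  have A1: "A N 1 - A N 0 = \<Phi> (of_nat (2 * m * Suc N)) - \<Phi> (- of_nat (2 * m * N))" for N
  proof -
    let ?v = "\<lambda>j. \<Phi> (2 * of_nat m * of_int (int j - int N))"
    have "A N 1 - A N 0 = (\<Sum>j<2*N+1. \<Sum>x<2*m.
       \<Phi> (of_nat (Suc x) + 2 * of_nat m * of_int (int j - int N)) -
       \<Phi> (of_nat x + 2 * of_nat m * of_int (int j - int N)))"
      unfolding A_def by (simp add: sum_subtractf add_ac)
    also have "\<dots> = (\<Sum>j<2*N+1. ?v (Suc j) - ?v j)"
    proof (intro sum.cong refl)
      fix j
      show "(\<Sum>x<2*m. \<Phi> (of_nat (Suc x) + 2 * of_nat m * of_int (int j - int N)) -
          \<Phi> (of_nat x + 2 * of_nat m * of_int (int j - int N))) = ?v (Suc j) - ?v j"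
        by (subst sum_lessThan_telescope) (simp add: algebra_simps)
    qed
    also have "\<dots> = ?v (2*N+1) - ?v 0" by (rule sum_lessThan_telescope)
    finally show ?thesis by (simp add: algebra_simps)
  qed
  have b1: "b N 1 = b N 0" for N
    using unit_exp_Ints[of "1 + of_nat N"] by (simp add: b_def unit_exp_Ints del: of_nat_Suc)
  define X where "X N = \<Phi> (of_nat (2 * m * Suc N)) - \<Phi> (- of_nat (2 * m * N))" for N
  have X: "X N - g = (W N 1 - W N 0) + (k 1 - k 0) * b N 0" for N
    using E1[of N] A1[of N] b1[of N] by (simp add: W_def X_def algebra_simps)
  have "(\<lambda>N. X N - g) \<longlonglongrightarrow> 0"
  proof (rule Lim_null_comparison)
    show "\<forall>\<^sub>F N in sequentially. norm (X N - g) \<le> (C + norm (k 1 - k 0)) / N"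
    proof (rule eventually_sequentiallyI[of 1])
      fix N :: nat assume N: "1 \<le> N"
      have "norm (X N - g) \<le> norm (W N 1 - W N 0) + norm (k 1 - k 0) * norm (b N 0)"
        unfolding X by (rule order.trans[OF norm_triangle_ineq]) (simp add: norm_mult)
      also have "\<dots> \<le> C / N + norm (k 1 - k 0) * (1 / N)"
        using N by (intro add_mono bound mult_left_mono bn) auto
      finally show "norm (X N - g) \<le> (C + norm (k 1 - k 0)) / N"
        by (simp add: add_divide_distrib)
    qed
    show "(\<lambda>N. (C + norm (k 1 - k 0)) / real N) \<longlonglongrightarrow> 0"
      by (rule lim_const_over_n)
  qed
  then show ?thesis unfolding X_def g_def by (rule LIM_zero_cancel)
qed

section \<open>The Fresnel integral and the value of the Gauss sum\<close>

lemma fresnel_increment: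
  assumes \<Psi>: "\<And>z. (\<Psi> has_field_derivative unit_exp (z\<^sup>2)) (at z)"
    and "0 < x" "x \<le> y"
  shows "norm (\<Psi> (of_real y) - \<Psi> (of_real x)) \<le> 2 / x + (y - x) / x\<^sup>2"
proof -
  \<comment> \<open>Integration by parts again: the subtracted term is chosen so that
    \<open>R\<close> has derivative \<open>unit_exp (z^2) / (4 pi \<i> z^2)\<close>, which is at
    most \<open>1 / x^2\<close> beyond \<open>x\<close>. Both boundary terms are at most
    \<open>1 / x\<close>.\<close>
  define R where "R z = \<Psi> z - unit_exp (z\<^sup>2) / (4 * of_real pi * \<i> * z)" for z
  have ne: "norm (unit_exp ((of_real t)\<^sup>2)) = 1" for t :: real
    by (rule norm_unit_exp_real) auto
  have c: "norm (unit_exp ((of_real t)\<^sup>2) / (4 * of_real pi * \<i> * of_real t)) \<le> 1 / x"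
    if "x \<le> t" for t :: real
  proof -
    have "1 * x \<le> (4 * pi) * t" using that assms pi_gt3 by (intro mult_mono) auto
    then have "1 / (4 * pi * t) \<le> 1 / x"
      using assms that by (intro divide_left_mono) auto
    moreover have "norm (unit_exp ((of_real t)\<^sup>2) / (4 * of_real pi * \<i> * of_real t)) = 1 / (4 * pi * t)"
      using that assms unfolding norm_divide norm_mult ne by simp
    ultimately show ?thesis by simp
  qed
  have "norm (R (of_real y) - R (of_real x)) \<le> 1 / x\<^sup>2 * norm (complex_of_real y - of_real x)"
  proof (rule field_differentiable_bound[where S = "closed_segment (of_real x) (of_real y)"])
    fix z :: complex assume "z \<in> closed_segment (of_real x) (of_real y)"
    then obtain t where t: "z = of_real t" "x \<le> t"
      using assms by (auto simp: closed_segment_of_real closed_segment_eq_real_ivl)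
    then have z0: "z \<noteq> 0" using assms by auto
    show "(R has_field_derivative unit_exp (z\<^sup>2) / (4 * of_real pi * \<i> * z\<^sup>2))
      (at z within closed_segment (of_real x) (of_real y))"
      unfolding R_def using z0
      by (auto intro!: derivative_eq_intros has_field_derivative_at_within[OF \<Psi>]
           simp: field_simps power2_eq_square)
    have "1 * x\<^sup>2 \<le> (4 * pi) * t\<^sup>2" using t assms pi_gt3 by (intro mult_mono power_mono) auto
    then have "1 / (4 * pi * t\<^sup>2) \<le> 1 / x\<^sup>2"
      using assms t by (intro divide_left_mono) auto
    then show "norm (unit_exp (z\<^sup>2) / (4 * of_real pi * \<i> * z\<^sup>2)) \<le> 1 / x\<^sup>2"
      unfolding t norm_divide norm_mult ne by (simp add: norm_power)
  qed auto
  also have "norm (complex_of_real y - of_real x) = y - x"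
    using assms by (metis abs_of_nonneg diff_ge_0_iff_ge norm_of_real of_real_diff)
  finally have "norm (R (of_real y) - R (of_real x)) \<le> (y - x) / x\<^sup>2" by simp
  moreover have "\<Psi> (of_real y) - \<Psi> (of_real x) = (R (of_real y) - R (of_real x)) +
      (unit_exp ((of_real y)\<^sup>2) / (4 * of_real pi * \<i> * of_real y) -
       unit_exp ((of_real x)\<^sup>2) / (4 * of_real pi * \<i> * of_real x))"
    by (simp add: R_def)
  moreover have "norm (unit_exp ((of_real y)\<^sup>2) / (4 * of_real pi * \<i> * of_real y) -
       unit_exp ((of_real x)\<^sup>2) / (4 * of_real pi * \<i> * of_real x)) \<le> 1 / x + 1 / x"
    by (rule order.trans[OF norm_triangle_ineq4]) (intro add_mono c; use assms in simp)
  ultimately show ?thesis using norm_triangle_ineq[of "R (of_real y) - R (of_real x)"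
     "unit_exp ((of_real y)\<^sup>2) / (4 * of_real pi * \<i> * of_real y) -
       unit_exp ((of_real x)\<^sup>2) / (4 * of_real pi * \<i> * of_real x)"] by simp
qed

lemma unit_exp_quarter: "unit_exp (1/4) = \<i>"
proof -
  have "2 * of_real pi * \<i> * (1/4) = \<i> * of_real (pi/2)" by simp
  then show ?thesis unfolding unit_exp_def by (metis cis_conv_exp cis_pi_half)
qed

text \<open>The value of the Fresnel integral is never computed: the case \<open>m = 1\<close> provides it.\<close>

lemma fresnel_limit:
  assumes \<Psi>: "\<And>z. (\<Psi> has_field_derivative unit_exp (z\<^sup>2)) (at z)"
    and odd: "\<And>z. \<Psi> (- z) = - \<Psi> z"
  shows "((\<lambda>x. \<Psi> (of_real x)) \<longlongrightarrow> (1 + \<i>) / 4) at_top"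
proof -
  have incr: "norm (\<Psi> (of_real y) - \<Psi> (of_nat n)) \<le> 3 / real n"
    if "n > 0" "real n \<le> y" "y \<le> real n + 1" for n y
  proof -
    have "norm (\<Psi> (of_real y) - \<Psi> (of_real (real n))) \<le> 2 / real n + (y - real n) / (real n)\<^sup>2"
      using that by (intro fresnel_increment \<Psi>) auto
    also have "(y - real n) / (real n)\<^sup>2 \<le> 1 / real n"
    proof -
      have "(y - real n) / (real n)\<^sup>2 \<le> 1 / (real n)\<^sup>2" using that by (intro divide_right_mono) auto
      also have "\<dots> \<le> 1 / real n" using that by (intro divide_left_mono) (auto simp: power2_eq_square)
      finally show ?thesis .
    qed
    finally show ?thesis by simp
  qed
  \<comment> \<open>For \<open>m = 1\<close> the primitive is \<open>2 * \<Psi> (z / 2)\<close>, and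
    by oddness the Fourier limit is that of \<open>2 \<Psi>(N + 1) + 2 \<Psi>(N)\<close>, equal to
    \<open>1 + unit_exp (1/4)\<close>. Since consecutive values get arbitrarily close, the limit of
    \<open>\<Psi>\<close> along the integers follows.\<close>
  have "(\<lambda>N. 2 * \<Psi> (of_nat (2 * 1 * Suc N) / 2) - 2 * \<Psi> (- of_nat (2 * 1 * N) / 2)) \<longlonglongrightarrow> theta_sum 1 0"
    by (rule theta_sum_fourier)
       (auto intro!: derivative_eq_intros DERIV_chain2[OF \<Psi>] simp: power_divide)
  moreover have "theta_sum 1 0 = 1 + \<i>"
    using unit_exp_quarter by (simp add: theta_sum_def numeral_2_eq_2 del: One_nat_def)
  moreover have "complex_of_nat (2 * 1 * n) / 2 = of_nat n"
    "- complex_of_nat (2 * 1 * n) / 2 = - of_nat n" for n by simp_all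
  ultimately have "(\<lambda>N. 2 * \<Psi> (of_nat (Suc N)) + 2 * \<Psi> (of_nat N)) \<longlonglongrightarrow> 1 + \<i>"
    by (simp only: odd mult_minus_right diff_minus_eq_add)
  then have "(\<lambda>N. (2 * \<Psi> (of_nat (Suc N)) + 2 * \<Psi> (of_nat N)) / 4) \<longlonglongrightarrow> (1 + \<i>) / 4"
    by (intro tendsto_divide tendsto_const) auto
  moreover have "(\<lambda>N. \<Psi> (of_nat (Suc N)) - \<Psi> (of_nat N)) \<longlonglongrightarrow> 0"
  proof (rule Lim_null_comparison)
    show "\<forall>\<^sub>F N in sequentially. norm (\<Psi> (of_nat (Suc N)) - \<Psi> (of_nat N)) \<le> 3 / real N"
    proof (rule eventually_sequentiallyI[of 1])
      fix N :: nat assume "1 \<le> N"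
      then show "norm (\<Psi> (of_nat (Suc N)) - \<Psi> (of_nat N)) \<le> 3 / real N"
        using incr[of N "real (Suc N)"] by simp
    qed
  qed (rule lim_const_over_n)
  ultimately have "(\<lambda>N. (2 * \<Psi> (of_nat (Suc N)) + 2 * \<Psi> (of_nat N)) / 4 -
      (\<Psi> (of_nat (Suc N)) - \<Psi> (of_nat N)) / 2) \<longlonglongrightarrow> (1 + \<i>) / 4 - 0 / 2"
    by (intro tendsto_diff tendsto_divide[where b = 2] tendsto_const) auto
  then have lim: "(\<lambda>N. \<Psi> (of_nat N)) \<longlonglongrightarrow> (1 + \<i>) / 4"
    by (simp add: field_simps)
  \<comment> \<open>The limit over the reals is needed because \<open>\<Psi>\<close> will be
    evaluated at multiples of \<open>sqrt m\<close>, which need not be integers.\<close>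
  have fl: "filterlim (\<lambda>x::real. nat \<lfloor>x\<rfloor>) sequentially at_top"
    by (intro filterlim_compose[OF filterlim_nat_sequentially filterlim_floor_sequentially])
  have "((\<lambda>x. \<Psi> (of_real x) - \<Psi> (of_nat (nat \<lfloor>x\<rfloor>))) \<longlongrightarrow> 0) at_top"
  proof (rule Lim_null_comparison)
    show "\<forall>\<^sub>F x in at_top. norm (\<Psi> (of_real x) - \<Psi> (of_nat (nat \<lfloor>x\<rfloor>))) \<le> 3 / real (nat \<lfloor>x\<rfloor>)"
    proof (rule eventually_mono[OF eventually_ge_at_top[of 1]])
      fix x :: real assume "1 \<le> x"
      then show "norm (\<Psi> (of_real x) - \<Psi> (of_nat (nat \<lfloor>x\<rfloor>))) \<le> 3 / real (nat \<lfloor>x\<rfloor>)"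
        by (intro incr) linarith+
    qed
    show "((\<lambda>x::real. 3 / real (nat \<lfloor>x\<rfloor>)) \<longlongrightarrow> 0) at_top"
      by (rule filterlim_compose[OF lim_const_over_n fl])
  qed
  from tendsto_add[OF this filterlim_compose[OF lim fl]] show ?thesis by simp
qed

text \<open>With \<open>s = sqrt m\<close>, the substitution \<open>z = 2 s w\<close> gives the
  primitive \<open>2 s \<Psi>(z / 2s)\<close> for general \<open>m\<close>. Each end of the line
  contributes \<open>2 s (1 + \<i>) / 4\<close>.\<close>

theorem quadratic_gauss_sum:
  assumes m: "m > 0"
  shows "(\<Sum>x<2*m. unit_exp ((of_nat x)\<^sup>2 / (4 * of_nat m))) = (1 + \<i>) * of_real (sqrt (real m))"
proof -
  obtain \<Psi> where \<Psi>: "\<And>z. (\<Psi> has_field_derivative unit_exp (z\<^sup>2)) (at z)" and \<Psi>0: "\<Psi> 0 = 0"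
    by (rule entire_primitive[of "\<lambda>z. unit_exp (z\<^sup>2)"]) (auto intro!: holomorphic_intros)
  have odd: "\<Psi> (- z) = - \<Psi> z" for z
  proof -
    have "((\<lambda>z. \<Psi> (- z) + \<Psi> z) has_field_derivative 0) (at z)" for z
      by (auto intro!: derivative_eq_intros DERIV_chain2[OF \<Psi>] \<Psi>)
    then have "\<exists>c. \<forall>z\<in>UNIV. \<Psi> (- z) + \<Psi> z = c"
      by (intro has_field_derivative_zero_constant) auto
    then show ?thesis using \<Psi>0 by (metis UNIV_I add.inverse_neutral add_0 eq_neg_iff_add_eq_0)
  qed
  define s where "s = sqrt (real m)"
  have s: "s > 0" "complex_of_real s ^ 2 = of_nat m" "real m = s * s"
    using m by (simp_all add: s_def flip: of_real_power)
  have "(\<lambda>N. 2 * of_real s * \<Psi> (of_nat (2 * m * Suc N) / (2 * of_real s))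
      - 2 * of_real s * \<Psi> (- of_nat (2 * m * N) / (2 * of_real s))) \<longlonglongrightarrow> theta_sum m 0"
    using s by (intro theta_sum_fourier m)
       (auto intro!: derivative_eq_intros DERIV_chain2[OF \<Psi>] simp: power_divide power_mult_distrib)
  moreover have e: "complex_of_nat (2 * m * n) / (2 * of_real s) = of_real (s * real n)" for n
    using s by (simp add: field_simps power2_eq_square flip: s(2))
  moreover have "- complex_of_nat (2 * m * n) / (2 * of_real s) = - of_real (s * real n)" for n
    unfolding e[symmetric] by simp
  ultimately have "(\<lambda>N. 2 * of_real s * (\<Psi> (of_real (s * real (Suc N))) + \<Psi> (of_real (s * real N))))
      \<longlonglongrightarrow> theta_sum m 0"
    by (simp only: odd mult_minus_right diff_minus_eq_add distrib_left)
  moreover have lim: "(\<lambda>N. \<Psi> (of_real (s * real N))) \<longlonglongrightarrow> (1 + \<i>) / 4"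
    using s by (intro filterlim_compose[OF fresnel_limit[OF \<Psi> odd]]
       filterlim_tendsto_pos_mult_at_top[OF tendsto_const] filterlim_real_sequentially)
  have "(\<lambda>N. 2 * of_real s * (\<Psi> (of_real (s * real (Suc N))) + \<Psi> (of_real (s * real N))))
      \<longlonglongrightarrow> 2 * of_real s * ((1 + \<i>) / 4 + (1 + \<i>) / 4)"
    by (intro tendsto_intros lim LIMSEQ_Suc[OF lim])
  ultimately have "theta_sum m 0 = 2 * of_real s * ((1 + \<i>) / 4 + (1 + \<i>) / 4)"
    using LIMSEQ_unique by blast
  then show ?thesis by (simp add: theta_sum_def s_def)
qed

section \<open>Milgram formula in coordinates\<close>

text \<open>Representatives of (Z/N)^n. Extensional functions are used so that sums over the box of
  products of one-variable terms factor by \<open>prod_sum_PiE\<close>.\<close>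

definition int_box :: "nat \<Rightarrow> int \<Rightarrow> (nat \<Rightarrow> int) set" where
  "int_box n N = (\<Pi>\<^sub>E j\<in>{..<n}. {0..<N})"

definition box_periodic :: "nat \<Rightarrow> int \<Rightarrow> ((nat \<Rightarrow> int) \<Rightarrow> 'a) \<Rightarrow> bool" where
  "box_periodic n N F \<longleftrightarrow> (\<forall>w w'. (\<forall>j<n. [w j = w' j] (mod N)) \<longrightarrow> F w = F w')"

lemma finite_int_box [simp]: "finite (int_box n N)"
  unfolding int_box_def by (intro finite_PiE) auto

lemma card_int_box: "card (int_box n N) = nat N ^ n"
  by (simp add: int_box_def card_PiE)

lemma int_box_sum_translate:
  assumes "N > 0" "box_periodic n N F"
  shows "(\<Sum>w\<in>int_box n N. F (\<lambda>j. w j + u j)) = (\<Sum>w\<in>int_box n N. F w)"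
proof (rule sum.reindex_bij_witness[where
      i = "\<lambda>w. restrict (\<lambda>j. (w j - u j) mod N) {..<n}" and
      j = "\<lambda>w. restrict (\<lambda>j. (w j + u j) mod N) {..<n}"])
  fix w assume w: "w \<in> int_box n N"
  have r: "w j mod N = w j" if "j < n" for j
    using w that by (auto simp: int_box_def PiE_iff)
  show "restrict (\<lambda>j. (restrict (\<lambda>j. (w j + u j) mod N) {..<n} j - u j) mod N) {..<n} = w"
    "restrict (\<lambda>j. (restrict (\<lambda>j. (w j - u j) mod N) {..<n} j + u j) mod N) {..<n} = w"
    using w r by (auto simp: fun_eq_iff restrict_def mod_simps int_box_def PiE_iff extensional_def)
  show "restrict (\<lambda>j. (w j + u j) mod N) {..<n} \<in> int_box n N"
    "restrict (\<lambda>j. (w j - u j) mod N) {..<n} \<in> int_box n N"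
    using assms(1) by (auto simp: int_box_def)
  show "F (restrict (\<lambda>j. (w j + u j) mod N) {..<n}) = F (\<lambda>j. w j + u j)"
    using assms(2) by (auto simp: box_periodic_def cong_def)
qed

lemma sum_mult_period:
  fixes f :: "nat \<Rightarrow> complex"
  assumes "\<And>x. f (x + d) = f x"
  shows "(\<Sum>x<k * d. f x) = of_nat k * (\<Sum>x<d. f x)"
proof -
  have per: "f (x + i * d) = f x" for x i
  proof (induction i)
    case (Suc i)
    then show ?case using assms[of "x + i * d"] by (simp add: algebra_simps)
  qed simp
  have "(\<Sum>x<k * d. f x) = (\<Sum>i<k. \<Sum>x\<in>{i * d..<i * d + d}. f x)"
    by (rule sum.nat_group[symmetric])
  also have "\<dots> = (\<Sum>i<k. \<Sum>x<d. f (x + i * d))"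
    using sum.shift_bounds_nat_ivl[of f 0 "_ * d" d] by (simp add: lessThan_atLeast0 add.commute)
  finally show ?thesis by (simp add: per)
qed

lemma sum_int_interval: "(\<Sum>x\<in>{0..<int N}. f x) = (\<Sum>x<N. f (int x))"
  by (rule sum.reindex_bij_witness[of _ int nat]) auto

text \<open>Orthogonality of characters of Z/N: \<open>unit_exp y\<close> is an \<open>N\<close>-th
  root of unity, and its geometric sum vanishes unless it is 1.\<close>

lemma sum_unit_exp_multiples:
  fixes y :: real
  assumes "of_nat N * y \<in> \<int>"
  shows "(\<Sum>x<N. unit_exp (of_real (real x * y))) = (if y \<in> \<int> then of_nat N else 0)"
proof (cases "y \<in> \<int>")
  case True
  have "unit_exp (of_real (real x * y)) = 1" for x
    using True by (intro unit_exp_Ints) (auto elim!: Ints_cases)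
  then show ?thesis using True by simp
next
  case False
  let ?z = "unit_exp (of_real y)"
  have pow: "unit_exp (of_real (real x * y)) = ?z ^ x" for x
    by (induction x) (auto simp: algebra_simps unit_exp_add)
  have "of_real y \<notin> (\<int> :: complex set)"
    using False by (metis Ints_cases Ints_of_int of_real_eq_iff of_real_of_int_eq)
  then have "?z \<noteq> 1" by (simp add: unit_exp_eq_1_iff)
  moreover have "?z ^ N = 1"
    unfolding pow[symmetric] using assms by (intro unit_exp_Ints) (auto elim!: Ints_cases simp flip: of_real_mult)
  ultimately show ?thesis unfolding pow using False by (simp add: geometric_sum)
qed

lemma unit_exp_cong:
  fixes x y :: real
  assumes "x - y \<in> \<int>"
  shows "unit_exp (of_real x) = unit_exp (of_real y)"
proof -
  have "of_real x = (of_real y + of_real (x - y) :: complex)" by simp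
  moreover have "of_real (x - y) \<in> (\<int> :: complex set)" using assms
    by (metis Ints_cases Ints_of_int of_real_of_int_eq)
  ultimately show ?thesis by (metis unit_exp_add unit_exp_Ints mult_1_right)
qed

lemma sum_unit_exp_square:
  assumes "m > 0" "2 * m dvd N"
  shows "(\<Sum>x\<in>{0..<int N}. unit_exp (of_real ((real_of_int x)\<^sup>2 / real (2 * (2 * m))))) =
    of_real (real (N div (2 * m)) * sqrt (real m)) * (1 + \<i>)"
proof -
  let ?f = "\<lambda>x::nat. unit_exp ((of_nat x)\<^sup>2 / (4 * of_nat m))"
  have per: "?f (x + 2 * m) = ?f x" for x
  proof -
    have "(of_nat (x + 2 * m))\<^sup>2 / (4 * of_nat m) = (of_nat x)\<^sup>2 / (4 * of_nat m) + (of_nat (x + m) :: complex)"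
      using assms by (simp add: field_simps power2_eq_square)
    then show ?thesis by (simp only: unit_exp_add unit_exp_Ints Ints_of_nat mult_1_right)
  qed
  have "(\<Sum>x\<in>{0..<int N}. unit_exp (of_real ((real_of_int x)\<^sup>2 / real (2 * (2 * m))))) = (\<Sum>x<N. ?f x)"
    by (simp add: sum_int_interval)
  also have "\<dots> = (\<Sum>x<N div (2 * m) * (2 * m). ?f x)" using assms by simp
  also have "\<dots> = of_nat (N div (2 * m)) * (\<Sum>x<2*m. ?f x)"
    by (rule sum_mult_period) (rule per)
  also have "\<dots> = of_nat (N div (2 * m)) * ((1 + \<i>) * of_real (sqrt (real m)))"
    unfolding quadratic_gauss_sum[OF assms(1)] ..
  finally show ?thesis by simp
qed

text \<open>
  The vectors \<open>w\<close> are the coordinates of the dual \<open>N\<^sup>\<sharp>\<close> of a sublattice \<open>N = \<Oplus> \<int>t\<^sub>j\<close> with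
  orthogonal \<open>t\<^sub>j\<close>, namely of \<open>\<Sum> w\<^sub>j t\<^sub>j / d\<^sub>j\<close> with \<open>d\<^sub>j = B(t\<^sub>j, t\<^sub>j)\<close>, and \<open>T j i = B(t\<^sub>j, b\<^sub>i)\<close>
  for a basis \<open>b\<^sub>i\<close> of the lattice \<open>M \<supseteq> N\<close>; the predicate \<open>D\<close> cuts out \<open>M\<^sup>\<sharp>\<close>.
  Averaging the Gauss sum of \<open>N\<^sup>\<sharp>/N\<close>, a product of one-dimensional ones, over translations
  by \<open>M\<close> leaves a sum over \<open>M\<^sup>\<sharp>/N\<close>, a multiple of the Gauss sum of \<open>M\<^sup>\<sharp>/M\<close>.
\<close>

lemma milgram_coordinates:
  fixes m :: "nat \<Rightarrow> nat" and T :: "nat \<Rightarrow> nat \<Rightarrow> int" and P :: nat and a :: int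
    and \<phi> :: "(nat \<Rightarrow> int) \<Rightarrow> int" and n :: nat
  defines "q \<equiv> \<lambda>w :: nat \<Rightarrow> int. \<Sum>j<n. (real_of_int (w j))\<^sup>2 / real (2 * (2 * m j))"
    and "y \<equiv> \<lambda>i (w :: nat \<Rightarrow> int). \<Sum>j<n. real_of_int (w j * T j i) / real (2 * m j)"
  defines "D \<equiv> \<lambda>w. \<forall>i<n. y i w \<in> \<int>"
  assumes m: "\<And>j. j < n \<Longrightarrow> m j > 0"
    and q_lattice: "\<And>u. q (\<lambda>j. \<Sum>i<n. u i * T j i) \<in> \<int>"
    and P: "P > 0"
    and \<phi>_restrict: "\<And>w w'. (\<And>j. j < n \<Longrightarrow> w j = w' j) \<Longrightarrow> \<phi> w = \<phi> w'"
    and \<phi>_add: "\<And>w w'. D w \<Longrightarrow> D w' \<Longrightarrow> [\<phi> (\<lambda>j. w j + w' j) = \<phi> w + \<phi> w'] (mod int P)"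
    and \<phi>_q: "\<And>w. D w \<Longrightarrow> q w - real_of_int (a * (\<phi> w)\<^sup>2) / real P \<in> \<int>"
    and w0: "D w0" "[\<phi> w0 = 1] (mod int P)"
  shows "\<exists>c>0. (\<Sum>k<P. unit_exp (of_real (real_of_int (a * (int k)\<^sup>2) / real P))) =
      of_real c * (1 + \<i>) ^ n"
proof -
  define N0 where "N0 = (\<Prod>j<n. 2 * m j)"
  \<comment> \<open>\<open>N0\<close> clears all denominators \<open>2 * m j\<close>, so that
    multiples of \<open>N0\<close> satisfy \<open>D\<close>. The extra factor \<open>P\<close> makes
    \<phi> vanish modulo \<open>P\<close> on multiples of \<open>N\<close> by additivity
    alone.\<close>
  define N where "N = P * N0"
  define e where "e w = unit_exp (of_real (q w))" for w
  define S where "S = (\<Sum>w\<in>int_box n (int N). e w)"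
  have N0: "N0 > 0" unfolding N0_def using m by (intro prod_pos) auto
  have N: "N > 0" using P N0 by (simp add: N_def)
  have dN0: "2 * m j dvd N0" if "j < n" for j
    unfolding N0_def by (rule dvd_prodI) (use that in auto)
  then have dN: "2 * m j dvd N" if "j < n" for j
    using that by (simp add: N_def)

  have e_prod: "e w = (\<Prod>j<n. unit_exp (of_real ((real_of_int (w j))\<^sup>2 / real (2 * (2 * m j)))))" for w
    unfolding e_def q_def of_real_sum by (rule unit_exp_sum)

  have S_prod: "\<exists>c>0. S = of_real c * (1 + \<i>) ^ n"
  proof (intro exI conjI)
    have "S = (\<Prod>j<n. \<Sum>x\<in>{0..<int N}. unit_exp (of_real ((real_of_int x)\<^sup>2 / real (2 * (2 * m j)))))"
      unfolding S_def e_prod int_box_def by (rule prod_sum_PiE[symmetric]) auto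
    also have "\<dots> = (\<Prod>j<n. of_real (real (N div (2 * m j)) * sqrt (real (m j))) * (1 + \<i>))"
      by (intro prod.cong refl sum_unit_exp_square) (use m dN in auto)
    also have "\<dots> = of_real (\<Prod>j<n. real (N div (2 * m j)) * sqrt (real (m j))) * (1 + \<i>) ^ n"
      by (simp add: prod.distrib)
    finally show "S = of_real (\<Prod>j<n. real (N div (2 * m j)) * sqrt (real (m j))) * (1 + \<i>) ^ n" .
    show "0 < (\<Prod>j<n. real (N div (2 * m j)) * sqrt (real (m j)))"
    proof (intro prod_pos)
      fix j assume "j \<in> {..<n}"
      then show "0 < real (N div (2 * m j)) * sqrt (real (m j))"
        using m[of j] dN[of j] N by (simp add: div_greater_zero_iff dvd_imp_le)
    qed
  qed

  have e_per: "box_periodic n (int N) e"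
    unfolding box_periodic_def
  proof (intro allI impI)
    fix w w' :: "nat \<Rightarrow> int" assume ww: "\<forall>j<n. [w j = w' j] (mod int N)"
    have "unit_exp (of_real ((real_of_int (w j))\<^sup>2 / real (2 * (2 * m j)))) =
        unit_exp (of_real ((real_of_int (w' j))\<^sup>2 / real (2 * (2 * m j))))" if j: "j < n" for j
    proof (rule unit_exp_cong)
      have "int (2 * m j) dvd w j - w' j"
        using dN[OF j] ww j by (metis cong_iff_dvd_diff dvd_trans int_dvd_int_iff)
      then obtain t where "w j - w' j = int (2 * m j) * t" by (rule dvdE)
      then have t: "w j = w' j + 2 * int (m j) * t" by (simp add: algebra_simps)
      have "(real_of_int (w j))\<^sup>2 / real (2 * (2 * m j)) - (real_of_int (w' j))\<^sup>2 / real (2 * (2 * m j))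
         = real_of_int (w' j * t + int (m j) * t * t)"
        unfolding t using m[OF j] by (simp add: field_simps power2_eq_square)
      then show "(real_of_int (w j))\<^sup>2 / real (2 * (2 * m j)) - (real_of_int (w' j))\<^sup>2 / real (2 * (2 * m j)) \<in> \<int>"
        by simp
    qed
    then show "e w = e w'" unfolding e_prod by (intro prod.cong) auto
  qed

  \<comment> \<open>The translation vector represents the lattice vector with coefficients
    \<open>u\<close>. Its own \<open>q\<close> value is integral, so only the bilinear cross term
    survives, and that is linear in \<open>u\<close>.\<close>
  have e_translate: "e (\<lambda>j. w j + (\<Sum>i<n. u i * T j i)) = e w * unit_exp (of_real (\<Sum>i<n. real_of_int (u i) * y i w))"
    for u w
  proof -
    let ?v = "\<lambda>j. \<Sum>i<n. u i * T j i"
    have cross: "(\<Sum>j<n. real_of_int (w j * ?v j) / real (2 * m j)) = (\<Sum>i<n. real_of_int (u i) * y i w)"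
    proof -
      have "(\<Sum>j<n. real_of_int (w j * ?v j) / real (2 * m j)) =
         (\<Sum>j<n. \<Sum>i<n. real_of_int (u i) * (real_of_int (w j * T j i) / real (2 * m j)))"
        by (simp add: sum_distrib_left sum_divide_distrib mult_ac)
      also have "\<dots> = (\<Sum>i<n. \<Sum>j<n. real_of_int (u i) * (real_of_int (w j * T j i) / real (2 * m j)))"
        by (rule sum.swap)
      finally show ?thesis by (simp add: y_def sum_distrib_left)
    qed
    have "q (\<lambda>j. w j + ?v j) = q w + (\<Sum>j<n. real_of_int (w j * ?v j) / real (2 * m j)) + q ?v"
      unfolding q_def sum.distrib[symmetric]
    proof (intro sum.cong refl)
      fix j assume "j \<in> {..<n}"
      then have "m j > 0" using m by auto
      then show "(real_of_int (w j + ?v j))\<^sup>2 / real (2 * (2 * m j)) =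
        (real_of_int (w j))\<^sup>2 / real (2 * (2 * m j)) + real_of_int (w j * ?v j) / real (2 * m j) +
        (real_of_int (?v j))\<^sup>2 / real (2 * (2 * m j))"
        unfolding of_int_add of_int_mult by (simp add: field_simps power2_eq_square)
    qed
    then have "e (\<lambda>j. w j + ?v j) = unit_exp (of_real (q w + (\<Sum>i<n. real_of_int (u i) * y i w)))"
      unfolding e_def by (intro unit_exp_cong) (use q_lattice[of u] cross in auto)
    then show ?thesis by (simp only: e_def of_real_add unit_exp_add)
  qed

  have S_D: "S = (\<Sum>w\<in>int_box n (int N). if D w then e w else 0)"
  proof -
    have Ny: "of_nat N * y i w \<in> \<int>" for i w
    proof -
      have "real N * y i w = (\<Sum>j<n. real_of_int (int (N div (2 * m j)) * w j * T j i))"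
        unfolding y_def sum_distrib_left
      proof (intro sum.cong refl)
        fix j assume "j \<in> {..<n}"
        then have "2 * m j dvd N" "m j > 0" using dN m by auto
        then have "real N = real (N div (2 * m j)) * real (2 * m j)"
          by (metis dvd_div_mult_self of_nat_mult)
        then show "real N * (real_of_int (w j * T j i) / real (2 * m j)) = real_of_int (int (N div (2 * m j)) * w j * T j i)"
          using \<open>m j > 0\<close> by (simp add: field_simps)
      qed
      then show ?thesis by (simp only: Ints_sum Ints_of_int)
    qed
    \<comment> \<open>All \<open>N ^ n\<close> translates of the sum are equal. Summing over
      \<open>u\<close> first gives, for each \<open>w\<close>, a product of character sums, which
      vanishes unless every \<open>y i w\<close> is an integer.\<close>
    have "of_nat (N ^ n) * S = (\<Sum>u\<in>int_box n (int N). S)"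
      by (simp add: card_int_box)
    also have "\<dots> = (\<Sum>u\<in>int_box n (int N). \<Sum>w\<in>int_box n (int N). e (\<lambda>j. w j + (\<Sum>i<n. u i * T j i)))"
      unfolding S_def using N by (subst int_box_sum_translate[OF _ e_per]) auto
    also have "\<dots> = (\<Sum>w\<in>int_box n (int N). e w *
        (\<Sum>u\<in>int_box n (int N). \<Prod>i<n. unit_exp (of_real (real_of_int (u i) * y i w))))"
      unfolding e_translate of_real_sum unit_exp_sum sum_distrib_left by (rule sum.swap)
    also have "\<dots> = (\<Sum>w\<in>int_box n (int N). of_nat (N ^ n) * (if D w then e w else 0))"
    proof (intro sum.cong refl)
      fix w
      have "(\<Sum>u\<in>int_box n (int N). \<Prod>i<n. unit_exp (of_real (real_of_int (u i) * y i w))) =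
        (\<Prod>i<n. \<Sum>x\<in>{0..<int N}. unit_exp (of_real (real_of_int x * y i w)))"
        unfolding int_box_def by (rule prod_sum_PiE[symmetric]) auto
      also have "\<dots> = (\<Prod>i<n. if y i w \<in> \<int> then of_nat N else 0)"
        unfolding sum_int_interval of_int_of_nat_eq
        by (intro prod.cong refl sum_unit_exp_multiples Ny)
      also have "\<dots> = (if D w then of_nat (N ^ n) else 0)"
        using N by (auto simp: D_def prod_zero_iff)
      finally show "e w * (\<Sum>u\<in>int_box n (int N). \<Prod>i<n. unit_exp (of_real (real_of_int (u i) * y i w))) =
         of_nat (N ^ n) * (if D w then e w else 0)" by simp
    qed
    also have "\<dots> = of_nat (N ^ n) * (\<Sum>w\<in>int_box n (int N). if D w then e w else 0)"
      by (simp only: sum_distrib_left)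
    finally show ?thesis using N by simp
  qed

  have y_add: "y i (\<lambda>j. w j + w' j) = y i w + y i w'" for i w w'
    by (simp add: y_def algebra_simps add_divide_distrib sum.distrib)
  have y_scale: "y i (\<lambda>j. c * w j) = of_int c * y i w" for i w c
    by (simp add: y_def sum_distrib_left algebra_simps)
  have y_restrict: "y i w = y i w'" if "\<And>j. j < n \<Longrightarrow> w j = w' j" for i w w'
    unfolding y_def using that by (intro sum.cong) auto
  have D_add: "D (\<lambda>j. w j + w' j)" if "D w" "D w'" for w w'
    using that by (auto simp: D_def y_add)
  have D_scale: "D (\<lambda>j. c * w j)" if "D w" for w c
    using that by (auto simp: D_def y_scale)
  have D0: "D (\<lambda>j. 0)" by (simp add: D_def y_def)
  have \<phi>0: "[\<phi> (\<lambda>j. 0) = 0] (mod int P)"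
    using \<phi>_add[OF D0 D0] by (simp add: cong_iff_dvd_diff)
  have \<phi>_mult: "[\<phi> (\<lambda>j. int k * w j) = int k * \<phi> w] (mod int P)" if "D w" for w k
  proof (induction k)
    case 0 then show ?case using \<phi>0 by simp
  next
    case (Suc k)
    have "[\<phi> (\<lambda>j. int k * w j + w j) = \<phi> (\<lambda>j. int k * w j) + \<phi> w] (mod int P)"
      using \<phi>_add[OF D_scale[OF that] that] .
    also have "[\<phi> (\<lambda>j. int k * w j) + \<phi> w = int k * \<phi> w + \<phi> w] (mod int P)"
      using Suc by (intro cong_add) auto
    finally show ?case by (simp add: algebra_simps)
  qed
  have D_N: "D (\<lambda>j. int N * t j)" "[\<phi> (\<lambda>j. int N * t j) = 0] (mod int P)" for t
  proof -
    have D': "D (\<lambda>j. int N0 * t j)"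
      unfolding D_def
    proof (intro allI impI)
      fix i
      have "y i (\<lambda>j. int N0 * t j) = (\<Sum>j<n. real_of_int (int (N0 div (2 * m j)) * t j * T j i))"
        unfolding y_def
      proof (intro sum.cong refl)
        fix j assume "j \<in> {..<n}"
        then have "2 * m j dvd N0" "m j > 0" using dN0 m by auto
        then have "real N0 = real (N0 div (2 * m j)) * real (2 * m j)"
          by (metis dvd_div_mult_self of_nat_mult)
        then show "real_of_int (int N0 * t j * T j i) / real (2 * m j) = real_of_int (int (N0 div (2 * m j)) * t j * T j i)"
          using \<open>m j > 0\<close> by (simp add: field_simps)
      qed
      then show "y i (\<lambda>j. int N0 * t j) \<in> \<int>" by (simp only: Ints_sum Ints_of_int)
    qed
    have eq: "(\<lambda>j. int N * t j) = (\<lambda>j. int P * (int N0 * t j))"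
      by (simp add: N_def mult_ac)
    show "D (\<lambda>j. int N * t j)" unfolding eq by (rule D_scale[OF D'])
    show "[\<phi> (\<lambda>j. int N * t j) = 0] (mod int P)"
      unfolding eq using \<phi>_mult[OF D', of P] by (simp add: cong_def)
  qed
  \<comment> \<open>\<open>cnt k\<close> is the number of points of the box over the class
    \<open>k\<close> modulo \<open>P\<close>. Adding \<open>w0\<close> matches class
    \<open>k\<close> with class \<open>k + 1\<close>, so all classes are equally populated; the zero
    vector shows that they are not empty.\<close>
  define I where "I k w \<longleftrightarrow> D w \<and> [\<phi> w = k] (mod int P)" for k w
  define cnt where "cnt k = (\<Sum>w\<in>int_box n (int N). if I k w then 1 else 0 :: nat)" for k
  have I_imp: "I k w'" if "\<forall>j<n. [w j = w' j] (mod int N)" "I k w" for k w w'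
  proof -
    have "\<exists>t. w' j = w j + int N * t" if "j < n" for j
      using that \<open>\<forall>j<n. [w j = w' j] (mod int N)\<close> by (meson cong_iff_lin cong_sym)
    then obtain t where t: "\<And>j. j < n \<Longrightarrow> w' j = w j + int N * t j" by metis
    have "D (\<lambda>j. w j + int N * t j)" using that D_N by (auto simp: I_def intro: D_add)
    then have "D w'" unfolding D_def using y_restrict[of w' "\<lambda>j. w j + int N * t j"] t by auto
    have "\<phi> w' = \<phi> (\<lambda>j. w j + int N * t j)" using t by (intro \<phi>_restrict) auto
    also have "[\<phi> (\<lambda>j. w j + int N * t j) = \<phi> w + \<phi> (\<lambda>j. int N * t j)] (mod int P)"
      using that D_N by (intro \<phi>_add) (auto simp: I_def)
    also have "[\<phi> w + \<phi> (\<lambda>j. int N * t j) = k + 0] (mod int P)"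
      using that D_N by (intro cong_add) (auto simp: I_def)
    finally show ?thesis using \<open>D w'\<close> by (simp add: I_def)
  qed
  have I_per: "box_periodic n (int N) (\<lambda>w. if I k w then 1 else 0 :: nat)" for k
    unfolding box_periodic_def using I_imp by (metis cong_sym)
  have I_shift: "I (k + 1) (\<lambda>j. w j + w0 j) = I k w" for k w
  proof
    assume I: "I k w"
    then have "[\<phi> (\<lambda>j. w j + w0 j) = \<phi> w + \<phi> w0] (mod int P)"
      using w0 by (intro \<phi>_add) (auto simp: I_def)
    also have "[\<phi> w + \<phi> w0 = k + 1] (mod int P)"
      using I w0 by (intro cong_add) (auto simp: I_def)
    finally show "I (k + 1) (\<lambda>j. w j + w0 j)" using I w0 by (auto simp: I_def intro: D_add)
  next
    assume I: "I (k + 1) (\<lambda>j. w j + w0 j)"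
    then have "D (\<lambda>j. (w j + w0 j) + (-1) * w0 j)"
      unfolding I_def by (intro D_add[OF _ D_scale[OF w0(1)]]) simp
    then have D: "D w" by simp
    have "[\<phi> w + \<phi> w0 = \<phi> (\<lambda>j. w j + w0 j)] (mod int P)"
      using \<phi>_add[OF D w0(1)] by (rule cong_sym)
    also have "[\<phi> (\<lambda>j. w j + w0 j) = k + 1] (mod int P)" using I by (simp add: I_def)
    finally have "[\<phi> w + \<phi> w0 - \<phi> w0 = k + 1 - 1] (mod int P)"
      by (rule cong_diff) (rule w0)
    then show "I k w" using D by (simp add: I_def)
  qed
  have cnt_step: "cnt (k + 1) = cnt k" for k
  proof -
    have "cnt (k + 1) = (\<Sum>w\<in>int_box n (int N). if I (k + 1) (\<lambda>j. w j + w0 j) then 1 else 0)"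
      unfolding cnt_def using N by (intro int_box_sum_translate[OF _ I_per, symmetric]) auto
    then show ?thesis by (simp only: I_shift cnt_def)
  qed
  have cnt_const: "cnt (int k) = cnt 0" for k
  proof (induction k)
    case (Suc k)
    then show ?case using cnt_step[of "int k"] by (simp add: add.commute)
  qed simp
  have cnt_pos: "cnt 0 > 0"
  proof -
    let ?z = "restrict (\<lambda>j. 0) {..<n} :: nat \<Rightarrow> int"
    have "I 0 ?z" by (rule I_imp[of "\<lambda>j. 0"]) (use D0 \<phi>0 in \<open>auto simp: I_def\<close>)
    moreover have "?z \<in> int_box n (int N)" using N by (auto simp: int_box_def)
    ultimately show ?thesis unfolding cnt_def by (intro sum_pos2[of _ ?z]) auto
  qed
  define h where "h k = unit_exp (of_real (real_of_int (a * k\<^sup>2) / real P))" for k :: int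
  have h_cong: "h k = h l" if kl: "[k = l] (mod int P)" for k l
    unfolding h_def
  proof (rule unit_exp_cong)
    have "int P dvd a * (k\<^sup>2 - l\<^sup>2)"
      using cong_pow[OF kl, of 2] by (simp add: cong_iff_dvd_diff)
    then obtain t where "a * (k\<^sup>2 - l\<^sup>2) = int P * t" by (auto elim: dvdE)
    then have "real_of_int (a * k\<^sup>2) - real_of_int (a * l\<^sup>2) = real P * of_int t"
      by (metis of_int_diff of_int_mult of_int_of_nat_eq right_diff_distrib)
    then have "real_of_int (a * k\<^sup>2) / real P - real_of_int (a * l\<^sup>2) / real P = of_int t"
      using P by (simp add: field_simps)
    then show "real_of_int (a * k\<^sup>2) / real P - real_of_int (a * l\<^sup>2) / real P \<in> \<int>" by simp
  qed
  have e_h: "(if D w then e w else 0) = (\<Sum>k<P. h (int k) * of_nat (if I (int k) w then 1 else 0))" for w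
  proof (cases "D w")
    case True
    define k where "k = nat (\<phi> w mod int P)"
    have k: "k < P" "[\<phi> w = int k] (mod int P)" using P by (auto simp: k_def nat_less_iff)
    have "I (int k') w \<longleftrightarrow> k' = k" if "k' < P" for k'
      using that k True by (auto simp: I_def cong_def)
    then have "(\<Sum>k<P. h (int k) * of_nat (if I (int k) w then 1 else 0)) =
       (\<Sum>k'<P. if k' = k then h (int k) else 0)" by (intro sum.cong) auto
    also have "\<dots> = h (int k)" using k by simp
    also have "\<dots> = h (\<phi> w)" by (rule h_cong) (rule cong_sym[OF k(2)])
    also have "\<dots> = e w" unfolding h_def e_def
      using \<phi>_q[OF True] by (intro unit_exp_cong[symmetric])
    finally show ?thesis using True by simp
  next
    case False then show ?thesis by (simp add: I_def)
  qed
  have "S = (\<Sum>k<P. \<Sum>w\<in>int_box n (int N). h (int k) * of_nat (if I (int k) w then 1 else 0))"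
    unfolding S_D e_h by (rule sum.swap)
  also have "\<dots> = (\<Sum>k<P. h (int k) * of_nat (cnt (int k)))"
    by (simp only: sum_distrib_left[symmetric] cnt_def of_nat_sum)
  also have "\<dots> = of_nat (cnt 0) * (\<Sum>k<P. h (int k))"
    unfolding cnt_const by (simp add: sum_distrib_left mult.commute)
  finally have S_h: "S = of_nat (cnt 0) * (\<Sum>k<P. h (int k))" .
  obtain c where c: "c > 0" "S = of_real c * (1 + \<i>) ^ n" using S_prod by blast
  have "(\<Sum>k<P. h (int k)) = of_real (c / real (cnt 0)) * (1 + \<i>) ^ n"
    using S_h c cnt_pos by (simp add: field_simps)
  then show ?thesis using c cnt_pos unfolding h_def
    by (intro exI[of _ "c / real (cnt 0)"]) auto
qed

section \<open>Lattices in coordinates and the Milgram formula\<close>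

text \<open>Coordinate vectors are total functions of which only the values below \<open>n\<close>
  are read, so that shifting and zero padding stay ordinary operations on functions.\<close>

definition gram_form :: "nat \<Rightarrow> (nat \<Rightarrow> nat \<Rightarrow> real) \<Rightarrow> (nat \<Rightarrow> real) \<Rightarrow> (nat \<Rightarrow> real) \<Rightarrow> real" where
  "gram_form n G r s = (\<Sum>i<n. \<Sum>j<n. r i * G i j * s j)"

lemma gram_form_add_left: "gram_form n G (\<lambda>i. r i + r' i) s = gram_form n G r s + gram_form n G r' s"
  by (simp add: gram_form_def algebra_simps sum.distrib)

lemma gram_form_scale_left: "gram_form n G (\<lambda>i. c * r i) s = c * gram_form n G r s"
  by (simp add: gram_form_def algebra_simps sum_distrib_left)

lemma gram_form_sum_left:
  "gram_form n G (\<lambda>i. \<Sum>j<k::nat. f j i) s = (\<Sum>j<k. gram_form n G (f j) s)"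
proof (induction k)
  case 0 then show ?case by (simp add: gram_form_def)
next
  case (Suc k) then show ?case by (simp add: gram_form_add_left)
qed

lemma gram_form_commute:
  assumes "\<And>i j. i < n \<Longrightarrow> j < n \<Longrightarrow> G i j = G j i"
  shows "gram_form n G r s = gram_form n G s r"
proof -
  have "gram_form n G r s = (\<Sum>j<n. \<Sum>i<n. r i * G i j * s j)"
    unfolding gram_form_def by (rule sum.swap)
  also have "\<dots> = gram_form n G s r"
    unfolding gram_form_def using assms by (intro sum.cong refl) (simp add: mult_ac)
  finally show ?thesis .
qed

lemma gram_form_cong:
  assumes "\<And>i. i < n \<Longrightarrow> r i = r' i" "\<And>i. i < n \<Longrightarrow> s i = s' i"
  shows "gram_form n G r s = gram_form n G r' s'"
  unfolding gram_form_def using assms by (intro sum.cong refl) auto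

lemma gram_form_Ints:
  assumes "\<And>i j. i < n \<Longrightarrow> j < n \<Longrightarrow> G i j \<in> \<int>"
  shows "gram_form n G (\<lambda>i. of_int (u i)) (\<lambda>i. of_int (v i)) \<in> \<int>"
  unfolding gram_form_def using assms by (intro Ints_sum Ints_mult) auto

text \<open>Gram-Schmidt with denominators cleared. The vectors must stay integral because
  positivity is known on integer vectors only, and because they are to span a sublattice.\<close>

lemma integral_gram_schmidt:
  fixes G :: "nat \<Rightarrow> nat \<Rightarrow> real" and n :: nat
  defines "B \<equiv> gram_form n G"
  assumes sym: "\<And>i j. i < n \<Longrightarrow> j < n \<Longrightarrow> G i j = G j i"
    and int: "\<And>i j. i < n \<Longrightarrow> j < n \<Longrightarrow> G i j \<in> \<int>"
    and pos: "\<And>u :: nat \<Rightarrow> int. \<exists>i<n. u i \<noteq> 0 \<Longrightarrow> B (\<lambda>i. of_int (u i)) (\<lambda>i. of_int (u i)) > 0"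
    and "k \<le> n"
  shows "\<exists>t :: nat \<Rightarrow> nat \<Rightarrow> int.
    (\<forall>j<k. \<forall>i\<ge>k. t j i = 0) \<and>
    (\<forall>j<k. B (\<lambda>i. of_int (t j i)) (\<lambda>i. of_int (t j i)) > 0) \<and>
    (\<forall>j<k. \<forall>j'<k. j \<noteq> j' \<longrightarrow> B (\<lambda>i. of_int (t j i)) (\<lambda>i. of_int (t j' i)) = 0) \<and>
    (\<forall>x :: nat \<Rightarrow> real. (\<forall>i\<ge>k. x i = 0) \<longrightarrow> (\<exists>c. \<forall>i. x i = (\<Sum>j<k. c j * of_int (t j i))))"
  using \<open>k \<le> n\<close>
proof (induction k)
  case 0
  then show ?case by auto
next
  case (Suc k)
  from Suc.IH[OF Suc_leD[OF Suc.prems]] obtain t :: "nat \<Rightarrow> nat \<Rightarrow> int" where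
    supp: "\<forall>j<k. \<forall>i\<ge>k. t j i = 0" and
    tpos: "\<forall>j<k. B (\<lambda>i. of_int (t j i)) (\<lambda>i. of_int (t j i)) > 0" and
    orth: "\<forall>j<k. \<forall>j'<k. j \<noteq> j' \<longrightarrow> B (\<lambda>i. of_int (t j i)) (\<lambda>i. of_int (t j' i)) = 0" and
    span: "\<forall>x :: nat \<Rightarrow> real. (\<forall>i\<ge>k. x i = 0) \<longrightarrow> (\<exists>c. \<forall>i. x i = (\<Sum>j<k. c j * of_int (t j i)))"
    by (elim exE conjE) (rule that)
  define e :: "nat \<Rightarrow> int" where "e i = (if i = k then 1 else 0)" for i
  have BZ: "B (\<lambda>i. of_int (u i)) (\<lambda>i. of_int (v i)) \<in> \<int>" for u v
    unfolding B_def using int by (intro gram_form_Ints) auto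
  define z where "z j = \<lfloor>B (\<lambda>i. of_int (t j i)) (\<lambda>i. of_int (t j i))\<rfloor>" for j
  define x where "x j = \<lfloor>B (\<lambda>i. of_int (e i)) (\<lambda>i. of_int (t j i))\<rfloor>" for j
  have z: "B (\<lambda>i. of_int (t j i)) (\<lambda>i. of_int (t j i)) = of_int (z j)" for j
    using BZ by (simp add: z_def)
  have x: "B (\<lambda>i. of_int (e i)) (\<lambda>i. of_int (t j i)) = of_int (x j)" for j
    using BZ by (simp add: x_def)
  have zpos: "z j > 0" if "j < k" for j using tpos that unfolding z by simp
  define D where "D = (\<Prod>j<k. z j)"
  have D: "D > 0" unfolding D_def using zpos by (intro prod_pos) auto
  have Dz: "D div z j * z j = D" if "j < k" for j
    unfolding D_def using that by (intro dvd_div_mult_self dvd_prodI) auto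
  \<comment> \<open>The usual projection \<open>e - \<Sum> (x j / z j) t j\<close> multiplied by
    \<open>D\<close>, the product of the norms \<open>z j\<close>. Its coordinate \<open>k\<close>
    is \<open>D\<close>, hence nonzero, which yields both positivity and the spanning
    property.\<close>
  define tk where "tk i = D * e i + (\<Sum>j<k. (- (D div z j * x j)) * t j i)" for i
  have tk_k: "tk k = D" using supp by (simp add: tk_def e_def)
  have tk_supp: "tk i = 0" if "i \<ge> Suc k" for i using supp that by (simp add: tk_def e_def)
  have tk_B: "B (\<lambda>i. of_int (tk i)) s = of_int D * B (\<lambda>i. of_int (e i)) s +
      (\<Sum>j<k. of_int (- (D div z j * x j)) * B (\<lambda>i. of_int (t j i)) s)" for s
    unfolding tk_def B_def of_int_add of_int_sum of_int_mult gram_form_add_left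
      gram_form_sum_left gram_form_scale_left ..
  have tk_orth: "B (\<lambda>i. of_int (tk i)) (\<lambda>i. of_int (t j i)) = 0" if j: "j < k" for j
  proof -
    have "(\<Sum>l<k. of_int (- (D div z l * x l)) * B (\<lambda>i. of_int (t l i)) (\<lambda>i. of_int (t j i))) =
       (\<Sum>l<k. if l = j then real_of_int (- (D div z j * x j) * z j) else 0)"
      using j orth z by (intro sum.cong) auto
    also have "\<dots> = real_of_int (- x j * (D div z j * z j))" using j by (simp add: mult_ac)
    finally show ?thesis unfolding tk_B x Dz[OF j] by (simp add: mult.commute)
  qed
  define t' where "t' = t(k := tk)"
  have comm: "B r s = B s r" for r s unfolding B_def using sym by (rule gram_form_commute)
  show ?case
  proof (intro exI[of _ t'] conjI allI impI)
    fix j i assume "j < Suc k" "i \<ge> Suc k"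
    then show "t' j i = 0" using supp tk_supp by (auto simp: t'_def less_Suc_eq)
  next
    fix j assume "j < Suc k"
    moreover have "B (\<lambda>i. of_int (tk i)) (\<lambda>i. of_int (tk i)) > 0"
      using Suc.prems tk_k D by (intro pos exI[of _ k]) auto
    ultimately show "B (\<lambda>i. of_int (t' j i)) (\<lambda>i. of_int (t' j i)) > 0"
      using tpos by (auto simp: t'_def less_Suc_eq)
  next
    fix j j' assume "j < Suc k" "j' < Suc k" "j \<noteq> j'"
    then show "B (\<lambda>i. of_int (t' j i)) (\<lambda>i. of_int (t' j' i)) = 0"
      using orth tk_orth comm[of _ "\<lambda>i. of_int (tk i)"] by (auto simp: t'_def less_Suc_eq)
  next
    fix v :: "nat \<Rightarrow> real" assume v: "\<forall>i\<ge>Suc k. v i = 0"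
    have "\<exists>c. \<forall>i. v i - v k / of_int D * of_int (tk i) = (\<Sum>j<k. c j * of_int (t j i))"
    proof (intro span[rule_format])
      fix i assume "i \<ge> k"
      then show "v i - v k / of_int D * of_int (tk i) = 0"
        using v tk_k tk_supp D by (cases "i = k") auto
    qed
    then obtain c where c: "\<And>i. v i = (\<Sum>j<k. c j * of_int (t j i)) + v k / of_int D * of_int (tk i)"
      by (metis diff_eq_eq)
    show "\<exists>c. \<forall>i. v i = (\<Sum>j<Suc k. c j * of_int (t' j i))"
    proof (intro exI allI)
      fix i
      show "v i = (\<Sum>j<Suc k. (c(k := v k / of_int D)) j * of_int (t' j i))"
        unfolding c[of i] by (simp add: t'_def)
    qed
  qed
qed

text \<open>\<open>lincomb\<close> takes coefficients indexed by basis vectors; the inverse of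
  \<open>(!) bs\<close> turns them into coefficients indexed by position.\<close>

definition lattice_embedding :: "'v zlattice \<Rightarrow> 'v list \<Rightarrow> (nat \<Rightarrow> real) \<Rightarrow> 'v" where
  "lattice_embedding L bs r =
     module.lincomb (ambient L) (\<lambda>b. r (inv_into {..<length bs} ((!) bs) b)) (set bs)"

lemma lattice_embedding_properties:
  assumes V: "vectorspace class_ring (ambient L)" and sb: "symmetric_bilinear L"
    and lb: "lattice_basis L bs"
  defines "n \<equiv> length bs" and "\<iota> \<equiv> lattice_embedding L bs"
  shows "\<iota> r \<in> carrier (ambient L)"
    and "\<iota> (\<lambda>i. r i + s i) = \<iota> r \<oplus>\<^bsub>ambient L\<^esub> \<iota> s"
    and "\<iota> (\<lambda>i. c * r i) = c \<odot>\<^bsub>ambient L\<^esub> \<iota> r"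
    and "form L (\<iota> r) (\<iota> s) = gram_form n (\<lambda>i j. form L (bs ! i) (bs ! j)) r s"
    and "(\<And>i. i < n \<Longrightarrow> r i = s i) \<Longrightarrow> \<iota> r = \<iota> s"
    and "points L = {\<iota> (\<lambda>i. of_int (u i)) | u. True}"
    and "i < n \<Longrightarrow> \<iota> r = \<zero>\<^bsub>ambient L\<^esub> \<Longrightarrow> r i = 0"
    and "v \<in> carrier (ambient L) \<Longrightarrow> \<exists>r. v = \<iota> r"
    and "lattice_rank L = n"
proof -
  interpret V: vectorspace class_ring "ambient L" by fact
  define idx where "idx = inv_into {..<n} ((!) bs)"
  have dist: "distinct bs" and bas: "V.basis (set bs)"
    and pts: "points L = {V.lincomb (\<lambda>b. real_of_int (c b)) (set bs) | c. True}"
    using lb by (auto simp: lattice_basis_def)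
  have sub: "set bs \<subseteq> carrier (ambient L)" and li: "V.lin_indpt (set bs)"
    and gen: "V.gen_set (set bs)"
    using bas by (auto simp: V.basis_def)
  have bij: "bij_betw ((!) bs) {..<n} (set bs)" unfolding n_def by (rule bij_betw_nth) (use dist in auto)
  have idx: "idx (bs ! i) = i" if "i < n" for i
    unfolding idx_def using bij that by (intro inv_into_f_f) (auto simp: bij_betw_def)
  have idx_set: "idx b < n" "bs ! idx b = b" if "b \<in> set bs" for b
    using that idx by (auto simp: in_set_conv_nth n_def)
  have \<iota>: "\<iota> r = V.lincomb (\<lambda>b. r (idx b)) (set bs)" for r
    by (simp add: \<iota>_def lattice_embedding_def idx_def n_def)
  have \<iota>_lincomb: "V.lincomb f (set bs) = \<iota> (\<lambda>i. f (bs ! i))" for f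
    unfolding \<iota> by (rule V.lincomb_cong) (use sub idx_set in auto)
  show cl: "\<iota> r \<in> carrier (ambient L)" for r
    unfolding \<iota> by (rule V.lincomb_closed) (use sub in auto)
  show "\<iota> (\<lambda>i. r i + s i) = \<iota> r \<oplus>\<^bsub>ambient L\<^esub> \<iota> s"
    unfolding \<iota> using V.lincomb_sum[OF _ sub, of "\<lambda>b. r (idx b)" "\<lambda>b. s (idx b)"] by simp
  show "\<iota> (\<lambda>i. c * r i) = c \<odot>\<^bsub>ambient L\<^esub> \<iota> r"
    unfolding \<iota> using V.lincomb_smult[OF sub, of "\<lambda>b. r (idx b)" c] by simp
  have form_sym: "form L u v = form L v u" and
    form_add: "form L (u \<oplus>\<^bsub>ambient L\<^esub> w) v = form L u v + form L w v" and
    form_smult: "form L (c \<odot>\<^bsub>ambient L\<^esub> u) v = c * form L u v"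
    if "u \<in> carrier (ambient L)" "v \<in> carrier (ambient L)" "w \<in> carrier (ambient L)" for u v w c
    using sb that by (auto simp: symmetric_bilinear_def)
  have form_lincomb: "form L (V.lincomb f A) v = (\<Sum>b\<in>A. f b * form L b v)"
    if "finite A" "A \<subseteq> carrier (ambient L)" "v \<in> carrier (ambient L)" for f A v
    using that
  proof (induction A)
    case empty
    have "V.lincomb f {} = 0 \<odot>\<^bsub>ambient L\<^esub> v" using empty V.smult_l_null[of v] by (simp add: V.lincomb_def)
    then show ?case using form_smult[of v v v 0] empty by simp
  next
    case (insert b A)
    have "V.lincomb f (insert b A) = f b \<odot>\<^bsub>ambient L\<^esub> b \<oplus>\<^bsub>ambient L\<^esub> V.lincomb f A"
      using V.lincomb_insert[of A f b] insert by simp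
    then show ?case using insert form_add form_smult by (simp add: V.lincomb_closed)
  qed
  have form_\<iota>: "form L (\<iota> r) v = (\<Sum>i<n. r i * form L (bs ! i) v)" if "v \<in> carrier (ambient L)" for r v
  proof -
    have "form L (\<iota> r) v = (\<Sum>b\<in>set bs. r (idx b) * form L b v)"
      unfolding \<iota> by (rule form_lincomb) (use sub that in auto)
    also have "\<dots> = (\<Sum>i<n. r (idx (bs ! i)) * form L (bs ! i) v)"
      by (rule sum.reindex_bij_betw[OF bij, symmetric])
    finally show ?thesis using idx by simp
  qed
  have bs_carrier: "bs ! i \<in> carrier (ambient L)" if "i < n" for i
    using sub that by (auto simp: n_def)
  have "form L (\<iota> r) (\<iota> s) = (\<Sum>i<n. r i * form L (\<iota> s) (bs ! i))"
    unfolding form_\<iota>[OF cl] using form_sym[OF bs_carrier cl cl] by (intro sum.cong refl) simp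
  also have "\<dots> = (\<Sum>i<n. \<Sum>j<n. r i * form L (bs ! i) (bs ! j) * s j)"
  proof (intro sum.cong refl)
    fix i assume "i \<in> {..<n}"
    then have i: "bs ! i \<in> carrier (ambient L)" using bs_carrier by simp
    have "form L (bs ! j) (bs ! i) = form L (bs ! i) (bs ! j)" if "j < n" for j
      using form_sym[OF bs_carrier[OF that] i i] .
    then show "r i * form L (\<iota> s) (bs ! i) = (\<Sum>j<n. r i * form L (bs ! i) (bs ! j) * s j)"
      unfolding form_\<iota>[OF i] sum_distrib_left by (intro sum.cong refl) simp
  qed
  finally show "form L (\<iota> r) (\<iota> s) = gram_form n (\<lambda>i j. form L (bs ! i) (bs ! j)) r s"
    by (simp add: gram_form_def)
  show "\<iota> r = \<iota> s" if "\<And>i. i < n \<Longrightarrow> r i = s i"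
    unfolding \<iota> by (rule V.lincomb_cong) (use sub idx_set that in auto)
  show "points L = {\<iota> (\<lambda>i. of_int (u i)) | u. True}"
  proof (intro subset_antisym subsetI)
    fix v assume "v \<in> points L"
    then obtain c where "v = \<iota> (\<lambda>i. of_int (c (bs ! i)))" unfolding pts \<iota>_lincomb by blast
    then show "v \<in> {\<iota> (\<lambda>i. of_int (u i)) | u. True}" by (auto intro!: exI[of _ "\<lambda>i. c (bs ! i)"])
  next
    fix v assume "v \<in> {\<iota> (\<lambda>i. of_int (u i)) | u. True}"
    then obtain u where "v = \<iota> (\<lambda>i. of_int (u i))" by blast
    then have "v = V.lincomb (\<lambda>b. of_int (u (idx b))) (set bs)" by (simp add: \<iota>)
    then show "v \<in> points L" unfolding pts by (auto intro!: exI[of _ "\<lambda>b. u (idx b)"])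
  qed
  show "r i = 0" if i: "i < n" and "\<iota> r = \<zero>\<^bsub>ambient L\<^esub>"
  proof (rule ccontr)
    assume "r i \<noteq> 0"
    have "V.lin_dep (set bs)"
      by (rule V.lin_dep_crit[of "set bs" _ "\<lambda>b. r (idx b)" "bs ! i"])
         (use that \<open>r i \<noteq> 0\<close> idx[OF i] in \<open>auto simp: \<iota> n_def\<close>)
    then show False using li by simp
  qed
  show "\<exists>r. v = \<iota> r" if "v \<in> carrier (ambient L)"
  proof -
    have "v \<in> V.span (set bs)" using gen that by simp
    then obtain f where "v = V.lincomb f (set bs)"
      using V.finite_span[of "set bs"] sub by auto
    then show ?thesis unfolding \<iota>_lincomb by blast
  qed
  \<comment> \<open>Every lattice basis is a real basis of the ambient space, so invariance of
    dimension gives the uniqueness that \<open>THE\<close> demands.\<close>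
  show "lattice_rank L = n"
    unfolding lattice_rank_def
  proof (rule the_equality)
    show "\<exists>bs. lattice_basis L bs \<and> length bs = n" using lb by (auto simp: n_def)
    fix k assume "\<exists>bs. lattice_basis L bs \<and> length bs = k"
    then obtain cs where cs: "lattice_basis L cs" "length cs = k" by blast
    then have "V.dim = card (set cs)" "V.dim = card (set bs)"
      using lb by (auto intro!: V.dim_basis simp: lattice_basis_def)
    then show "k = n" using cs dist by (simp add: n_def distinct_card lattice_basis_def)
  qed
qed

definition
  "dual_group L = (add_monoid (ambient L))\<lparr>carrier := dual_lattice L\<rparr>"

lemma dual_group_simps [simp]:
  "carrier (dual_group L) = dual_lattice L"
  "monoid.mult (dual_group L) = add (ambient L)"
  by (simp_all add: dual_group_def)

text \<open>Evenness includes integrality, hence places the lattice inside its dual; the quotient by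
  \<open>Mod\<close> is then a group. Inverses are handled as multiplication by -1.\<close>

lemma points_normal_dual_group:
  fixes L :: "'v zlattice"
  assumes "even_lattice L"
  shows "points L \<lhd> dual_group L"
proof -
  let ?A = "add_monoid (ambient L)"
  have V: "vectorspace class_ring (ambient L)" and sb: "symmetric_bilinear L"
    and pts_int: "\<And>x y. x \<in> points L \<Longrightarrow> y \<in> points L \<Longrightarrow> form L x y \<in> \<int>"
    using assms by (auto simp: even_lattice_def is_lattice_def)
  obtain bs where lb: "lattice_basis L bs" using assms by (auto simp: even_lattice_def is_lattice_def)
  interpret V: vectorspace class_ring "ambient L" by fact
  note \<iota> = lattice_embedding_properties[OF V sb lb]
  let ?\<iota> = "lattice_embedding L bs"
  have inv: "inv\<^bsub>?A\<^esub> v = (-1) \<odot>\<^bsub>ambient L\<^esub> v" if "v \<in> carrier (ambient L)" for v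
  proof -
    have "(-1) \<odot>\<^bsub>ambient L\<^esub> v \<oplus>\<^bsub>ambient L\<^esub> v = (-1) \<odot>\<^bsub>ambient L\<^esub> v \<oplus>\<^bsub>ambient L\<^esub> 1 \<odot>\<^bsub>ambient L\<^esub> v"
      using V.smult_one[OF that] by simp
    also have "\<dots> = (-1 + 1) \<odot>\<^bsub>ambient L\<^esub> v"
      using V.smult_l_distr[of "-1" 1 v] that by simp
    also have "\<dots> = \<zero>\<^bsub>ambient L\<^esub>" using V.smult_l_null[of v] that by simp
    finally show ?thesis using V.minus_equality[of _ v] that V.smult_closed[of "-1" v]
      by (simp add: a_inv_def)
  qed
  have grp: "comm_group ?A" by (rule V.a_comm_group)
  then have group: "group ?A" by (rule comm_group.axioms(2))
  have pts: "points L \<subseteq> carrier (ambient L)" using \<iota>(1,6) by auto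
  have sub_pts: "subgroup (points L) ?A"
  proof (rule group.subgroupI[OF group])
    show "points L \<subseteq> carrier ?A" using pts by simp
    show "points L \<noteq> {}" using \<iota>(6) by auto
  next
    fix a assume a: "a \<in> points L"
    then obtain u where "a = ?\<iota> (\<lambda>i. of_int (u i))" using \<iota>(6) by auto
    then have "inv\<^bsub>?A\<^esub> a = ?\<iota> (\<lambda>i. of_int (- u i))"
      using inv[of a] pts a \<iota>(3)[of "-1" "\<lambda>i. of_int (u i)"] by auto
    then show "inv\<^bsub>?A\<^esub> a \<in> points L" unfolding \<iota>(6) by (auto intro!: exI[of _ "\<lambda>i. - u i"])
  next
    fix a b assume "a \<in> points L" "b \<in> points L"
    then obtain u v where "a = ?\<iota> (\<lambda>i. of_int (u i))" "b = ?\<iota> (\<lambda>i. of_int (v i))"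
      using \<iota>(6) by auto
    then have "a \<oplus>\<^bsub>ambient L\<^esub> b = ?\<iota> (\<lambda>i. of_int (u i + v i))" using \<iota>(2) by simp
    then show "a \<otimes>\<^bsub>?A\<^esub> b \<in> points L" unfolding \<iota>(6) by (auto intro!: exI[of _ "\<lambda>i. u i + v i"])
  qed
  have dual: "points L \<subseteq> dual_lattice L"
    using pts pts_int by (auto simp: dual_lattice_def)
  have form_add: "form L (u \<oplus>\<^bsub>ambient L\<^esub> w) v = form L u v + form L w v" and
    form_smult: "form L (c \<odot>\<^bsub>ambient L\<^esub> u) v = c * form L u v"
    if "u \<in> carrier (ambient L)" "v \<in> carrier (ambient L)" "w \<in> carrier (ambient L)" for u v w c
    using sb that by (auto simp: symmetric_bilinear_def)
  have sub_dual: "subgroup (dual_lattice L) ?A"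
  proof (rule group.subgroupI[OF group])
    show "dual_lattice L \<subseteq> carrier ?A" by (auto simp: dual_lattice_def)
    show "dual_lattice L \<noteq> {}" using dual \<iota>(6) by auto
  next
    fix a assume a: "a \<in> dual_lattice L"
    then have "inv\<^bsub>?A\<^esub> a = (-1) \<odot>\<^bsub>ambient L\<^esub> a" by (intro inv) (simp add: dual_lattice_def)
    moreover have "form L ((-1) \<odot>\<^bsub>ambient L\<^esub> a) w = - form L a w" if "w \<in> points L" for w
      using form_smult[of a w a "-1"] a that pts by (auto simp: dual_lattice_def)
    ultimately show "inv\<^bsub>?A\<^esub> a \<in> dual_lattice L"
      using a V.smult_closed[of "-1" a] by (auto simp: dual_lattice_def)
  next
    fix a b assume ab: "a \<in> dual_lattice L" "b \<in> dual_lattice L"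
    then show "a \<otimes>\<^bsub>?A\<^esub> b \<in> dual_lattice L"
      using form_add pts by (auto simp: dual_lattice_def subset_iff)
  qed
  have "subgroup (points L) (dual_group L)"
    unfolding dual_group_def by (rule group.subgroup_incl[OF group sub_pts sub_dual dual])
  moreover have "comm_group (dual_group L)"
  proof (rule group.group_comm_groupI)
    show "group (dual_group L)"
      unfolding dual_group_def by (rule subgroup.subgroup_is_group[OF sub_dual group])
    show "x \<otimes>\<^bsub>dual_group L\<^esub> y = y \<otimes>\<^bsub>dual_group L\<^esub> x"
      if "x \<in> carrier (dual_group L)" "y \<in> carrier (dual_group L)" for x y
      using that V.a_comm by (simp add: dual_lattice_def)
  qed
  ultimately show ?thesis by (simp add: comm_group.subgroup_imp_normal)
qed

lemma fst_discriminant_module: "fst (discriminant_module L) = dual_group L Mod points L"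
  by (simp add: discriminant_module_def dual_group_def)

text \<open>An integral orthogonal system in the lattice supplies the data of
  \<open>milgram_coordinates\<close>; there \<phi> is the given isomorphism onto Z/P, composed with
  the passage from coordinates to cosets.\<close>

theorem milgram:
  fixes L :: "'v zlattice" and P :: nat and a :: int
  assumes even: "even_lattice L" and pd: "pos_def_lattice L" and P: "P > 0"
    and iso: "isometric (discriminant_module L) (A_module P a)"
  shows "\<exists>c>0. (\<Sum>k<P. unit_exp (of_real (real_of_int (a * (int k)\<^sup>2) / real P))) =
      of_real c * (1 + \<i>) ^ lattice_rank L"
    and "P > 1 \<Longrightarrow> lattice_rank L > 0"
proof -
  have V: "vectorspace class_ring (ambient L)" and sb: "symmetric_bilinear L"
    and pts_int: "\<And>x y. x \<in> points L \<Longrightarrow> y \<in> points L \<Longrightarrow> form L x y \<in> \<int>"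
    and pts_even: "\<And>x. x \<in> points L \<Longrightarrow> \<exists>k::int. form L x x = 2 * real_of_int k"
    and pts_pos: "\<And>x. x \<in> points L \<Longrightarrow> x \<noteq> \<zero>\<^bsub>ambient L\<^esub> \<Longrightarrow> form L x x > 0"
    using even pd by (auto simp: even_lattice_def pos_def_lattice_def is_lattice_def)
  obtain bs where lb: "lattice_basis L bs" using even by (auto simp: even_lattice_def is_lattice_def)
  define n where "n = length bs"
  define \<iota> where "\<iota> = lattice_embedding L bs"
  define G where "G = (\<lambda>i j. form L (bs ! i) (bs ! j))"
  define B where "B = gram_form n G"
  note props = lattice_embedding_properties[OF V sb lb, folded n_def \<iota>_def G_def, folded B_def]
  note \<iota>_carrier = props(1) and \<iota>_add = props(2) and \<iota>_form = props(4) and \<iota>_cong = props(5)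
    and \<iota>_points = props(6) and \<iota>_zero = props(7) and \<iota>_surj = props(8) and rank = props(9)
  have points: "\<iota> (\<lambda>i. of_int (u i)) \<in> points L" for u using \<iota>_points by blast
  define unit where "unit l = (\<lambda>i. of_int (if i = l then 1 else 0 :: int) :: real)" for l :: nat
  have unit_points: "\<iota> (unit l) \<in> points L" for l unfolding unit_def by (rule points)
  have B_unit: "B r (unit l) = (\<Sum>i<n. r i * G i l)" if "l < n" for r l
    unfolding B_def gram_form_def unit_def using that by (simp add: if_distrib cong: if_cong)
  have G_unit: "G i j = B (unit i) (unit j)" if "i < n" "j < n" for i j
  proof -
    have "B (unit i) (unit j) = (\<Sum>l<n. if l = i then G i j else 0)"
      unfolding B_unit[OF that(2)] by (intro sum.cong) (auto simp: unit_def)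
    then show ?thesis using that by simp
  qed
  have form_sym: "form L u v = form L v u" if "u \<in> carrier (ambient L)" "v \<in> carrier (ambient L)" for u v
    using sb that by (auto simp: symmetric_bilinear_def)
  have B_commute: "B r s = B s r" for r s
    unfolding \<iota>_form[symmetric] by (intro form_sym \<iota>_carrier)
  have G_sym: "G i j = G j i" if "i < n" "j < n" for i j
    using that B_commute by (simp add: G_unit)
  have B_int: "B (\<lambda>i. of_int (u i)) (\<lambda>i. of_int (v i)) \<in> \<int>" for u v
    unfolding \<iota>_form[symmetric] by (intro pts_int points)
  have G_int: "G i j \<in> \<int>" if "i < n" "j < n" for i j
    unfolding G_unit[OF that] unit_def by (rule B_int)
  have B_pos: "B (\<lambda>i. of_int (u i)) (\<lambda>i. of_int (u i)) > 0" if "\<exists>i<n. u i \<noteq> 0" for u :: "nat \<Rightarrow> int"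
  proof -
    from that obtain i where i: "i < n" "u i \<noteq> 0" by blast
    then have "\<iota> (\<lambda>i. of_int (u i)) \<noteq> \<zero>\<^bsub>ambient L\<^esub>"
      using \<iota>_zero[of i "\<lambda>i. of_int (u i)"] by auto
    then show ?thesis unfolding \<iota>_form[symmetric] by (intro pts_pos points)
  qed
  have "\<exists>t :: nat \<Rightarrow> nat \<Rightarrow> int.
    (\<forall>j<n. \<forall>i\<ge>n. t j i = 0) \<and>
    (\<forall>j<n. B (\<lambda>i. of_int (t j i)) (\<lambda>i. of_int (t j i)) > 0) \<and>
    (\<forall>j<n. \<forall>j'<n. j \<noteq> j' \<longrightarrow> B (\<lambda>i. of_int (t j i)) (\<lambda>i. of_int (t j' i)) = 0) \<and>
    (\<forall>x :: nat \<Rightarrow> real. (\<forall>i\<ge>n. x i = 0) \<longrightarrow> (\<exists>c. \<forall>i. x i = (\<Sum>j<n. c j * of_int (t j i))))"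
    unfolding B_def using G_sym G_int B_pos[unfolded B_def] order_refl by (rule integral_gram_schmidt)
  then obtain t :: "nat \<Rightarrow> nat \<Rightarrow> int" where
    tpos: "\<forall>j<n. B (\<lambda>i. of_int (t j i)) (\<lambda>i. of_int (t j i)) > 0" and
    orth: "\<forall>j<n. \<forall>j'<n. j \<noteq> j' \<longrightarrow> B (\<lambda>i. of_int (t j i)) (\<lambda>i. of_int (t j' i)) = 0" and
    span: "\<forall>x :: nat \<Rightarrow> real. (\<forall>i\<ge>n. x i = 0) \<longrightarrow> (\<exists>c. \<forall>i. x i = (\<Sum>j<n. c j * of_int (t j i)))"
    by (elim exE conjE) (rule that)
  define tr where "tr j = (\<lambda>i. real_of_int (t j i))" for j
  have "\<exists>k::int. B (tr j) (tr j) = 2 * real_of_int k" for j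
    unfolding tr_def \<iota>_form[symmetric] by (intro pts_even points)
  then obtain k :: "nat \<Rightarrow> int" where k: "\<And>j. B (tr j) (tr j) = 2 * real_of_int (k j)" by metis
  define m where "m j = nat (k j)" for j
  have m: "m j > 0" "B (tr j) (tr j) = real (2 * m j)" if "j < n" for j
    using tpos that k[of j] unfolding m_def tr_def by auto
  have orth': "B (tr j) (tr l) = 0" if "j < n" "l < n" "j \<noteq> l" for j l
    using orth that unfolding tr_def by blast
  define T where "T j i = \<lfloor>B (tr j) (unit i)\<rfloor>" for j i
  have T: "B (tr j) (unit i) = of_int (T j i)" for j i
    using B_int unfolding T_def tr_def unit_def by simp
  define \<rho> where "\<rho> w = (\<lambda>i. \<Sum>j<n. real_of_int (w j) / real (2 * m j) * tr j i)" for w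
  have B_\<rho>: "B (\<rho> w) s = (\<Sum>j<n. real_of_int (w j) / real (2 * m j) * B (tr j) s)" for w s
    unfolding \<rho>_def B_def gram_form_sum_left gram_form_scale_left ..
  have B_\<rho>_tr: "B (\<rho> w) (tr l) = of_int (w l)" if "l < n" for w l
  proof -
    have "B (\<rho> w) (tr l) = (\<Sum>j<n. if j = l then of_int (w l) else 0)"
      unfolding B_\<rho> using m orth' that by (intro sum.cong) auto
    then show ?thesis using that by simp
  qed
  \<comment> \<open>The dual of the sublattice contains nothing else: expand \<open>x\<close> in the
    orthogonal vectors and read off coefficients. \<open>x'\<close> truncates \<open>x\<close>, as
    \<open>span\<close> speaks of sequences that vanish from \<open>n\<close> on.\<close>
  have \<rho>_complete: "\<iota> x = \<iota> (\<rho> w)" if wx: "\<And>j. j < n \<Longrightarrow> B (tr j) x = of_int (w j)" for x w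
  proof -
    define x' where "x' i = (if i < n then x i else 0)" for i
    have "\<exists>c. \<forall>i. x' i = (\<Sum>j<n. c j * tr j i)"
      using span unfolding x'_def tr_def by auto
    then obtain c where c: "x' = (\<lambda>i. \<Sum>j<n. c j * tr j i)" by auto
    have x': "B r x = B r x'" for r unfolding B_def by (rule gram_form_cong) (auto simp: x'_def)
    have "of_int (w l) = c l * real (2 * m l)" if l: "l < n" for l
    proof -
      have "of_int (w l) = B x' (tr l)" using wx[OF l] x'[of "tr l"] B_commute[of x' "tr l"] by simp
      also have "\<dots> = (\<Sum>j<n. c j * B (tr j) (tr l))"
        unfolding c B_def gram_form_sum_left gram_form_scale_left ..
      also have "\<dots> = (\<Sum>j<n. if j = l then c l * real (2 * m l) else 0)"
        using m orth' l by (intro sum.cong) auto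
      finally show ?thesis using l by simp
    qed
    then have "x' = \<rho> w" unfolding c \<rho>_def using m(1) by (intro ext sum.cong refl) auto
    moreover have "\<iota> x = \<iota> x'" by (rule \<iota>_cong) (simp add: x'_def)
    ultimately show ?thesis by simp
  qed
  define q where "q w = (\<Sum>j<n. (real_of_int (w j))\<^sup>2 / real (2 * (2 * m j)))" for w :: "nat \<Rightarrow> int"
  define y where "y i w = (\<Sum>j<n. real_of_int (w j * T j i) / real (2 * m j))" for i and w :: "nat \<Rightarrow> int"
  define D where "D w \<longleftrightarrow> (\<forall>i<n. y i w \<in> \<int>)" for w
  have q: "form L (\<iota> (\<rho> w)) (\<iota> (\<rho> w)) / 2 = q w" for w
    unfolding \<iota>_form B_\<rho>[of w "\<rho> w"] q_def sum_divide_distrib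
    by (intro sum.cong refl) (simp add: B_commute[of "tr _"] B_\<rho>_tr power2_eq_square)
  have y: "y i w = B (\<rho> w) (unit i)" for i w
    unfolding B_\<rho> y_def T by (intro sum.cong refl) simp
  have D: "D w \<longleftrightarrow> \<iota> (\<rho> w) \<in> dual_lattice L" for w
  proof
    assume "D w"
    have "form L (\<iota> (\<rho> w)) (\<iota> (\<lambda>i. of_int (u i))) \<in> \<int>" for u
    proof -
      have "B (\<rho> w) (\<lambda>i. of_int (u i)) = (\<Sum>l<n. of_int (u l) * y l w)"
      proof -
        have "B (\<rho> w) (\<lambda>i. of_int (u i)) = (\<Sum>l<n. of_int (u l) * (\<Sum>i<n. \<rho> w i * G i l))"
          unfolding B_def gram_form_def sum_distrib_left by (subst sum.swap) (simp add: mult_ac)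
        then show ?thesis by (simp add: y B_unit)
      qed
      then show ?thesis using \<open>D w\<close> unfolding \<iota>_form D_def by (auto intro!: Ints_sum)
    qed
    then show "\<iota> (\<rho> w) \<in> dual_lattice L"
      unfolding dual_lattice_def \<iota>_points using \<iota>_carrier by auto
  next
    assume "\<iota> (\<rho> w) \<in> dual_lattice L"
    then show "D w" using unit_points unfolding D_def y \<iota>_form[symmetric] by (auto simp: dual_lattice_def)
  qed
  interpret N: normal "points L" "dual_group L" by (rule points_normal_dual_group[OF even])
  obtain f where f: "f \<in> iso (dual_group L Mod points L) (integer_mod_group P)"
    and fQ: "\<And>X. X \<in> carrier (dual_group L Mod points L) \<Longrightarrow>
        mod_ints (real_of_int a / real P * (real_of_int (f X))\<^sup>2) = (\<Union>v\<in>X. mod_ints (form L v v / 2))"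
    using iso unfolding isometric_def fst_discriminant_module
    by (auto simp: A_module_def discriminant_module_def)
  have hom: "f \<in> hom (dual_group L Mod points L) (integer_mod_group P)"
    and surj: "f ` carrier (dual_group L Mod points L) = {0..<int P}"
    using f P by (auto simp: iso_def bij_betw_def carrier_integer_mod_group)
  define \<phi> where "\<phi> w = f (points L #>\<^bsub>dual_group L\<^esub> \<iota> (\<rho> w))" for w
  have coset: "points L #>\<^bsub>dual_group L\<^esub> v \<in> carrier (dual_group L Mod points L)" if "v \<in> dual_lattice L" for v
    using that by (auto simp: carrier_FactGroup)
  have \<rho>_add: "\<iota> (\<rho> (\<lambda>j. w j + w' j)) = \<iota> (\<rho> w) \<oplus>\<^bsub>ambient L\<^esub> \<iota> (\<rho> w')" for w w'
    unfolding \<iota>_add[symmetric] \<rho>_def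
    by (intro arg_cong[of _ _ \<iota>] ext) (simp add: algebra_simps add_divide_distrib sum.distrib)
  have \<phi>_restrict: "\<phi> w = \<phi> w'" if "\<And>j. j < n \<Longrightarrow> w j = w' j" for w w'
  proof -
    have "\<rho> w = \<rho> w'" unfolding \<rho>_def using that by (intro ext sum.cong) auto
    then show ?thesis by (simp add: \<phi>_def)
  qed
  have \<phi>_add: "[\<phi> (\<lambda>j. w j + w' j) = \<phi> w + \<phi> w'] (mod int P)" if "D w" "D w'" for w w'
  proof -
    have "\<phi> (\<lambda>j. w j + w' j) =
        f ((points L #>\<^bsub>dual_group L\<^esub> \<iota> (\<rho> w)) \<otimes>\<^bsub>dual_group L Mod points L\<^esub> (points L #>\<^bsub>dual_group L\<^esub> \<iota> (\<rho> w')))"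
      using N.rcos_sum[of "\<iota> (\<rho> w)" "\<iota> (\<rho> w')"] that by (simp add: \<phi>_def \<rho>_add D)
    also have "\<dots> = (\<phi> w + \<phi> w') mod int P"
      using hom_mult[OF hom coset coset] that by (simp add: D \<phi>_def)
    finally show ?thesis by (simp add: cong_def)
  qed
  have \<phi>_q: "q w - real_of_int (a * (\<phi> w)\<^sup>2) / real P \<in> \<int>" if "D w" for w
  proof -
    have "\<iota> (\<rho> w) \<in> points L #>\<^bsub>dual_group L\<^esub> \<iota> (\<rho> w)"
      using that by (intro N.rcos_self N.is_subgroup) (auto simp: D)
    then have "mod_ints (q w) \<subseteq> mod_ints (real_of_int a / real P * (real_of_int (\<phi> w))\<^sup>2)"
      using fQ[OF coset] that unfolding \<phi>_def D by (auto simp flip: q)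
    moreover have "q w \<in> mod_ints (q w)" unfolding mod_ints_def by (auto intro!: image_eqI[of _ _ 0])
    ultimately have "q w \<in> mod_ints (real_of_int a / real P * (real_of_int (\<phi> w))\<^sup>2)" by (rule subsetD)
    then obtain z where "z \<in> \<int>" "q w = real_of_int a / real P * (real_of_int (\<phi> w))\<^sup>2 + z"
      by (auto simp: mod_ints_def)
    then show ?thesis by simp
  qed
  \<comment> \<open>A preimage of the generator will serve as \<open>w0\<close>. Writing
    \<open>1 mod int P\<close> keeps the statement correct for \<open>P = 1\<close>, where the only
    element is 0.\<close>
  have "\<exists>X\<in>carrier (dual_group L Mod points L). f X = 1 mod int P"
    using surj P by (metis (no_types, lifting) atLeastLessThan_iff imageE of_nat_0_less_iff pos_mod_bound pos_mod_sign)
  then obtain v0 where v0: "v0 \<in> dual_lattice L" "f (points L #>\<^bsub>dual_group L\<^esub> v0) = 1 mod int P"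
    by (auto simp: carrier_FactGroup)
  have "\<exists>w0. D w0 \<and> [\<phi> w0 = 1] (mod int P)"
  proof -
    obtain x where x: "v0 = \<iota> x" using \<iota>_surj v0 by (auto simp: dual_lattice_def)
    have "B (tr j) x \<in> \<int>" for j
    proof -
      have "form L (\<iota> x) (\<iota> (tr j)) \<in> \<int>"
        using v0(1) points[of "t j"] unfolding x tr_def by (simp add: dual_lattice_def)
      then show ?thesis using B_commute[of "tr j" x] by (simp add: \<iota>_form)
    qed
    then have "\<iota> x = \<iota> (\<rho> (\<lambda>j. \<lfloor>B (tr j) x\<rfloor>))" by (intro \<rho>_complete) simp
    then show ?thesis using v0 x
      by (intro exI[of _ "\<lambda>j. \<lfloor>B (tr j) x\<rfloor>"]) (auto simp: D \<phi>_def cong_def)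
  qed
  then obtain w0 where w0: "D w0" "[\<phi> w0 = 1] (mod int P)" by blast
  have q_lattice: "q (\<lambda>j. \<Sum>i<n. u i * T j i) \<in> \<int>" for u
  proof -
    let ?u = "\<lambda>i. real_of_int (u i)"
    have "B (tr j) ?u = of_int (\<Sum>i<n. u i * T j i)" for j
    proof -
      have "B (tr j) ?u = (\<Sum>l<n. of_int (u l) * (\<Sum>i<n. tr j i * G i l))"
        unfolding B_def gram_form_def sum_distrib_left by (subst sum.swap) (simp add: mult_ac)
      then show ?thesis by (simp add: T flip: B_unit)
    qed
    then have "\<iota> ?u = \<iota> (\<rho> (\<lambda>j. \<Sum>i<n. u i * T j i))" by (intro \<rho>_complete)
    moreover obtain z :: int where "form L (\<iota> ?u) (\<iota> ?u) = 2 * real_of_int z"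
      using pts_even[OF points] by blast
    ultimately show ?thesis unfolding q[symmetric] by simp
  qed
  show "\<exists>c>0. (\<Sum>k<P. unit_exp (of_real (real_of_int (a * (int k)\<^sup>2) / real P))) =
      of_real c * (1 + \<i>) ^ lattice_rank L"
    unfolding rank
    by (rule milgram_coordinates[of n m T P \<phi> a w0, OF m(1) q_lattice[unfolded q_def] P \<phi>_restrict
         \<phi>_add[unfolded D_def y_def] \<phi>_q[unfolded D_def y_def q_def] w0[unfolded D_def y_def]])
  \<comment> \<open>In rank 0 all coordinate vectors agree below \<open>n\<close>, so \<phi> is
    constant; additivity makes this constant 0 modulo \<open>P\<close>, whereas \<phi> takes the
    value 1 at \<open>w0\<close>.\<close>
  show "lattice_rank L > 0" if "P > 1"
  proof (rule ccontr)
    assume "\<not> lattice_rank L > 0"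
    then have n: "n = 0" using rank by simp
    have "[\<phi> (\<lambda>j. w0 j + w0 j) = \<phi> w0 + \<phi> w0] (mod int P)" using \<phi>_add w0 by blast
    moreover have "\<phi> (\<lambda>j. w0 j + w0 j) = \<phi> w0" by (rule \<phi>_restrict) (simp add: n)
    ultimately have "[\<phi> w0 = 0] (mod int P)" by (simp add: cong_iff_dvd_diff)
    then have "[1 = 0] (mod int P)" using w0 cong_sym cong_trans by blast
    then show False using that by (simp add: cong_def)
  qed
qed

section \<open>The bordered lattices\<close>

lemma even_quadratic_form:
  fixes h :: "nat \<Rightarrow> nat \<Rightarrow> int"
  assumes "\<And>i j. i < n \<Longrightarrow> j < n \<Longrightarrow> h i j = h j i" "\<And>i. i < n \<Longrightarrow> even (h i i)"
  shows "even (\<Sum>i<n. \<Sum>j<n. u i * h i j * u j)"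
  using assms
proof (induction n)
  case (Suc n)
  have "(\<Sum>i<n. u i * h i n * u n) = (\<Sum>j<n. u n * h n j * u j)"
    using Suc.prems(1)[of _ n] by (intro sum.cong) auto
  then have "(\<Sum>i<Suc n. \<Sum>j<Suc n. u i * h i j * u j) =
    (\<Sum>i<n. \<Sum>j<n. u i * h i j * u j) + 2 * (\<Sum>j<n. u n * h n j * u j) + u n * h n n * u n"
    by (simp add: sum.distrib)
  moreover have "even (\<Sum>i<n. \<Sum>j<n. u i * h i j * u j)" using Suc by auto
  ultimately show ?case using Suc.prems(2)[of n] by simp
qed simp

section \<open>Lattices given by a Gram matrix\<close>

lemma form_gram_lattice:
  assumes "x \<in> carrier_vec n" "y \<in> carrier_vec n"
  shows "form (gram_lattice (mat n n (\<lambda>(i, j). g i j))) x y = gram_form n g (($) x) (($) y)"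
  using assms by (simp add: gram_lattice_def scalar_prod_def gram_form_def sum_distrib_left
      lessThan_atLeast0 mult_ac)

lemma gram_lattice_simps [simp]:
  "carrier (ambient (gram_lattice G)) = carrier_vec (dim_row G)"
  "add (ambient (gram_lattice G)) = (+)"
  "zero (ambient (gram_lattice G)) = 0\<^sub>v (dim_row G)"
  "module.smult (ambient (gram_lattice G)) = (\<cdot>\<^sub>v)"
  by (simp_all add: gram_lattice_def module_vec_simps)

lemma gram_lattice_basis: "lattice_basis (gram_lattice G) (unit_vecs (dim_row G))"
proof -
  define n where "n = dim_row G"
  interpret vec_space "TYPE(real)" n .
  have amb: "ambient (gram_lattice G) = module_vec TYPE(real) n" by (simp add: gram_lattice_def n_def)
  have "points (gram_lattice G) = {lincomb (\<lambda>b. real_of_int (c b)) (set (unit_vecs n)) | c. True}"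
  proof (intro subset_antisym subsetI)
    fix v assume "v \<in> points (gram_lattice G)"
    then have v: "v \<in> carrier_vec n" "\<And>i. i < n \<Longrightarrow> v $ i \<in> \<int>" by (auto simp: gram_lattice_def n_def)
    define c where "c b = \<lfloor>v $ (THE i. b = unit_vec n i)\<rfloor>" for b :: "real vec"
    have the: "(THE l. unit_vec n i = (unit_vec n l :: real vec)) = i" if "i < n" for i
    proof (rule the_equality)
      fix l assume "unit_vec n i = (unit_vec n l :: real vec)"
      then have "unit_vec n i $ i = (unit_vec n l :: real vec) $ i" by simp
      then show "l = i" using that by (simp add: unit_vec_def split: if_splits)
    qed simp
    have "lincomb (\<lambda>b. real_of_int (c b)) (set (unit_vecs n)) = v"
    proof (rule eq_vecI)
      fix i assume "i < dim_vec v"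
      then have "i < n" using v by simp
      then show "lincomb (\<lambda>b. real_of_int (c b)) (set (unit_vecs n)) $ i = v $ i"
        using v(2) by (simp add: lincomb_units c_def the)
    qed (use v in \<open>simp add: lincomb_dim[OF finite_set unit_vecs_carrier]\<close>)
    then show "v \<in> {lincomb (\<lambda>b. real_of_int (c b)) (set (unit_vecs n)) | c. True}" by (metis (mono_tags, lifting) mem_Collect_eq)
  next
    fix v assume "v \<in> {lincomb (\<lambda>b. real_of_int (c b)) (set (unit_vecs n)) | c. True}"
    then obtain c where v: "v = lincomb (\<lambda>b. real_of_int (c b)) (set (unit_vecs n))" by blast
    have "v \<in> carrier_vec n" unfolding v by (rule lincomb_closed) (auto simp: unit_vecs_carrier)
    moreover have "v $ i \<in> \<int>" if "i < n" for i unfolding v lincomb_units[OF that] by simp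
    ultimately show "v \<in> points (gram_lattice G)" unfolding gram_lattice_def n_def by simp
  qed
  then show ?thesis
    unfolding lattice_basis_def amb n_def[symmetric] using unit_vecs_distinct unit_vecs_basis by simp
qed

lemma gram_lattice_even_pos_def:
  fixes g :: "nat \<Rightarrow> nat \<Rightarrow> real" and h :: "nat \<Rightarrow> nat \<Rightarrow> int" and n :: nat
  defines "L \<equiv> gram_lattice (mat n n (\<lambda>(i, j). g i j))"
  assumes h: "\<And>i j. i < n \<Longrightarrow> j < n \<Longrightarrow> g i j = of_int (h i j)"
    and sym: "\<And>i j. i < n \<Longrightarrow> j < n \<Longrightarrow> h i j = h j i" and ev: "\<And>i. i < n \<Longrightarrow> even (h i i)"
    and pos: "\<And>X. \<exists>i<n. X i \<noteq> 0 \<Longrightarrow> gram_form n g X X > 0"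
  shows "even_lattice L" "pos_def_lattice L" "lattice_rank L = n"
proof -
  let ?G = "mat n n (\<lambda>(i, j). g i j)"
  have carrier: "carrier (ambient L) = carrier_vec n" by (simp add: L_def)
  have ops: "add (ambient L) = (+)" "module.smult (ambient L) = (\<cdot>\<^sub>v)" by (simp_all add: L_def)
  have form: "form L x y = gram_form n g (($) x) (($) y)"
    if "x \<in> carrier_vec n" "y \<in> carrier_vec n" for x y
    unfolding L_def by (rule form_gram_lattice) fact+
  have V: "vectorspace class_ring (ambient L)" unfolding L_def gram_lattice_def by (simp add: vec_vs)
  have gsym: "g i j = g j i" if "i < n" "j < n" for i j using that sym by (simp add: h)
  have sb: "symmetric_bilinear L"
    unfolding symmetric_bilinear_def carrier
  proof (intro conjI ballI allI)
    fix u v :: "real vec" assume uv: "u \<in> carrier_vec n" "v \<in> carrier_vec n"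
    show "form L u v = form L v u"
      unfolding form[OF uv] form[OF uv(2,1)] using gsym by (rule gram_form_commute)
    show "form L (c \<odot>\<^bsub>ambient L\<^esub> u) v = c * form L u v" for c
    proof -
      have "form L (c \<cdot>\<^sub>v u) v = gram_form n g (\<lambda>i. c * u $ i) (($) v)"
        using uv by (subst form) (auto intro!: gram_form_cong)
      then show ?thesis using uv by (simp add: form gram_form_scale_left ops)
    qed
  next
    fix u v w :: "real vec" assume uv: "u \<in> carrier_vec n" "v \<in> carrier_vec n" "w \<in> carrier_vec n"
    have "form L (u + v) w = gram_form n g (\<lambda>i. u $ i + v $ i) (($) w)"
      using uv by (subst form) (auto intro!: gram_form_cong)
    then show "form L (u \<oplus>\<^bsub>ambient L\<^esub> v) w = form L u w + form L v w"
      using uv by (simp add: form gram_form_add_left ops)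
  qed
  have lb: "lattice_basis L (unit_vecs n)"
    unfolding L_def using gram_lattice_basis[of ?G] by simp
  have gram: "gram_matrix L (unit_vecs n) = ?G"
  proof (rule eq_matI)
    fix i j assume "i < dim_row ?G" "j < dim_col ?G"
    then have ij: "i < n" "j < n" by auto
    then have u: "unit_vecs n ! i = unit_vec n i" "unit_vecs n ! j = unit_vec n j"
      by (simp_all add: unit_vecs_def)
    have "(\<Sum>a<n. \<Sum>b<n. unit_vec n i $ a * g a b * unit_vec n j $ b) =
       (\<Sum>a<n. if a = i then \<Sum>b<n. if b = j then g i j else 0 else 0)"
      using ij by (intro sum.cong refl) (simp add: if_distrib[of "(*) _"] cong: if_cong)
    also have "\<dots> = g i j" using ij by simp
    finally show "gram_matrix L (unit_vecs n) $$ (i, j) = ?G $$ (i, j)"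
      using ij by (simp add: gram_matrix_def u form gram_form_def unit_vecs_def)
  qed (auto simp: gram_matrix_def unit_vecs_def)
  \<comment> \<open>Nondegeneracy comes from definiteness over the reals: a kernel vector would have
    norm 0.\<close>
  have "det ?G \<noteq> 0"
  proof
    assume "det ?G = 0"
    then obtain v where v: "v \<in> carrier_vec n" "v \<noteq> 0\<^sub>v n" "?G *\<^sub>v v = 0\<^sub>v n"
      using det_0_iff_vec_prod_zero[of ?G n] by auto
    then have "form L v v = 0" by (simp add: L_def gram_lattice_def)
    moreover have "\<exists>i<n. v $ i \<noteq> 0"
    proof (rule ccontr)
      assume "\<not> (\<exists>i<n. v $ i \<noteq> 0)"
      then have "v = 0\<^sub>v n" using v(1) by (intro eq_vecI) auto
      then show False using v(2) by simp
    qed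
    ultimately show False using pos[of "($) v"] v(1) by (simp add: form)
  qed
  then have lat: "is_lattice L"
    unfolding is_lattice_def using V sb lb gram by metis
  have pts: "x \<in> carrier_vec n" "\<And>i. i < n \<Longrightarrow> x $ i = of_int \<lfloor>x $ i\<rfloor>" if "x \<in> points L" for x :: "real vec"
    using that by (auto simp: L_def gram_lattice_def)
  have form_int: "form L x y = of_int (\<Sum>i<n. \<Sum>j<n. \<lfloor>x $ i\<rfloor> * h i j * \<lfloor>y $ j\<rfloor>)"
    if "x \<in> points L" "y \<in> points L" for x y
  proof -
    have "form L x y = gram_form n g (\<lambda>i. of_int \<lfloor>x $ i\<rfloor>) (\<lambda>i. of_int \<lfloor>y $ i\<rfloor>)"
      using pts that by (subst form) (auto intro!: gram_form_cong)
    then show ?thesis by (simp add: gram_form_def h)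
  qed
  show "even_lattice L"
    unfolding even_lattice_def
  proof (intro conjI ballI lat)
    show "form L x y \<in> \<int>" if "x \<in> points L" "y \<in> points L" for x y
      unfolding form_int[OF that] by (rule Ints_of_int)
    show "\<exists>k::int. form L x x = 2 * real_of_int k" if "x \<in> points L" for x
    proof -
      have "even (\<Sum>i<n. \<Sum>j<n. \<lfloor>x $ i\<rfloor> * h i j * \<lfloor>x $ j\<rfloor>)"
        using sym ev by (rule even_quadratic_form)
      then obtain k where "(\<Sum>i<n. \<Sum>j<n. \<lfloor>x $ i\<rfloor> * h i j * \<lfloor>x $ j\<rfloor>) = 2 * k" by (rule evenE)
      then show ?thesis unfolding form_int[OF that that] by auto
    qed
  qed
  show "pos_def_lattice L"
    unfolding pos_def_lattice_def
  proof (intro conjI ballI impI lat)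
    fix x assume x: "x \<in> points L" "x \<noteq> \<zero>\<^bsub>ambient L\<^esub>"
    have "\<exists>i<n. x $ i \<noteq> 0"
    proof (rule ccontr)
      assume "\<not> (\<exists>i<n. x $ i \<noteq> 0)"
      then have "x = 0\<^sub>v n" using pts[OF x(1)] by (intro eq_vecI) auto
      then show False using x(2) by (simp add: L_def)
    qed
    then show "form L x x > 0" using pos[of "($) x"] pts[OF x(1)] by (simp add: form)
  qed
  show "lattice_rank L = n"
    using lattice_embedding_properties(9)[OF V sb lb] by (simp add: unit_vecs_def)
qed

text \<open>\<open>X 0\<close> is a boundary value, and \<open>X 1\<close>, ..., \<open>X k\<close>
  are the variables of the form of \<open>F_mat k\<close>. Minimising over them gives
  \<open>- k / (k + 1)\<close> times \<open>(X 0)^2\<close>, where \<open>k / (k + 1)\<close> is the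
  corner entry of the inverse. The induction removes \<open>X 1\<close> by a square with coefficient
  \<open>2 - k / (k + 1) = (k + 2) / (k + 1)\<close>.\<close>

lemma chain_form_nonneg:
  fixes X :: "nat \<Rightarrow> real" and k :: nat
  defines "t \<equiv> \<lambda>X :: nat \<Rightarrow> real. \<lambda>k. \<Sum>i<k. 2 * (X (Suc i))\<^sup>2 + 2 * X i * X (Suc i)"
  shows "t X k + real k / real (Suc k) * (X 0)\<^sup>2 \<ge> 0"
    and "X 0 = 0 \<Longrightarrow> t X k \<le> 0 \<Longrightarrow> i \<le> k \<Longrightarrow> X i = 0"
proof -
  have step: "t X (Suc k) = 2 * (X 1)\<^sup>2 + 2 * X 0 * X 1 + t (\<lambda>i. X (Suc i)) k" for X k
    unfolding t_def by (subst sum.lessThan_Suc_shift) simp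
  have sq: "2 * b\<^sup>2 + 2 * a * b - real k / real (Suc k) * b\<^sup>2 + real (Suc k) / real (Suc (Suc k)) * a\<^sup>2 =
      real (k + 2) / real (k + 1) * (b + real (k + 1) / real (k + 2) * a)\<^sup>2" for a b :: real and k
  proof -
    define r where "r = real (k + 1) / real (k + 2)"
    have r: "r \<noteq> 0" "real k / real (Suc k) = 2 - 1 / r" "real (Suc k) / real (Suc (Suc k)) = r"
      "real (k + 2) / real (k + 1) = 1 / r" "real (k + 1) / real (k + 2) = r"
      unfolding r_def by (simp_all add: field_simps)
    show ?thesis unfolding r(2-5) using r(1) by (simp add: field_simps power2_eq_square)
  qed
  have nonneg: "t X k + real k / real (Suc k) * (X 0)\<^sup>2 \<ge> 0" for X k
  proof (induction k arbitrary: X)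
    case 0 then show ?case by (simp add: t_def)
  next
    case (Suc k)
    have "0 \<le> real (k + 2) / real (k + 1) * (X 1 + real (k + 1) / real (k + 2) * X 0)\<^sup>2" by simp
    moreover have "t (\<lambda>i. X (Suc i)) k + real k / real (Suc k) * (X 1)\<^sup>2 \<ge> 0"
      using Suc[of "\<lambda>i. X (Suc i)"] by simp
    ultimately show ?case using sq[of "X 1" "X 0" k] unfolding step by linarith
  qed
  then show "t X k + real k / real (Suc k) * (X 0)\<^sup>2 \<ge> 0" .
  show "X i = 0" if "X 0 = 0" "t X k \<le> 0" "i \<le> k"
    using that
  proof (induction k arbitrary: X i)
    case (Suc k)
    have t: "t (\<lambda>i. X (Suc i)) k + real k / real (Suc k) * (X 1)\<^sup>2 \<ge> 0"
      using nonneg[of "\<lambda>i. X (Suc i)" k] by simp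
    have "2 * (X 1)\<^sup>2 + 2 * X 0 * X 1 - real k / real (Suc k) * (X 1)\<^sup>2 \<le> 0"
      using t Suc.prems(2) unfolding step by linarith
    then have "real (k + 2) / real (k + 1) * (X 1)\<^sup>2 \<le> 0"
      using sq[of "X 1" 0 k] Suc.prems(1) by simp
    moreover have "real (k + 2) / real (k + 1) > 0" by simp
    ultimately have "X 1 = 0"
      by (metis mult_le_0_iff power2_less_eq_zero_iff not_le)
    moreover have "t (\<lambda>i. X (Suc i)) k \<le> 0" using Suc.prems(1,2) \<open>X 1 = 0\<close> unfolding step by simp
    ultimately have "X (Suc i) = 0" if "i \<le> k" for i
      using Suc.IH[of "\<lambda>i. X (Suc i)" i] that by simp
    then show ?case using Suc.prems by (cases i) auto
  qed simp
qed

text \<open>Polymorphic because the same matrix is used over the reals, as Gram matrix, and over the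
  integers, where evenness of the diagonal makes sense.\<close>

definition bordered_entry :: "'a \<Rightarrow> 'a \<Rightarrow> 'a \<Rightarrow> nat \<Rightarrow> nat \<Rightarrow> 'a :: comm_ring_1" where
  "bordered_entry \<alpha> \<beta> \<gamma> i j =
     (if i = 0 \<and> j = 0 then \<alpha> else if i = 1 \<and> j = 1 then \<gamma>
      else if i + j = 1 then \<beta> else if i = j then 2
      else if j = Suc i \<or> i = Suc j then 1 else 0)"

lemma bordered_F_mat_eq:
  "bordered_F_mat k \<alpha> \<beta> \<gamma> = mat (k + 2) (k + 2) (\<lambda>(i, j). bordered_entry \<alpha> \<beta> \<gamma> i j)"
proof (rule eq_matI)
  let ?B = "mat_of_rows k [0\<^sub>v k, unit_vec k 0 :: real vec]"
  let ?C = "mat_of_cols k [0\<^sub>v k, unit_vec k 0 :: real vec]"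
  let ?A = "mat_of_rows_list 2 [[\<alpha>, \<beta>], [\<beta>, \<gamma>]]"
  have A: "?A \<in> carrier_mat 2 2" by (intro carrier_matI) (simp_all add: mat_of_rows_list_def)
  have F: "F_mat k \<in> carrier_mat k k" by (simp add: F_mat_def)
  fix i j
  assume "i < dim_row (mat (k + 2) (k + 2) (\<lambda>(i, j). bordered_entry \<alpha> \<beta> \<gamma> i j))"
    "j < dim_col (mat (k + 2) (k + 2) (\<lambda>(i, j). bordered_entry \<alpha> \<beta> \<gamma> i j))"
  then have ij: "i < k + 2" "j < k + 2" by auto
  have "bordered_F_mat k \<alpha> \<beta> \<gamma> $$ (i, j) =
    (if i < 2 then if j < 2 then ?A $$ (i, j) else ?B $$ (i, j - 2)
     else if j < 2 then ?C $$ (i - 2, j) else F_mat k $$ (i - 2, j - 2))"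
    unfolding bordered_F_mat_def using ij A F by (subst index_mat_four_block) auto
  also have "\<dots> = bordered_entry \<alpha> \<beta> \<gamma> i j"
  proof (cases "i < 2"; cases "j < 2")
    assume "i < 2" "j < 2"
    then show ?thesis
      by (auto simp: less_2_cases_iff mat_of_rows_list_def bordered_entry_def)
  next
    assume "i < 2" "\<not> j < 2"
    then show ?thesis using ij
      by (auto simp: less_2_cases_iff mat_of_rows_def bordered_entry_def unit_vec_def)
  next
    assume "\<not> i < 2" "j < 2"
    then show ?thesis using ij
      by (auto simp: less_2_cases_iff mat_of_cols_def bordered_entry_def unit_vec_def)
  next
    assume ge: "\<not> i < 2" "\<not> j < 2"
    define i' j' where "i' = i - 2" and "j' = j - 2"
    have e: "i = i' + 2" "j = j' + 2" "i' < k" "j' < k" using ge ij by (auto simp: i'_def j'_def)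
    show ?thesis unfolding e(1,2) using e(3,4) by (simp add: F_mat_def bordered_entry_def)
  qed
  finally show "bordered_F_mat k \<alpha> \<beta> \<gamma> $$ (i, j) =
      mat (k + 2) (k + 2) (\<lambda>(i, j). bordered_entry \<alpha> \<beta> \<gamma> i j) $$ (i, j)" using ij by simp
qed (simp_all add: bordered_F_mat_def F_mat_def mat_of_rows_list_def)

text \<open>Entry \<open>i\<close> of the Gram matrix applied to \<open>X\<close>. The last row fits
  the generic pattern under the convention \<open>X (k + 2) = 0\<close>.\<close>

definition bordered_row :: "real \<Rightarrow> real \<Rightarrow> real \<Rightarrow> (nat \<Rightarrow> real) \<Rightarrow> nat \<Rightarrow> real" where
  "bordered_row \<alpha> \<beta> \<gamma> X i =
     (if i = 0 then \<alpha> * X 0 + \<beta> * X 1 else if i = 1 then \<beta> * X 0 + \<gamma> * X 1 + X 2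
      else X (i - 1) + 2 * X i + X (Suc i))"

lemma bordered_row_eq:
  assumes "X (k + 2) = 0" "i < k + 2"
  shows "(\<Sum>j<k+2. bordered_entry \<alpha> \<beta> \<gamma> i j * X j) = bordered_row \<alpha> \<beta> \<gamma> X i"
proof -
  let ?e = "bordered_entry \<alpha> \<beta> \<gamma>"
  have "(\<Sum>j<k+2. ?e i j * X j) = (\<Sum>j<Suc (k+2). ?e i j * X j)" using assms(1) by simp
  also have "\<dots> = (\<Sum>j\<in>{i - 1, i, Suc i}. ?e i j * X j)"
    using assms(2) by (intro sum.mono_neutral_right) (auto simp: bordered_entry_def)
  also have "\<dots> = bordered_row \<alpha> \<beta> \<gamma> X i"
  proof (cases i)
    case 0 then show ?thesis by (simp add: bordered_entry_def bordered_row_def)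
  next
    case (Suc l)
    then show ?thesis by (cases l) (auto simp: bordered_entry_def bordered_row_def numeral_2_eq_2)
  qed
  finally show ?thesis .
qed

lemma bordered_form_eq:
  assumes "X (k + 2) = 0"
  shows "gram_form (k + 2) (bordered_entry \<alpha> \<beta> \<gamma>) X X = \<alpha> * (X 0)\<^sup>2 + 2 * \<beta> * X 0 * X 1 + \<gamma> * (X 1)\<^sup>2
    + (\<Sum>i<k. 2 * (X (i + 2))\<^sup>2 + 2 * X (i + 1) * X (i + 2))"
proof -
  have "gram_form (k + 2) (bordered_entry \<alpha> \<beta> \<gamma>) X X = (\<Sum>i<k+2. X i * bordered_row \<alpha> \<beta> \<gamma> X i)"
    unfolding gram_form_def
  proof (intro sum.cong refl)
    fix i assume "i \<in> {..<k+2}"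
    then have "bordered_row \<alpha> \<beta> \<gamma> X i = (\<Sum>j<k+2. bordered_entry \<alpha> \<beta> \<gamma> i j * X j)"
      using bordered_row_eq[of X k i] assms by simp
    then show "(\<Sum>j<k+2. X i * bordered_entry \<alpha> \<beta> \<gamma> i j * X j) = X i * bordered_row \<alpha> \<beta> \<gamma> X i"
      by (simp only: sum_distrib_left mult.assoc)
  qed
  also have "\<dots> = X 0 * bordered_row \<alpha> \<beta> \<gamma> X 0 + X 1 * bordered_row \<alpha> \<beta> \<gamma> X 1 +
      (\<Sum>i<k. X (i + 2) * bordered_row \<alpha> \<beta> \<gamma> X (i + 2))"
    by (simp add: sum.lessThan_Suc_shift del: sum.lessThan_Suc)
  \<comment> \<open>Every product of neighbours occurs in two rows. Assigning both copies to the
    lower row costs a telescoping sum, whose end term \<open>X 1 * X 2\<close> cancels the coupling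
    in row 1.\<close>
  also have "(\<Sum>i<k. X (i + 2) * bordered_row \<alpha> \<beta> \<gamma> X (i + 2)) =
     (\<Sum>i<k. (2 * (X (i + 2))\<^sup>2 + 2 * X (i + 1) * X (i + 2)) + (X (Suc i + 1) * X (Suc i + 2) - X (i + 1) * X (i + 2)))"
    by (intro sum.cong refl) (simp add: bordered_row_def power2_eq_square algebra_simps)
  also have "\<dots> = (\<Sum>i<k. 2 * (X (i + 2))\<^sup>2 + 2 * X (i + 1) * X (i + 2)) + (X (k + 1) * X (k + 2) - X 1 * X 2)"
    unfolding sum.distrib sum_lessThan_telescope[of "\<lambda>i. X (i + 1) * X (i + 2)"] by (simp add: numeral_2_eq_2)
  finally show ?thesis using assms
    by (simp add: bordered_row_def power2_eq_square algebra_simps)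
qed

text \<open>Schur complement: bounding the chain from below replaces \<gamma> by \<delta> = \<gamma>
  - k/(k+1) and leaves a binary form, which is positive definite by the determinant condition. If
  \<open>X 0 = X 1 = 0\<close>, the chain itself must vanish.\<close>

lemma bordered_form_pos:
  assumes X: "X (k + 2) = 0" "\<exists>i<k+2. X i \<noteq> 0"
    and "\<alpha> > 0" and det: "\<alpha> * (\<gamma> - real k / real (Suc k)) - \<beta>\<^sup>2 > 0"
  shows "gram_form (k + 2) (bordered_entry \<alpha> \<beta> \<gamma>) X X > 0"
proof (rule ccontr)
  define t where "t = (\<Sum>i<k. 2 * (X (i + 2))\<^sup>2 + 2 * X (i + 1) * X (i + 2))"
  define \<delta> where "\<delta> = \<gamma> - real k / real (Suc k)"
  have t: "t + real k / real (Suc k) * (X 1)\<^sup>2 \<ge> 0"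
    using chain_form_nonneg(1)[of "\<lambda>i. X (i + 1)" k] by (simp add: t_def)
  assume "\<not> gram_form (k + 2) (bordered_entry \<alpha> \<beta> \<gamma>) X X > 0"
  then have le: "\<alpha> * (X 0)\<^sup>2 + 2 * \<beta> * X 0 * X 1 + \<gamma> * (X 1)\<^sup>2 + t \<le> 0"
    unfolding bordered_form_eq[of X k, OF X(1)] t_def by simp
  then have "\<alpha> * (X 0)\<^sup>2 + 2 * \<beta> * X 0 * X 1 + \<delta> * (X 1)\<^sup>2 \<le> 0"
    using t by (simp add: \<delta>_def left_diff_distrib)
  then have "\<alpha> * (\<alpha> * (X 0)\<^sup>2 + 2 * \<beta> * X 0 * X 1 + \<delta> * (X 1)\<^sup>2) \<le> 0"
    using \<open>\<alpha> > 0\<close> by (simp add: mult_le_0_iff)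
  moreover have "\<alpha> * (\<alpha> * (X 0)\<^sup>2 + 2 * \<beta> * X 0 * X 1 + \<delta> * (X 1)\<^sup>2) =
      (\<alpha> * X 0 + \<beta> * X 1)\<^sup>2 + (\<alpha> * \<delta> - \<beta>\<^sup>2) * (X 1)\<^sup>2"
    by (simp add: power2_eq_square algebra_simps)
  ultimately have sum: "(\<alpha> * X 0 + \<beta> * X 1)\<^sup>2 + (\<alpha> * \<delta> - \<beta>\<^sup>2) * (X 1)\<^sup>2 \<le> 0" by simp
  have det': "\<alpha> * \<delta> - \<beta>\<^sup>2 > 0" using det by (simp add: \<delta>_def)
  then have "(\<alpha> * \<delta> - \<beta>\<^sup>2) * (X 1)\<^sup>2 \<ge> 0" by simp
  then have "(\<alpha> * X 0 + \<beta> * X 1)\<^sup>2 = 0" "(\<alpha> * \<delta> - \<beta>\<^sup>2) * (X 1)\<^sup>2 = 0"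
    using sum zero_le_power2[of "\<alpha> * X 0 + \<beta> * X 1"] by linarith+
  then have X1: "X 1 = 0" and X0: "X 0 = 0" using det' \<open>\<alpha> > 0\<close> by auto
  have "t \<le> 0" using le X0 X1 by simp
  then have "X (i + 1) = 0" if "i \<le> k" for i
    using chain_form_nonneg(2)[of "\<lambda>i. X (i + 1)" k i] that X1 by (simp add: t_def)
  then have "X i = 0" if "i < k + 2" for i
    using X0 that by (cases i) auto
  then show False using X(2) by blast
qed

text \<open>Modulo the integers the rows of \<open>F_mat k\<close> form a recurrence that, started
  at the bottom with \<open>z = X (k + 1)\<close> and \<open>X (k + 2) = 0\<close>, gives
  \<open>X (k + 2 - j) = (-1) ^ (j + 1) * j * z\<close>. So everything depends on \<open>z\<close>
  and \<open>s = P * X 0\<close>, for which rows 0 and 1 remain.\<close>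

lemma bordered_dual_coordinates:
  fixes X :: "nat \<Rightarrow> real" and q v x P :: int
  assumes Xn: "X (k + 2) = 0" and "even k"
    and det: "2 * q * (2 * x * int (k + 1) - int k) - P * v\<^sup>2 * int (k + 1) = 1"
    and rows: "\<And>i. i < k + 2 \<Longrightarrow> bordered_row (of_int (2 * q * P)) (of_int (P * v)) (of_int (2 * x)) X i \<in> \<int>"
  shows "of_int P * X 0 \<in> \<int>" and "\<And>i. 1 \<le> i \<Longrightarrow> i < k + 2 \<Longrightarrow> X i \<in> \<int>"
proof -
  define z where "z = X (k + 1)"
  define s where "s = of_int P * X 0"
  have chain: "X (k + 2 - j) - (-1) ^ Suc j * real j * z \<in> \<int> \<and>
      X (k + 2 - Suc j) - (-1) ^ j * real (Suc j) * z \<in> \<int>" if "j \<le> k" for j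
    using that
  proof (induction j)
    case 0 then show ?case using Xn by (simp add: z_def)
  next
    case (Suc j)
    let ?i = "k + 2 - Suc j"
    have i: "\<not> ?i = 0" "\<not> ?i = 1" "?i < k + 2" "?i - 1 = k + 2 - Suc (Suc j)" "Suc ?i = k + 2 - j"
      using Suc.prems by auto
    have row: "X (k + 2 - Suc (Suc j)) + 2 * X ?i + X (k + 2 - j) \<in> \<int>"
      using rows[OF i(3)] i unfolding bordered_row_def by simp
    have IH: "X (k + 2 - j) - (-1) ^ Suc j * real j * z \<in> \<int>"
      "X ?i - (-1) ^ j * real (Suc j) * z \<in> \<int>"
      using Suc.IH Suc.prems by auto
    have "(X (k + 2 - Suc (Suc j)) + 2 * X ?i + X (k + 2 - j))
        - 2 * (X ?i - (-1) ^ j * real (Suc j) * z) - (X (k + 2 - j) - (-1) ^ Suc j * real j * z) \<in> \<int>"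
      by (rule Ints_diff[OF Ints_diff[OF row Ints_mult[OF Ints_numeral IH(2)]] IH(1)])
    also have "(X (k + 2 - Suc (Suc j)) + 2 * X ?i + X (k + 2 - j))
        - 2 * (X ?i - (-1) ^ j * real (Suc j) * z) - (X (k + 2 - j) - (-1) ^ Suc j * real j * z) =
        X (k + 2 - Suc (Suc j)) - (-1) ^ Suc j * real (Suc (Suc j)) * z"
      by (simp add: algebra_simps)
    finally show ?case using IH by simp
  qed
  have X2: "X 2 + real k * z \<in> \<int>" and X1: "X 1 - real (Suc k) * z \<in> \<int>"
    using chain[of k] \<open>even k\<close> by (simp_all add: numeral_2_eq_2)
  let ?c = "2 * x * int (k + 1) - int k"
  have r1: "of_int v * s + of_int ?c * z \<in> \<int>"
  proof -
    have "of_int (P * v) * X 0 + of_int (2 * x) * X 1 + X 2 \<in> \<int>"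
      using rows[of 1] by (simp add: bordered_row_def)
    then have "(of_int (P * v) * X 0 + of_int (2 * x) * X 1 + X 2) - of_int (2 * x) * (X 1 - real (Suc k) * z)
        - (X 2 + real k * z) \<in> \<int>"
      by (rule Ints_diff[OF Ints_diff[OF _ Ints_mult[OF Ints_of_int X1]] X2])
    then show ?thesis by (simp add: s_def algebra_simps)
  qed
  have r0: "of_int (2 * q) * s + of_int (P * v * int (k + 1)) * z \<in> \<int>"
  proof -
    have "of_int (2 * q * P) * X 0 + of_int (P * v) * X 1 \<in> \<int>"
      using rows[of 0] by (simp add: bordered_row_def)
    then have "(of_int (2 * q * P) * X 0 + of_int (P * v) * X 1) - of_int (P * v) * (X 1 - real (Suc k) * z) \<in> \<int>"
      by (rule Ints_diff[OF _ Ints_mult[OF Ints_of_int X1]])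
    then show ?thesis by (simp add: s_def algebra_simps)
  qed
  \<comment> \<open>Up to sign, the determinant of the integral system \<open>r0\<close>,
    \<open>r1\<close> in \<open>s\<close> and \<open>z\<close>. Being 1, it lets Cramer's rule solve
    for both within the integers.\<close>
  have det': "of_int (2 * q) * of_int ?c - of_int (P * v * int (k + 1)) * of_int v = (1 :: real)"
    using arg_cong[OF det, of real_of_int] by (simp only: of_int_mult[symmetric] of_int_diff[symmetric] of_int_1
      power2_eq_square mult_ac)
  have "of_int (2 * q) * (of_int v * s + of_int ?c * z) -
      of_int v * (of_int (2 * q) * s + of_int (P * v * int (k + 1)) * z) =
      (of_int (2 * q) * of_int ?c - of_int (P * v * int (k + 1)) * of_int v) * z"
    by (simp add: algebra_simps)
  also have "\<dots> = z" unfolding det' by simp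
  finally have "z = of_int (2 * q) * (of_int v * s + of_int ?c * z) -
      of_int v * (of_int (2 * q) * s + of_int (P * v * int (k + 1)) * z)" ..
  then have z: "z \<in> \<int>" using r0 r1 by (metis Ints_diff Ints_mult Ints_of_int)
  have vs: "of_int v * s \<in> \<int>" using Ints_diff[OF r1 Ints_mult[OF Ints_of_int[of ?c] z]] by (simp only: add_diff_cancel_right')
  have qs: "of_int (2 * q) * s \<in> \<int>" using Ints_diff[OF r0 Ints_mult[OF Ints_of_int[of "P * v * int (k + 1)"] z]] by (simp only: add_diff_cancel_right')
  have "of_int ?c * (of_int (2 * q) * s) - of_int (P * v * int (k + 1)) * (of_int v * s) =
      (of_int (2 * q) * of_int ?c - of_int (P * v * int (k + 1)) * of_int v) * s"
    by (simp add: algebra_simps)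
  also have "\<dots> = s" unfolding det' by simp
  finally have "s = of_int ?c * (of_int (2 * q) * s) - of_int (P * v * int (k + 1)) * (of_int v * s)" ..
  then show "of_int P * X 0 \<in> \<int>" unfolding s_def[symmetric] using vs qs by (metis Ints_diff Ints_mult Ints_of_int)
  show "X i \<in> \<int>" if "1 \<le> i" "i < k + 2" for i
  proof -
    let ?j = "k + 1 - i"
    have "X (k + 2 - Suc ?j) - (-1) ^ ?j * real (Suc ?j) * z \<in> \<int>" using chain[of ?j] that by simp
    moreover have "k + 2 - Suc ?j = i" using that by auto
    moreover have "(-1) ^ ?j * real (Suc ?j) * z \<in> \<int>" using z by (intro Ints_mult Ints_power) auto
    ultimately show ?thesis by (metis Ints_add diff_add_cancel)
  qed
qed

text \<open>Equal nonzero Legendre symbols make \<open>a * b\<close> a square \<open>y^2\<close>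
  modulo \<open>p\<close>, by Euler's criterion; then \<open>s = y / a\<close> works modulo
  \<open>p\<close>. Hensel lifting reaches higher powers, since the derivative
  \<open>2 * a * s\<close> is a unit for odd \<open>p\<close>.\<close>

lemma square_ratio_mod_prime_power:
  fixes p r :: nat and a b :: int
  assumes p: "prime p" "odd p" and a: "coprime a (int p)" "Legendre b (int p) = Legendre a (int p)"
    and "r > 0"
  shows "\<exists>s. [a * s\<^sup>2 = b] (mod int p ^ r) \<and> coprime s (int p)"
proof -
  have p2: "2 < int p" using p prime_ge_2_nat[of p] by (cases "p = 2") auto
  then have p2n: "2 < p" by simp
  have pi: "prime (int p)" using p by simp
  have a0: "\<not> [a = 0] (mod int p)"
    using a(1) pi by (metis cong_0_iff coprime_common_divisor dvd_refl not_prime_unit)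
  then have La: "Legendre a (int p) \<noteq> 0" by (simp add: Legendre_def)
  then have b0: "\<not> [b = 0] (mod int p)" using a(2) by (auto simp: Legendre_def)
  have cop: "coprime s (int p)" if "[a * s\<^sup>2 = b] (mod int p)" for s
  proof (rule ccontr)
    assume "\<not> coprime s (int p)"
    then have "int p dvd s" using prime_imp_coprime_int[OF pi, of s] by (auto simp: coprime_commute)
    then have "int p dvd a * s\<^sup>2" by (simp add: power2_eq_square)
    then show False using that b0 by (metis cong_0_iff cong_sym cong_trans)
  qed
  have base: "\<exists>s. [a * s\<^sup>2 = b] (mod int p)"
  proof -
    have "[Legendre (a * b) (int p) = (a * b) ^ ((p - 1) div 2)] (mod int p)"
      using euler_criterion[OF p(1) p2n] .
    also have "(a * b) ^ ((p - 1) div 2) = a ^ ((p - 1) div 2) * b ^ ((p - 1) div 2)"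
      by (rule power_mult_distrib)
    also have "[\<dots> = Legendre a (int p) * Legendre b (int p)] (mod int p)"
      by (intro cong_mult cong_sym[OF euler_criterion[OF p(1) p2n]])
    also have "Legendre a (int p) * Legendre b (int p) = 1" unfolding a(2) using La by (auto simp: Legendre_def)
    finally have L1: "[Legendre (a * b) (int p) = 1] (mod int p)" .
    have "Legendre (a * b) (int p) = 1"
    proof (rule ccontr)
      assume "Legendre (a * b) (int p) \<noteq> 1"
      then have "Legendre (a * b) (int p) = 0 \<or> Legendre (a * b) (int p) = -1" by (auto simp: Legendre_def split: if_splits)
      then have "int p dvd 1 \<or> int p dvd 2" using L1 by (auto simp: cong_iff_dvd_diff)
      then show False using p2 zdvd_imp_le[of "int p" 1] zdvd_imp_le[of "int p" 2] by auto
    qed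
    then obtain y where y: "[y\<^sup>2 = a * b] (mod int p)"
      by (auto simp: Legendre_def QuadRes_def split: if_splits)
    obtain a' where a': "[a * a' = 1] (mod int p)" using cong_solve_coprime_int[OF a(1)] by blast
    have "[a * (y * a')\<^sup>2 = a * a' * a' * y\<^sup>2] (mod int p)" by (simp add: power2_eq_square algebra_simps)
    also have "[a * a' * a' * y\<^sup>2 = 1 * a' * (a * b)] (mod int p)"
      by (intro cong_mult a' y cong_refl)
    also have "1 * a' * (a * b) = a * a' * b" by simp
    also have "[a * a' * b = 1 * b] (mod int p)" by (intro cong_mult a' cong_refl)
    finally show ?thesis by auto
  qed
  have "\<exists>s. [a * s\<^sup>2 = b] (mod int p ^ Suc l)" for l
  proof (induction l)
    case 0 then show ?case using base by simp
  next
    case (Suc l)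
    then obtain s where s: "[a * s\<^sup>2 = b] (mod int p ^ Suc l)" by blast
    then have "[a * s\<^sup>2 = b] (mod int p)"
      by (rule cong_dvd_modulus) simp
    then have "coprime s (int p)" by (rule cop)
    moreover have "coprime 2 (int p)" using p by simp
    ultimately have "coprime (2 * a * s) (int p)" using a(1) by simp
    then obtain i where i: "[2 * a * s * i = 1] (mod int p)" using cong_solve_coprime_int by blast
    obtain t where t: "b - a * s\<^sup>2 = int p ^ Suc l * t" using s by (metis cong_iff_dvd_diff cong_sym dvdE)
    have "int p dvd 2 * a * s * i - 1" using i by (simp add: cong_iff_dvd_diff)
    then obtain w where w: "2 * a * s * i = 1 + int p * w" by (metis dvdE diff_add_cancel add.commute)
    \<comment> \<open>Newton correction: \<open>i\<close> inverts the derivative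
      \<open>2 * a * s\<close> modulo \<open>p\<close>, and \<open>t\<close> is the error divided by
      \<open>p ^ (l + 1)\<close>.\<close>
    define u where "u = i * t"
    have "a * (s + int p ^ Suc l * u)\<^sup>2 - b =
       int p ^ Suc l * (2 * a * s * i * t) + a * (int p ^ Suc l * int p ^ Suc l) * u\<^sup>2 - (b - a * s\<^sup>2)"
      by (simp add: u_def power2_eq_square algebra_simps)
    also have "\<dots> = int p ^ Suc (Suc l) * (w * t + a * int p ^ l * u\<^sup>2)"
      unfolding w t by (simp add: algebra_simps)
    finally have "[a * (s + int p ^ Suc l * u)\<^sup>2 = b] (mod int p ^ Suc (Suc l))"
      by (simp add: cong_iff_dvd_diff)
    then show ?case by blast
  qed
  then obtain s where s: "[a * s\<^sup>2 = b] (mod int p ^ r)" using \<open>r > 0\<close> by (metis Suc_pred)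
  then have "[a * s\<^sup>2 = b] (mod int p)" by (rule cong_dvd_modulus) (use \<open>r > 0\<close> in simp)
  then show ?thesis using s cop by blast
qed

lemma mod_ints_cong: "t - t' \<in> \<int> \<Longrightarrow> mod_ints t = mod_ints t'"
proof -
  have sub: "mod_ints t \<subseteq> mod_ints t'" if "t - t' \<in> \<int>" for t t'
  proof
    fix y assume "y \<in> mod_ints t"
    then obtain z where z: "z \<in> \<int>" "y = t + z" by (auto simp: mod_ints_def)
    then have "y = t' + ((t - t') + z)" "(t - t') + z \<in> \<int>" using that by auto
    then show "y \<in> mod_ints t'" unfolding mod_ints_def by blast
  qed
  assume "t - t' \<in> \<int>"
  then show ?thesis using sub[of t t'] sub[of t' t] by (metis Ints_minus minus_diff_eq subset_antisym)
qed

text \<open>A dual vector \<open>w\<close> is integral except in coordinate 0, where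
  \<open>m = P * w $ 0\<close> is an integer; modulo the integers, half its norm is
  \<open>q m^2 / P\<close>. Because \<open>q\<close> is congruent to \<open>a s^2\<close>, this is
  the value of \<open>A_module P a\<close> at \<open>s m\<close>. So \<open>w\<close> is sent to
  \<open>s m\<close> modulo \<open>P\<close>, and the first isomorphism theorem applies:
  \<open>s\<close> is a unit, hence the kernel is the lattice.\<close>

lemma bordered_lattice_discriminant:
  fixes k q P :: nat and v x s a :: int
  defines "L \<equiv> gram_lattice (bordered_F_mat k (2 * real q * real P) (real P * real_of_int v) (2 * real_of_int x))"
  assumes "even k" and "q > 0" and P: "P > 0"
    and det: "2 * int q * (2 * x * int (k + 1) - int k) - int P * v\<^sup>2 * int (k + 1) = 1"
    and s: "[a * s\<^sup>2 = int q] (mod int P)" "coprime s (int P)"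
  shows "even_lattice L" and "pos_def_lattice L" and "lattice_rank L = k + 2"
    and "isometric (discriminant_module L) (A_module P a)"
proof -
  define n where "n = k + 2"
  define \<alpha> \<beta> \<gamma> where "\<alpha> = 2 * int q * int P" and "\<beta> = int P * v" and "\<gamma> = 2 * x"
  define g where "g = bordered_entry (real_of_int \<alpha>) (real_of_int \<beta>) (real_of_int \<gamma>)"
  have L: "L = gram_lattice (mat n n (\<lambda>(i, j). g i j))"
    unfolding L_def bordered_F_mat_eq g_def n_def \<alpha>_def \<beta>_def \<gamma>_def by simp
  have g_int: "g i j = of_int (bordered_entry \<alpha> \<beta> \<gamma> i j)" for i j
    by (simp add: g_def bordered_entry_def)
  have g_sym: "bordered_entry \<alpha> \<beta> \<gamma> i j = bordered_entry \<alpha> \<beta> \<gamma> j i" for i j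
    by (auto simp: bordered_entry_def)
  have g_even: "even (bordered_entry \<alpha> \<beta> \<gamma> i i)" for i
    by (auto simp: bordered_entry_def \<alpha>_def \<gamma>_def)
  have det_real: "2 * real q * (2 * real_of_int x * real (k + 1) - real k) - real P * (real_of_int v)\<^sup>2 * real (k + 1) = 1"
    using arg_cong[OF det, of real_of_int] by simp
  have det_pos: "of_int \<alpha> * (of_int \<gamma> - real k / real (Suc k)) - (real_of_int \<beta>)\<^sup>2 > 0"
  proof -
    have "of_int \<alpha> * (of_int \<gamma> - real k / real (Suc k)) - (real_of_int \<beta>)\<^sup>2 =
      real P / real (k + 1) * (2 * real q * (2 * real_of_int x * real (k + 1) - real k) - real P * (real_of_int v)\<^sup>2 * real (k + 1))"
      by (simp add: \<alpha>_def \<beta>_def \<gamma>_def field_simps power2_eq_square)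
    then show ?thesis using P unfolding det_real by simp
  qed
  have pos: "gram_form n g X X > 0" if "\<exists>i<n. X i \<noteq> 0" for X
  proof -
    let ?X = "\<lambda>i. if i < n then X i else 0"
    have "gram_form n g ?X ?X > 0"
      unfolding n_def g_def
      by (rule bordered_form_pos)
         (use that \<open>q > 0\<close> P det_pos in \<open>auto simp: n_def \<alpha>_def\<close>)
    moreover have "gram_form n g ?X ?X = gram_form n g X X" by (rule gram_form_cong) auto
    ultimately show ?thesis by simp
  qed
  have lat: "even_lattice L" "pos_def_lattice L" "lattice_rank L = n"
    unfolding L
    by (rule gram_lattice_even_pos_def[where h = "bordered_entry \<alpha> \<beta> \<gamma>"];
        use g_int g_sym g_even pos in blast)+
  show even: "even_lattice L" by (fact lat)
  show "pos_def_lattice L" by (fact lat)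
  show "lattice_rank L = k + 2" using lat(3) by (simp add: n_def)

  \<comment> \<open>Zero padding, so that the convention \<open>X (k + 2) = 0\<close> of the row
    formulas holds.\<close>
  define ext where "ext w = (\<lambda>i. if i < n then w $ i else 0)" for w :: "real vec"
  have ext_n: "ext w (k + 2) = 0" for w by (simp add: ext_def n_def)
  have form: "form L u w = gram_form n g (ext u) (ext w)" if "u \<in> carrier_vec n" "w \<in> carrier_vec n" for u w
    unfolding L form_gram_lattice[OF that] by (rule gram_form_cong) (simp_all add: ext_def)
  have form_row: "form L u w = (\<Sum>i<n. ext u i * bordered_row (of_int \<alpha>) (of_int \<beta>) (of_int \<gamma>) (ext w) i)"
    if "u \<in> carrier_vec n" "w \<in> carrier_vec n" for u w
    unfolding form[OF that] gram_form_def
  proof (intro sum.cong refl)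
    fix i assume "i \<in> {..<n}"
    then have "bordered_row (of_int \<alpha>) (of_int \<beta>) (of_int \<gamma>) (ext w) i = (\<Sum>j<n. g i j * ext w j)"
      using bordered_row_eq[of "ext w" k i, OF ext_n] by (simp add: n_def g_def)
    then show "(\<Sum>j<n. ext u i * g i j * ext w j) = ext u i * bordered_row (of_int \<alpha>) (of_int \<beta>) (of_int \<gamma>) (ext w) i"
      by (simp only: sum_distrib_left mult.assoc)
  qed
  have form_sym: "form L u w = form L w u" if "u \<in> carrier_vec n" "w \<in> carrier_vec n" for u w
    unfolding form[OF that] form[OF that(2,1)]
    by (rule gram_form_commute) (simp add: g_int g_sym)
  have carrier: "carrier (ambient L) = carrier_vec n" by (simp add: L)
  have points: "points L = {w \<in> carrier_vec n. \<forall>i<n. w $ i \<in> \<int>}"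
    unfolding L gram_lattice_def by simp
  have dual: "w \<in> dual_lattice L \<longleftrightarrow> w \<in> carrier_vec n \<and> real P * w $ 0 \<in> \<int> \<and> (\<forall>i. 1 \<le> i \<and> i < n \<longrightarrow> w $ i \<in> \<int>)"
    for w
  proof
    assume w: "w \<in> dual_lattice L"
    then have wc: "w \<in> carrier_vec n" by (simp add: dual_lattice_def carrier)
    have rows: "bordered_row (of_int (2 * int q * int P)) (of_int (int P * v)) (of_int (2 * x)) (ext w) i \<in> \<int>"
      if "i < k + 2" for i
    proof -
      have i: "i < n" using that by (simp add: n_def)
      have "unit_vec n i \<in> points L" using i by (auto simp: points)
      then have "form L (unit_vec n i) w \<in> \<int>"
        using w form_sym[OF wc unit_vec_carrier[of n i]] unfolding dual_lattice_def by fastforce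
      moreover have "form L (unit_vec n i) w =
          (\<Sum>j<n. if j = i then bordered_row (of_int \<alpha>) (of_int \<beta>) (of_int \<gamma>) (ext w) i else 0)"
        unfolding form_row[OF unit_vec_carrier wc] using i by (intro sum.cong) (auto simp: ext_def)
      ultimately show ?thesis using i by (simp add: \<alpha>_def \<beta>_def \<gamma>_def)
    qed
    note coords = bordered_dual_coordinates[of "ext w" k "int q" x "int P" v, OF ext_n \<open>even k\<close> det rows]
    show "w \<in> carrier_vec n \<and> real P * w $ 0 \<in> \<int> \<and> (\<forall>i. 1 \<le> i \<and> i < n \<longrightarrow> w $ i \<in> \<int>)"
    proof (intro conjI allI impI wc)
      show "real P * w $ 0 \<in> \<int>" using coords(1) by (simp add: ext_def n_def)
      fix i assume "1 \<le> i \<and> i < n"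
      then show "w $ i \<in> \<int>" using coords(2)[of i] by (simp add: ext_def n_def)
    qed
  next
    assume w: "w \<in> carrier_vec n \<and> real P * w $ 0 \<in> \<int> \<and> (\<forall>i. 1 \<le> i \<and> i < n \<longrightarrow> w $ i \<in> \<int>)"
    have ext_int: "ext w i \<in> \<int>" if "1 \<le> i" for i using w that by (auto simp: ext_def)
    have w0: "real P * ext w 0 \<in> \<int>" using w by (simp add: ext_def n_def)
    have row: "bordered_row (of_int \<alpha>) (of_int \<beta>) (of_int \<gamma>) (ext w) i \<in> \<int>" for i
    proof -
      consider "i = 0" | "i = 1" | "i \<ge> 2" by linarith
      then show ?thesis
      proof cases
        case 1
        have "real_of_int (2 * int q) * (real P * ext w 0) + real_of_int \<beta> * ext w 1 \<in> \<int>"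
          by (rule Ints_add[OF Ints_mult[OF Ints_of_int w0] Ints_mult[OF Ints_of_int ext_int]]) simp
        then show ?thesis using 1 by (simp add: bordered_row_def \<alpha>_def mult_ac)
      next
        case 2
        have "real_of_int v * (real P * ext w 0) + real_of_int \<gamma> * ext w 1 + ext w 2 \<in> \<int>"
          by (intro Ints_add[OF Ints_add[OF Ints_mult[OF Ints_of_int w0] Ints_mult[OF Ints_of_int ext_int]] ext_int]) simp_all
        then show ?thesis using 2 by (simp add: bordered_row_def \<beta>_def mult_ac)
      next
        case 3
        then show ?thesis using ext_int[of "i - 1"] ext_int[of i] ext_int[of "Suc i"]
          by (auto simp: bordered_row_def intro!: Ints_add Ints_mult)
      qed
    qed
    have "form L w u \<in> \<int>" if "u \<in> points L" for u
    proof -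
      have uc: "u \<in> carrier_vec n" using that by (simp add: points)
      have "form L u w \<in> \<int>"
        unfolding form_row[OF uc conjunct1[OF w]] using that
        by (intro Ints_sum Ints_mult row) (auto simp: ext_def points)
      then show ?thesis using form_sym[OF uc conjunct1[OF w]] by simp
    qed
    then show "w \<in> dual_lattice L" using w by (simp add: dual_lattice_def carrier)
  qed

  define f where "f w = (s * \<lfloor>real P * w $ 0\<rfloor>) mod int P" for w :: "real vec"
  have Q: "form L w w / 2 - real_of_int a / real P * (real_of_int (f w))\<^sup>2 \<in> \<int>" if w: "w \<in> dual_lattice L" for w
  proof -
    define m where "m = \<lfloor>real P * w $ 0\<rfloor>"
    have wc: "w \<in> carrier_vec n" and m: "real P * ext w 0 = of_int m"
      and wi: "\<And>i. ext w (Suc i) \<in> \<int>"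
      using w unfolding dual by (auto simp: m_def ext_def n_def)
    have w0: "ext w 0 = of_int m / real P" using m P by (simp add: field_simps)
    let ?t = "\<Sum>i<k. (ext w (i + 2))\<^sup>2 + ext w (i + 1) * ext w (i + 2)"
    have t: "(\<Sum>i<k. 2 * (ext w (i + 2))\<^sup>2 + 2 * ext w (i + 1) * ext w (i + 2)) = 2 * ?t"
      unfolding sum_distrib_left by (intro sum.cong) (simp_all add: algebra_simps)
    have "form L w w / 2 = real q * (of_int m)\<^sup>2 / real P + (of_int v * of_int m * ext w 1 + of_int x * (ext w 1)\<^sup>2 + ?t)"
      unfolding form[OF wc wc] g_def n_def bordered_form_eq[of "ext w" k, OF ext_n] t
      unfolding w0 \<alpha>_def \<beta>_def \<gamma>_def using P by (simp add: field_simps power2_eq_square)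
    moreover have "of_int v * of_int m * ext w 1 + of_int x * (ext w 1)\<^sup>2 + ?t \<in> \<int>"
      using wi[of 0] wi[of "Suc _"] wi by (intro Ints_add Ints_mult Ints_sum Ints_power) auto
    moreover have "real q * (of_int m)\<^sup>2 / real P - real_of_int a / real P * (real_of_int (f w))\<^sup>2 \<in> \<int>"
    proof -
      have "[f w = s * m] (mod int P)" by (simp add: f_def m_def)
      then have "[a * (f w)\<^sup>2 = a * (s * m)\<^sup>2] (mod int P)" by (intro cong_mult cong_pow cong_refl)
      also have "a * (s * m)\<^sup>2 = a * s\<^sup>2 * m\<^sup>2" by (simp add: power_mult_distrib)
      also have "[a * s\<^sup>2 * m\<^sup>2 = int q * m\<^sup>2] (mod int P)" by (intro cong_mult s(1) cong_refl)
      finally have "int P dvd int q * m\<^sup>2 - a * (f w)\<^sup>2" by (meson cong_iff_dvd_diff cong_sym)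
      then obtain z where "int q * m\<^sup>2 - a * (f w)\<^sup>2 = int P * z" by (rule dvdE)
      then have "real q * (of_int m)\<^sup>2 - of_int a * (of_int (f w))\<^sup>2 = real P * of_int z"
        using arg_cong[of _ _ real_of_int] by fastforce
      then have "real q * (of_int m)\<^sup>2 / real P - real_of_int a / real P * (real_of_int (f w))\<^sup>2 = of_int z"
        using P by (simp add: field_simps)
      then show ?thesis by simp
    qed
    ultimately show ?thesis by (metis (no_types, lifting) Ints_add add_diff_eq add.commute)
  qed
  interpret N: normal "points L" "dual_group L" by (rule points_normal_dual_group[OF even])
  have plus: "add (ambient L) = (+)" by (simp add: L)
  have f_add: "f (u + w) = (f u + f w) mod int P" if "u \<in> dual_lattice L" "w \<in> dual_lattice L" for u w
  proof -
    have "real P * (u + w) $ 0 = real P * u $ 0 + real P * w $ 0"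
      using that unfolding dual by (auto simp: n_def algebra_simps)
    moreover have "real P * u $ 0 \<in> \<int>" "real P * w $ 0 \<in> \<int>" using that unfolding dual by auto
    ultimately have "\<lfloor>real P * (u + w) $ 0\<rfloor> = \<lfloor>real P * u $ 0\<rfloor> + \<lfloor>real P * w $ 0\<rfloor>"
      by (metis Ints_cases floor_add_int floor_of_int)
    then show ?thesis by (simp add: f_def mod_simps algebra_simps)
  qed
  have f_hom: "f \<in> hom (dual_group L) (integer_mod_group P)"
    using P f_add by (auto simp: hom_def carrier_integer_mod_group plus f_def)
  interpret H: group_hom "dual_group L" "integer_mod_group P" f
    by (intro group_hom.intro group_hom_axioms.intro N.is_group group_integer_mod_group f_hom)
  have "f w = 0 \<longleftrightarrow> w \<in> points L" if w: "w \<in> dual_lattice L" for w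
  proof -
    have "f w = 0 \<longleftrightarrow> int P dvd s * \<lfloor>real P * w $ 0\<rfloor>" by (auto simp: f_def)
    also have "\<dots> \<longleftrightarrow> int P dvd \<lfloor>real P * w $ 0\<rfloor>"
      using s(2) by (simp add: coprime_dvd_mult_right_iff coprime_commute)
    also have "\<dots> \<longleftrightarrow> w $ 0 \<in> \<int>"
    proof
      assume "int P dvd \<lfloor>real P * w $ 0\<rfloor>"
      then obtain z where "\<lfloor>real P * w $ 0\<rfloor> = int P * z" by (rule dvdE)
      moreover have "real P * w $ 0 = of_int \<lfloor>real P * w $ 0\<rfloor>" using w unfolding dual by auto
      ultimately have "real P * w $ 0 = real P * of_int z" by simp
      then show "w $ 0 \<in> \<int>" using P by simp
    next
      assume "w $ 0 \<in> \<int>"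
      then obtain z where "w $ 0 = of_int z" by (rule Ints_cases)
      then have "real P * w $ 0 = of_int (int P * z)" by simp
      then show "int P dvd \<lfloor>real P * w $ 0\<rfloor>" by (simp only: floor_of_int dvd_triv_left)
    qed
    also have "\<dots> \<longleftrightarrow> w \<in> points L"
    proof -
      have "(\<forall>i<n. w $ i \<in> \<int>) \<longleftrightarrow> w $ 0 \<in> \<int>"
        using w unfolding dual by (metis Suc_leI One_nat_def gr0I n_def add_gr_0 zero_less_numeral)
      then show ?thesis using w unfolding dual points by auto
    qed
    finally show ?thesis .
  qed
  then have ker: "kernel (dual_group L) (integer_mod_group P) f = points L"
    using N.subset by (auto simp: kernel_def)
  have surj: "f ` carrier (dual_group L) = carrier (integer_mod_group P)"
  proof (intro subset_antisym subsetI)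
    fix y assume "y \<in> carrier (integer_mod_group P)"
    then have y: "0 \<le> y" "y < int P" using P by (auto simp: carrier_integer_mod_group)
    obtain s' where s': "[s * s' = 1] (mod int P)" using cong_solve_coprime_int[OF s(2)] by blast
    \<comment> \<open>A multiple of \<open>e_0 / P\<close>; the factor \<open>s'\<close> undoes the
      multiplication by \<open>s\<close> built into \<open>f\<close>.\<close>
    define w where "w = vec n (\<lambda>i. if i = 0 then real_of_int (s' * y) / real P else 0)"
    have w0: "real P * w $ 0 = of_int (s' * y)" using P by (simp add: w_def n_def)
    then have "w \<in> dual_lattice L" unfolding dual w0 by (auto simp: w_def)
    moreover have "f w = y"
    proof -
      have "[s * (s' * y) = 1 * y] (mod int P)"
        using cong_mult[OF s' cong_refl[of y]] by (simp add: mult.assoc)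
      then show ?thesis using y unfolding f_def w0 by (simp add: cong_def del: of_int_mult)
    qed
    ultimately show "y \<in> f ` carrier (dual_group L)" by auto
  qed auto
  have iso: "(\<lambda>X. the_elem (f ` X)) \<in> iso (dual_group L Mod points L) (integer_mod_group P)"
    using H.FactGroup_iso_set[OF surj] unfolding ker .
  show "isometric (discriminant_module L) (A_module P a)"
    unfolding isometric_def fst_discriminant_module
  proof (intro bexI ballI)
    show "(\<lambda>X. the_elem (f ` X)) \<in> iso (dual_group L Mod points L) (fst (A_module P a))"
      using iso by (simp add: A_module_def)
    fix X assume "X \<in> carrier (dual_group L Mod points L)"
    then obtain w where w: "w \<in> dual_lattice L" and X: "X = points L #>\<^bsub>dual_group L\<^esub> w"
      by (auto simp: carrier_FactGroup)
    have wX: "w \<in> X" unfolding X using w by (intro N.rcos_self N.is_subgroup) auto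
    have Xu: "u \<in> dual_lattice L" "f u = f w" if uX: "u \<in> X" for u
    proof -
      obtain p where p: "p \<in> points L" "u = p + w" using uX unfolding X r_coset_def by (auto simp: plus)
      have pd: "p \<in> dual_lattice L" using p N.subset by auto
      have "p \<in> kernel (dual_group L) (integer_mod_group P) f" using p ker by simp
      then have "f p = 0" by (simp add: kernel_def)
      then show "f u = f w" using f_add[OF pd w] p by (simp add: f_def)
      show "u \<in> dual_lattice L" using N.m_closed[of p w] pd w p by (simp add: plus)
    qed
    have "f ` X = (\<lambda>_. f w) ` X" by (rule image_cong[OF refl]) (rule Xu(2))
    then have "f ` X = {f w}" using wX by auto
    then have "the_elem (f ` X) = f w" by simp
    moreover have "(\<Union>u\<in>X. mod_ints (form L u u / 2)) = mod_ints (real_of_int a / real P * (real_of_int (f w))\<^sup>2)"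
    proof -
      have "mod_ints (form L u u / 2) = mod_ints (real_of_int a / real P * (real_of_int (f w))\<^sup>2)" if "u \<in> X" for u
        using Q[OF Xu(1)[OF that]] Xu(2)[OF that] by (intro mod_ints_cong) simp
      then show ?thesis using wX by auto
    qed
    ultimately show "snd (A_module P a) (the_elem (f ` X)) = snd (discriminant_module L) X"
      by (simp add: A_module_def discriminant_module_def)
  qed
qed

section \<open>Minimality of the rank\<close>

lemma one_plus_i_power_real_neg:
  assumes "0 < j" "j < 8" "(1 + \<i>) ^ j = complex_of_real c"
  shows "c < 0"
proof -
  \<comment> \<open>Among these exponents only 4 gives a real power, namely -4.\<close>
  have "j \<in> {1, 2, 3, 4, 5, 6, 7}" using assms by auto
  then show ?thesis using assms(3)
    by (auto simp: numeral_eq_Suc complex_eq_iff)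
qed

text \<open>Both lattices express the same Gauss sum, so a smaller rank of \<open>M\<close> would
  make a power of \<open>1 + \<i>\<close> with exponent between 1 and 7 a positive real.
  \<open>P > 1\<close> excludes rank 0 for \<open>M\<close>, which keeps the exponent below 8 even
  when \<open>L\<close> has rank 8.\<close>

lemma lattice_rank_minimal:
  fixes L :: "'u zlattice" and M :: "'v zlattice"
  assumes "even_lattice L" "pos_def_lattice L" "isometric (discriminant_module L) (A_module P a)"
    and "even_lattice M" "pos_def_lattice M" "isometric (discriminant_module M) (A_module P a)"
    and "P > 1" and "lattice_rank L \<le> 8"
  shows "lattice_rank L \<le> lattice_rank M"
proof (rule ccontr)
  assume less: "\<not> lattice_rank L \<le> lattice_rank M"
  define l m where "l = lattice_rank L" and "m = lattice_rank M"
  have P: "P > 0" using assms by simp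
  obtain c d where "c > 0" "d > 0" and eq: "of_real c * (1 + \<i>) ^ l = of_real d * (1 + \<i>) ^ m"
    using milgram(1)[OF assms(1,2) P assms(3)] milgram(1)[OF assms(4,5) P assms(6)]
    unfolding l_def m_def by metis
  have m: "m > 0" using milgram(2)[OF assms(4,5) P assms(6)] assms by (simp add: m_def)
  have l: "l = m + (l - m)" "0 < l - m" "l - m < 8" using less m assms by (auto simp: l_def m_def)
  have "1 + \<i> \<noteq> 0" by (simp add: complex_eq_iff)
  then have "(1 + \<i>) ^ m \<noteq> 0" by simp
  moreover have "(1 + \<i>) ^ m * (of_real c * (1 + \<i>) ^ (l - m)) = (1 + \<i>) ^ m * of_real d"
    using eq by (subst (asm) l(1)) (simp add: power_add mult_ac)
  ultimately have "of_real c * (1 + \<i>) ^ (l - m) = of_real d" by (metis mult_cancel_left)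
  then have "(1 + \<i>) ^ (l - m) = complex_of_real (d / c)" using \<open>c > 0\<close> by (simp add: field_simps)
  then have "d / c < 0" using one_plus_i_power_real_neg l by blast
  then show False using \<open>c > 0\<close> \<open>d > 0\<close> by (simp add: divide_less_0_iff)
qed

lemma Legendre_minus_1_mod_4:
  assumes "prime p" "odd p"
  shows "Legendre (-1) (int p) = 1 \<Longrightarrow> p mod 4 = 1"
    and "Legendre (-1) (int p) = -1 \<Longrightarrow> p mod 4 = 3"
proof -
  have p2: "p > 2" using assms prime_ge_2_nat[of p] by (cases "p = 2") auto
  have euler: "[Legendre (-1) (int p) = (-1) ^ ((p - 1) div 2)] (mod int p)"
    using euler_criterion[OF assms(1) p2] .
  have ne: "\<not> [1 = -1] (mod int p)"
    using p2 zdvd_imp_le[of "int p" 2] by (auto simp: cong_iff_dvd_diff)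
  have cases: "p mod 4 = 1 \<and> even ((p - 1) div 2) \<or> p mod 4 = 3 \<and> odd ((p - 1) div 2)"
    using assms(2) by presburger
  show "p mod 4 = 1" if "Legendre (-1) (int p) = 1"
    using cases euler ne that by auto
  show "p mod 4 = 3" if "Legendre (-1) (int p) = -1"
    using cases euler ne that cong_sym[of "-1" 1 "int p"] by auto
qed

lemma odd_power_mod_4:
  fixes p r :: nat
  assumes "odd p" "odd r"
  shows "p ^ r mod 4 = p mod 4"
proof -
  obtain l where r: "r = Suc (2 * l)" using assms(2) by (metis oddE Suc_eq_plus1)
  obtain t where "p = 2 * t + 1" using assms(1) by (rule oddE)
  then have "p\<^sup>2 = 1 + 4 * (t * t + t)" by (simp add: power2_eq_square algebra_simps)
  then have "p\<^sup>2 mod 4 = 1" by simp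
  then have "(p\<^sup>2) ^ l mod 4 = 1" using power_mod[of "p\<^sup>2" 4 l] by simp
  then show ?thesis unfolding r power_Suc power_mult using mod_mult_right_eq[of p "(p\<^sup>2) ^ l" 4] by simp
qed

text \<open>The common form of all four cases: \<open>k \<le> 6\<close> bounds the rank
  \<open>k + 2\<close> by 8, and \<open>q > 0\<close> admits \<open>q = 1\<close> for the lattice of
  rank 2.\<close>

lemma bordered_lattice_minimal:
  fixes k q p r :: nat and v x a :: int
  defines "L \<equiv> gram_lattice (bordered_F_mat k (2 * real q * real p ^ r) (real p ^ r * real_of_int v) (2 * real_of_int x))"
  assumes p: "prime p" "odd p" and a: "coprime a (int p)" "Legendre (int q) (int p) = Legendre a (int p)"
    and "odd r" and "even k" and "k \<le> 6" and "q > 0"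
    and det: "2 * int q * (2 * x * int (k + 1) - int k) - int p ^ r * v\<^sup>2 * int (k + 1) = 1"
  shows "even_lattice L \<and> pos_def_lattice L \<and> isometric (discriminant_module L) (A_module (p ^ r) a) \<and>
    (\<forall>M::'v zlattice. even_lattice M \<and> pos_def_lattice M \<and>
       isometric (discriminant_module M) (A_module (p ^ r) a) \<longrightarrow> lattice_rank L \<le> lattice_rank M)"
proof -
  have r: "r > 0" using \<open>odd r\<close> by (rule odd_pos)
  obtain s where s: "[a * s\<^sup>2 = int q] (mod int p ^ r)" "coprime s (int p)"
    using square_ratio_mod_prime_power[OF p a r] by blast
  have P: "p ^ r > 1" using prime_gt_1_nat[OF p(1)] r by (rule one_less_power)
  have L: "L = gram_lattice (bordered_F_mat k (2 * real q * real (p ^ r)) (real (p ^ r) * real_of_int v) (2 * real_of_int x))"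
    by (simp add: L_def)
  have prems: "p ^ r > 0" "2 * int q * (2 * x * int (k + 1) - int k) - int (p ^ r) * v\<^sup>2 * int (k + 1) = 1"
    "[a * s\<^sup>2 = int q] (mod int (p ^ r))" "coprime s (int (p ^ r))"
    using P det s prime_gt_0_nat[OF p(1)] by simp_all
  note lat = bordered_lattice_discriminant[OF \<open>even k\<close> \<open>q > 0\<close> prems, folded L]
  show ?thesis
    using lat P \<open>k \<le> 6\<close> lattice_rank_minimal[OF lat(1,2,4), where 'v = 'v] by auto
qed

lemma dvd_linear_of_cong:
  fixes q :: nat and b t :: int
  assumes "[q = c] (mod nat t)" "t > 0" "t dvd b * int c + 1"
  shows "t dvd b * int q + 1"
proof -
  have "[int q = int c] (mod int (nat t))" using assms(1) by (simp only: cong_int_iff)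
  then have "[b * int q + 1 = b * int c + 1] (mod t)" using assms(2) by (intro cong_add cong_mult cong_refl) simp
  then show ?thesis using assms(3) cong_dvd_iff by blast
qed

text \<open>Integrality of \<open>x\<close>, checked separately modulo \<open>4 * q\<close> and
  modulo \<open>t\<close>, where \<open>t\<close> is \<open>k + 1\<close>. The two moduli are
  coprime because \<open>t\<close> divides \<open>4 * q * j + 1\<close>.\<close>

lemma border_entry_dvd:
  fixes q t u j :: int
  assumes "4 * q dvd t * u + 1" "t dvd 4 * q * j + 1"
  shows "4 * q * t dvd t * u + 4 * q * j + 1"
proof (rule divides_mult)
  show "4 * q dvd t * u + 4 * q * j + 1"
    using dvd_add[OF assms(1) dvd_triv_left[of "4 * q" j]] by (simp add: algebra_simps)
  show "t dvd t * u + 4 * q * j + 1"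
    using dvd_add[OF dvd_triv_left[of t u] assms(2)] by (simp add: algebra_simps)
  show "coprime (4 * q) t"
  proof (rule coprimeI)
    fix c assume "c dvd 4 * q" "c dvd t"
    then have "c dvd 4 * q * j + 1" "c dvd 4 * q * j" using assms(2) by (auto intro: dvd_trans dvd_mult2)
    then show "is_unit c" by (metis dvd_add_right_iff)
  qed
qed

theorem theorem5p7:
  fixes p r :: nat and a :: int
  assumes "prime p" and "odd p" and "coprime a (int p)" and "odd r"
  shows
   "(Legendre (-1) (int p) = 1 \<and> Legendre a (int p) = 1 \<longrightarrow>
      (\<forall>(q::nat) (v::int) (x::real).
        prime q \<and> [q = 4] (mod 7) \<and> Legendre (int q) (int p) = Legendre a (int p) \<and>
        [7 * int p ^ r * v\<^sup>2 = -1] (mod (4 * int q)) \<and>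
        x = (7 * real p ^ r * (real_of_int v)\<^sup>2 + 12 * real q + 1) / (28 * real q) \<longrightarrow>
        (let L = gram_lattice (bordered_F_mat 6 (2 * real q * real p ^ r)
                                                (real p ^ r * real_of_int v) (2 * x))
         in even_lattice L \<and> pos_def_lattice L \<and>
            isometric (discriminant_module L) (A_module (p ^ r) a) \<and>
            (\<forall>M::'v zlattice. even_lattice M \<and> pos_def_lattice M \<and>
               isometric (discriminant_module M) (A_module (p ^ r) a) \<longrightarrow>
               lattice_rank L \<le> lattice_rank M)))) \<and>
    (Legendre (-1) (int p) = 1 \<and> Legendre a (int p) = -1 \<longrightarrow>
      (\<forall>(q::nat) (v::int) (x::real).
        prime q \<and> odd q \<and> [q = 2] (mod 3) \<and> Legendre (int q) (int p) = -1 \<and>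
        [int p ^ r * v\<^sup>2 = - ((4 * int q + 1) div 3)] (mod int q) \<and>
        [v\<^sup>2 = - ((4 * int q + 1) div 3)] (mod 4) \<and>
        x = 1 / (4 * real q) * (real p ^ r * (real_of_int v)\<^sup>2 + (4 * real q + 1) / 3) \<longrightarrow>
        (let L = gram_lattice (mat_of_rows_list 4
               [[2 * real q * real p ^ r, real p ^ r * real_of_int v, 0, 0],
                [real p ^ r * real_of_int v, 2 * x, 1, 0],
                [0, 1, 2, 1],
                [0, 0, 1, 2]])
         in even_lattice L \<and> pos_def_lattice L \<and>
            isometric (discriminant_module L) (A_module (p ^ r) a) \<and>
            (\<forall>M::'v zlattice. even_lattice M \<and> pos_def_lattice M \<and>
               isometric (discriminant_module M) (A_module (p ^ r) a) \<longrightarrow>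
               lattice_rank L \<le> lattice_rank M)))) \<and>
    (Legendre (-1) (int p) = -1 \<and> Legendre a (int p) = 1 \<longrightarrow>
        (let L = gram_lattice (mat_of_rows_list 2
               [[2 * real p ^ r, real p ^ r],
                [real p ^ r, 1 / 2 * (real p ^ r - real_of_int (Legendre (-1) (int p)) ^ r)]])
         in even_lattice L \<and> pos_def_lattice L \<and>
            isometric (discriminant_module L) (A_module (p ^ r) a) \<and>
            (\<forall>M::'v zlattice. even_lattice M \<and> pos_def_lattice M \<and>
               isometric (discriminant_module M) (A_module (p ^ r) a) \<longrightarrow>
               lattice_rank L \<le> lattice_rank M))) \<and>
    (Legendre (-1) (int p) = -1 \<and> Legendre a (int p) = -1 \<longrightarrow>
      (\<forall>(q::nat) (v::int) (x::real).
        prime q \<and> [q = 3] (mod 5) \<and> Legendre (int q) (int p) = -1 \<and>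
        [5 * int p ^ r * v\<^sup>2 = -1] (mod (4 * int q)) \<and>
        x = (5 * real p ^ r * (real_of_int v)\<^sup>2 + 8 * real q + 1) / (20 * real q) \<longrightarrow>
        (let L = gram_lattice (bordered_F_mat 4 (2 * real q * real p ^ r)
                                                (real p ^ r * real_of_int v) (2 * x))
         in even_lattice L \<and> pos_def_lattice L \<and>
            isometric (discriminant_module L) (A_module (p ^ r) a) \<and>
            (\<forall>M::'v zlattice. even_lattice M \<and> pos_def_lattice M \<and>
               isometric (discriminant_module M) (A_module (p ^ r) a) \<longrightarrow>
               lattice_rank L \<le> lattice_rank M))))"
  proof -
  note minimal = bordered_lattice_minimal[where 'v = 'v, OF assms(1-3) _ assms(4)]
  have Pmod: "int p ^ r mod 4 = int p mod 4"
    using odd_power_mod_4[OF assms(2,4)] by (metis of_nat_mod of_nat_numeral of_nat_power)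
  show ?thesis
  proof (intro conjI impI allI, goal_cases)
    case (1 q v x)
    then have q: "prime q" "[q = 4] (mod 7)" and leg: "Legendre (int q) (int p) = Legendre a (int p)"
      and v: "[7 * int p ^ r * v\<^sup>2 = -1] (mod (4 * int q))"
      and x: "x = (7 * real p ^ r * (real_of_int v)\<^sup>2 + 12 * real q + 1) / (28 * real q)"
      by auto
    have q0: "q > 0" using q(1) by (rule prime_gt_0_nat)
    have "4 * int q dvd 7 * (int p ^ r * v\<^sup>2) + 1"
      using v by (simp add: cong_iff_dvd_diff algebra_simps)
    moreover have "7 dvd 4 * int q * 3 + 1"
      using dvd_linear_of_cong[of q 4 7 12] q(2) by (simp add: mult.commute mult.assoc)
    ultimately have "4 * int q * 7 dvd 7 * int p ^ r * v\<^sup>2 + 12 * int q + 1"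
      using border_entry_dvd[of "int q" 7 "int p ^ r * v\<^sup>2" 3] by (simp add: mult_ac)
    then obtain x' where x': "7 * int p ^ r * v\<^sup>2 + 12 * int q + 1 = 4 * int q * 7 * x'" by (rule dvdE)
    have "x = of_int x'"
      using arg_cong[OF x', of real_of_int] q0 unfolding x by (simp add: field_simps)
    moreover have "2 * int q * (2 * x' * int (6 + 1) - int 6) - int p ^ r * v\<^sup>2 * int (6 + 1) = 1"
      using x' by (simp add: algebra_simps)
    ultimately show ?case
      using minimal[of q 6 x' v] leg q0 by (simp add: Let_def)
  next
    case (2 q v x)
    then have q: "prime q" "odd q" "[q = 2] (mod 3)" and leg: "Legendre (int q) (int p) = Legendre a (int p)"
      and p1: "Legendre (-1) (int p) = 1"
      and v: "[int p ^ r * v\<^sup>2 = - ((4 * int q + 1) div 3)] (mod int q)" "[v\<^sup>2 = - ((4 * int q + 1) div 3)] (mod 4)"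
      and x: "x = 1 / (4 * real q) * (real p ^ r * (real_of_int v)\<^sup>2 + (4 * real q + 1) / 3)"
      by auto
    have q0: "q > 0" using q(1) by (rule prime_gt_0_nat)
    define c where "c = (4 * int q + 1) div 3"
    have "3 dvd 4 * int q + 1" using dvd_linear_of_cong[of q 2 3 4] q(3) by simp
    then have c: "3 * c = 4 * int q + 1" unfolding c_def by simp
    have "int q dvd int p ^ r * v\<^sup>2 + c" using v(1) by (simp add: cong_iff_dvd_diff c_def)
    \<comment> \<open>Since -1 is a square modulo \<open>p\<close>, \<open>p\<close> and hence
      \<open>p ^ r\<close> are 1 modulo 4, so the condition on \<open>v^2\<close> modulo 4 carries
      over to \<open>p ^ r * v^2\<close>. As \<open>q\<close> is odd, the conditions modulo
      \<open>q\<close> and 4 combine.\<close>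
    moreover have "4 dvd int p ^ r * v\<^sup>2 + c"
    proof -
      have "p mod 4 = 1" using Legendre_minus_1_mod_4(1)[OF assms(1,2) p1] .
      then have "int p mod 4 = 1" by presburger
      then have "[int p ^ r = 1] (mod 4)" using Pmod by (simp add: cong_def)
      then have "[int p ^ r * v\<^sup>2 = 1 * - c] (mod 4)" using v(2) unfolding c_def by (rule cong_mult)
      then show ?thesis by (simp add: cong_iff_dvd_diff)
    qed
    moreover have "coprime (int q) 4"
    proof -
      have "coprime (int q) (2 * 2)" using q(2) by (simp only: coprime_mult_right_iff) simp
      then show ?thesis by simp
    qed
    ultimately have "int q * 4 dvd int p ^ r * v\<^sup>2 + c" by (rule divides_mult)
    then obtain x' where x': "int p ^ r * v\<^sup>2 + c = int q * 4 * x'" by (rule dvdE)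
    have "real_of_int c = (4 * real q + 1) / 3" using arg_cong[OF c, of real_of_int] by simp
    then have x'': "x = of_int x'"
      using arg_cong[OF x', of real_of_int] q0 unfolding x by (simp add: field_simps)
    have "3 * (int p ^ r * v\<^sup>2 + c) = 3 * (int q * 4 * x')" using x' by simp
    then have "2 * int q * (2 * x' * int (2 + 1) - int 2) - int p ^ r * v\<^sup>2 * int (2 + 1) = 1"
      using c by (simp add: algebra_simps)
    moreover have "mat_of_rows_list 4
               [[2 * real q * real p ^ r, real p ^ r * real_of_int v, 0, 0],
                [real p ^ r * real_of_int v, 2 * x, 1, 0],
                [0, 1, 2, 1],
                [0, 0, 1, 2]] =
       bordered_F_mat 2 (2 * real q * real p ^ r) (real p ^ r * real_of_int v) (2 * real_of_int x')"
      unfolding bordered_F_mat_eq x''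
      by (rule eq_matI)
         (auto simp: mat_of_rows_list_def bordered_entry_def numeral_eq_Suc less_Suc_eq)
    ultimately show ?case
      using minimal[of q 2 x' v] leg q0 by (simp add: Let_def)
  next
    case 3
    then have m1: "Legendre (-1) (int p) = -1" and leg: "Legendre a (int p) = 1" by auto
    have "p mod 4 = 3" using Legendre_minus_1_mod_4(2)[OF assms(1,2) m1] .
    then have "int p mod 4 = 3" by presburger
    then have "4 dvd int p ^ r + 1" using Pmod by presburger
    then obtain x' where x': "int p ^ r + 1 = 4 * x'" by (rule dvdE)
    have "real p ^ r + 1 = 4 * of_int x'" using arg_cong[OF x', of real_of_int] by simp
    \<comment> \<open>For odd \<open>r\<close> the power of the symbol is -1, so the corner entry is
      \<open>(p ^ r + 1) / 2 = 2 * x'\<close>. The matrix is the bordered one with empty chain and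
      \<open>q = v = 1\<close>, where 1 has the same Legendre symbol as \<open>a\<close>.\<close>
    then have "1 / 2 * (real p ^ r - real_of_int (Legendre (-1) (int p)) ^ r) = 2 * of_int x'"
      using assms(4) unfolding m1 by simp
    then have "mat_of_rows_list 2
               [[2 * real p ^ r, real p ^ r],
                [real p ^ r, 1 / 2 * (real p ^ r - real_of_int (Legendre (-1) (int p)) ^ r)]] =
       bordered_F_mat 0 (2 * real 1 * real p ^ r) (real p ^ r * real_of_int 1) (2 * real_of_int x')"
      unfolding bordered_F_mat_eq
      by (intro eq_matI)
         (auto simp: mat_of_rows_list_def bordered_entry_def numeral_2_eq_2 less_Suc_eq)
    moreover have "Legendre (int 1) (int p) = Legendre a (int p)"
    proof -
      have "\<not> [1 = 0] (mod int p)" using prime_gt_1_nat[OF assms(1)] by (simp add: cong_def)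
      moreover have "QuadRes (int p) 1" unfolding QuadRes_def by (rule exI[of _ 1]) simp
      ultimately show ?thesis using leg by (simp add: Legendre_def)
    qed
    moreover have "2 * int 1 * (2 * x' * int (0 + 1) - int 0) - int p ^ r * 1\<^sup>2 * int (0 + 1) = 1"
      using x' by simp
    ultimately show ?case
      using minimal[of 1 0 x' 1] by (simp add: Let_def)
  next
    case (4 q v x)
    then have q: "prime q" "[q = 3] (mod 5)" and leg: "Legendre (int q) (int p) = Legendre a (int p)"
      and v: "[5 * int p ^ r * v\<^sup>2 = -1] (mod (4 * int q))"
      and x: "x = (5 * real p ^ r * (real_of_int v)\<^sup>2 + 8 * real q + 1) / (20 * real q)"
      by auto
    have q0: "q > 0" using q(1) by (rule prime_gt_0_nat)
    have "4 * int q dvd 5 * (int p ^ r * v\<^sup>2) + 1"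
      using v by (simp add: cong_iff_dvd_diff algebra_simps)
    moreover have "5 dvd 4 * int q * 2 + 1"
      using dvd_linear_of_cong[of q 3 5 8] q(2) by (simp add: mult.commute mult.assoc)
    ultimately have "4 * int q * 5 dvd 5 * int p ^ r * v\<^sup>2 + 8 * int q + 1"
      using border_entry_dvd[of "int q" 5 "int p ^ r * v\<^sup>2" 2] by (simp add: mult_ac)
    then obtain x' where x': "5 * int p ^ r * v\<^sup>2 + 8 * int q + 1 = 4 * int q * 5 * x'" by (rule dvdE)
    have "x = of_int x'"
      using arg_cong[OF x', of real_of_int] q0 unfolding x by (simp add: field_simps)
    moreover have "2 * int q * (2 * x' * int (4 + 1) - int 4) - int p ^ r * v\<^sup>2 * int (4 + 1) = 1"
      using x' by (simp add: algebra_simps)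
    ultimately show ?case
      using minimal[of q 4 x' v] leg q0 by (simp add: Let_def)
  qed
qed

end
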